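(* The weakening monad $W$ on $[\mathcal H^{\mathrm{op}},\mathbf{Set}]$, i.e. the monad induced by the free-forgetful adjunction $\{w\}\text{-}\mathbf{GAT}\leftrightarrows[\mathcal H^{\mathrm{op}},\mathbf{Set}]$, is strongly cartesian.
   Context: \textbf{Categorical notions.} A functor $F\colon\mathcal C\to\mathcal D$ is local right adjoint if for each $X\in\mathcal C$ the induced functor on slices $F/X\colon\mathcal C/X\to\mathcal D/FX$ is a right adjoint; a monad is local right adjoint if its underlying endofunctor is. A natural transformation is cartesian if all its naturality squares are pullbacks. A monad is cartesian if its underlying endofunctor preserves pullbacks and its unit and multiplication are cartesian; it is strongly cartesian if it is cartesian and local right adjoint. \textbf{Expressions and judgements.} Fix a denumerable set $\mathrm{Var}$ of variables. Given an alphabet $\Xi$, the expressions over $\Xi$ are generated as follows: each $x\in\mathrm{Var}$ is an expression; if $n\geq 0$, $e_1,\dots,e_n$ are expressions and $w\in\Xi$, then $w(e_1,\dots,e_n)$ is an expression (written $w$ when $n=0$). $\mathsf{fv}$ denotes free variables and $e'[e/x]$ substitution of $e$ for $x$ in $e'$. A context is a (possibly empty) list $x_1:T_1,\dots,x_n:T_n$ of distinct variables $x_i$ and expressions $T_i$; $\mathsf{fv}(\Gamma)$ is the set of variables occurring in $\Gamma$. A judgement is a string $\Gamma\vdash T\ \mathsf{type}$ (type judgement), $\Gamma\vdash t:T$ (term judgement), $\Gamma\vdash T=T'\ \mathsf{type}$ (type equality) or $\Gamma\vdash t=t':T$ (term equality), with $\Gamma$ a context and $t,t',T,T'$ expressions;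 its degree is one more than the length of $\Gamma$. The boundary of a judgement is a list of judgements: $\partial(\vdash T\ \mathsf{type})=()$; $\partial(\Gamma,x:T\vdash T'\ \mathsf{type})=(\Gamma\vdash T\ \mathsf{type})$; $\partial(\Gamma\vdash t:T)=(\Gamma\vdash T\ \mathsf{type})$; $\partial(\Gamma\vdash T=T'\ \mathsf{type})=(\Gamma\vdash T\ \mathsf{type},\ \Gamma\vdash T'\ \mathsf{type})$; $\partial(\Gamma\vdash t=t':T)=(\Gamma\vdash t:T,\ \Gamma\vdash t':T)$. \textbf{Deduction rules} (premises $\Longrightarrow$ conclusion; $\mathcal J$ stands for the right-hand side of any of the four judgement forms). \emph{Equality and $\alpha$ rules}: $\Gamma\vdash t:T\Longrightarrow\Gamma\vdash t=t:T$; $\Gamma\vdash t_1=t_2:T\Longrightarrow\Gamma\vdash t_2=t_1:T$; $\Gamma\vdash t_1=t_2:T$ and $\Gamma\vdash t_2=t_3:T\Longrightarrow\Gamma\vdash t_1=t_3:T$; $\Gamma\vdash T\ \mathsf{type}\Longrightarrow\Gamma\vdash T=T\ \mathsf{type}$; $\Gamma\vdash T_1=T_2\ \mathsf{type}\Longrightarrow\Gamma\vdash T_2=T_1\ \mathsf{type}$; $\Gamma\vdash T_1=T_2\ \mathsf{type}$ and $\Gamma\vdash T_2=T_3\ \mathsf{type}\Longrightarrow\Gamma\vdash T_1=T_3\ \mathsf{type}$; $\Gamma\vdash T_1=T_2\ \mathsf{type}$ and $\Gamma\vdash t:T_1\Longrightarrow\Gamma\vdash t:T_2$; $\Gamma\vdash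 T_1=T_2\ \mathsf{type}$ and $\Gamma\vdash t_1=t_2:T_1\Longrightarrow\Gamma\vdash t_1=t_2:T_2$; $\Gamma\vdash\mathcal J\Longrightarrow\sigma\cdot\Gamma\vdash\sigma\cdot\mathcal J$ for any permutation $\sigma\in\mathrm{Sym}(\mathrm{Var})$ acting on variables. \emph{Weakening} ($w$): $\Gamma\vdash T\ \mathsf{type}$ and $\Gamma,\Delta\vdash\mathcal J\Longrightarrow\Gamma,y:T,\Delta\vdash\mathcal J$, for $y\notin\mathsf{fv}(\Gamma)\cup\mathsf{fv}(\Delta)$. \textbf{$\{w\}$-GATs.} A $\{w\}$-GAT $\mathbb T$ consists of a collection $\Omega$ of type-constants, a collection $\Sigma$ of term-constants and a collection $\Lambda$ of basic judgements over $\Omega\amalg\Sigma$ such that: for each $A\in\Omega$ there is a unique judgement in $\Lambda$ of the form $x_1:T_1,\dots,x_{n-1}:T_{n-1}\vdash A(x_1,\dots,x_{n-1})\ \mathsf{type}$; for each $f\in\Sigma$ there is a unique judgement in $\Lambda$ of the form $x_1:T_1,\dots,x_{n-1}:T_{n-1}\vdash f(x_1,\dots,x_{n-1}):T$; all other elements of $\Lambda$ are type or term equality judgements; each element of $\Lambda$ lies in $\mathbb T^*$. Here $\mathbb T^*$, the collection of derived judgements, is the smallest collection closed under all the rules listed above and containing $\mathcal J\in\Lambda$ whenever it contains each judgement in $\partial(\mathcal J)$. An interpretation $\phi\colon\mathbb T\to\mathbb U$ is a function $\phi\colon\mathbb T^*\to\mathbb U^*$ preserving boundaries and preserving deduction: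 viewing each rule with $n$ premises (for each choice of parameters such as $y$ or $\sigma$) as an $n$-ary partial function $r$ on judgements, $\phi(r(\mathcal J_1,\dots,\mathcal J_n))=r(\phi(\mathcal J_1),\dots,\phi(\mathcal J_n))$ whenever both sides are defined. On derived type judgements, $(x_1:S_1,\dots,x_{n-1}:S_{n-1}\vdash S_n\ \mathsf{type})\equiv(y_1:T_1,\dots,y_{m-1}:T_{m-1}\vdash T_m\ \mathsf{type})$ iff $n=m$ and for $1\le i\le n$ the judgement $x_1:S_1,\dots,x_{i-1}:S_{i-1}\vdash S_i=T_i[x_1/y_1,\dots,x_{i-1}/y_{i-1}]\ \mathsf{type}$ is derived. On derived term judgements, $(x_1:S_1,\dots,x_{n-1}:S_{n-1}\vdash s:S_n)\equiv(y_1:T_1,\dots,y_{m-1}:T_{m-1}\vdash t:T_m)$ iff their boundaries are $\equiv$ and $x_1:S_1,\dots,x_{n-1}:S_{n-1}\vdash s=t[x_1/y_1,\dots,x_{n-1}/y_{n-1}]:S_n$ is derived. $\{w\}\text{-}\mathbf{GAT}$ has $\{w\}$-GATs as objects and, as morphisms, interpretations modulo: $\phi\sim\phi'$ iff $\phi(\mathcal J)\equiv\phi'(\mathcal J)$ for each derived type or term judgement $\mathcal J$. \textbf{Type-and-term structures and the monad.} $\mathcal H$ is the category freely generated by the graph with objects $n$ and $n_t$ ($n\ge1$) and arrows $n\to n+1$ and $n\to n_t$. For $X\in[\mathcal H^{\mathrm{op}},\mathbf{Set}]$ the maps $X(n+1)\to X(n)$, $X(n_t)\to X(n)$ are written $\partial$.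 The forgetful functor $V\colon\{w\}\text{-}\mathbf{GAT}\to[\mathcal H^{\mathrm{op}},\mathbf{Set}]$ has $V\mathbb T(n)$ (resp. $V\mathbb T(n_t)$) the set of derived type (resp. term) judgements of degree $n$ modulo $\equiv$, boundaries induced by $\partial$, and $V\phi([\mathcal J])=[\phi(\mathcal J)]$. It has a left adjoint $G$, where $GX$ is the $\{w\}$-GAT whose type- and term-constants are the elements of the sets $X(n)$ and $X(n_t)$ and whose basic judgements are $\mathcal J_A=(x_1:A_1,x_2:A_2(x_1),\dots,x_{n-1}:A_{n-1}(x_1,\dots,x_{n-2})\vdash A(x_1,\dots,x_{n-1})\ \mathsf{type})$ for $A\in X(n)$, where $A_i=\partial^{n-i}A$, and, in the same context, $\mathcal J_a=(\dots\vdash a(x_1,\dots,x_{n-1}):A(x_1,\dots,x_{n-1}))$ for $a\in X(n_t)$ with $\partial a=A$. The adjunction unit is $A\mapsto[\mathcal J_A]$, $a\mapsto[\mathcal J_a]$, and the counit $\epsilon_{\mathbb T}\colon GV\mathbb T\to\mathbb T$ is given on basic judgements by $\mathcal J_{[\mathcal J]}\mapsto\mathcal J$. $W=VG$ is the induced monad. *)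

theory Defs
  imports "HOL-Library.FuncSet" "HOL-Library.Infinite_Typeclass"
begin

section \<open>Categories, functors and adjunctions\<close>

record ('o, 'a) cat =
  Ob :: "'o set"
  Ar :: "'a set"
  Dom :: "'a \<Rightarrow> 'o"
  Cod :: "'a \<Rightarrow> 'o"
  Idn :: "'o \<Rightarrow> 'a"
  Cmp :: "'a \<Rightarrow> 'a \<Rightarrow> 'a"  \<comment> \<open>\<open>Cmp C g f\<close> is g after f\<close>

definition hom :: "('o, 'a) cat \<Rightarrow> 'o \<Rightarrow> 'o \<Rightarrow> 'a set" where
  "hom C a b = {f \<in> Ar C. Dom C f = a \<and> Cod C f = b}"

definition category :: "('o, 'a) cat \<Rightarrow> bool" where
  "category C \<longleftrightarrow>
     (\<forall>f\<in>Ar C. Dom C f \<in> Ob C \<and> Cod C f \<in> Ob C) \<and>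
     (\<forall>a\<in>Ob C. Idn C a \<in> hom C a a) \<and>
     (\<forall>f\<in>Ar C. \<forall>g\<in>Ar C. Cod C f = Dom C g \<longrightarrow> Cmp C g f \<in> hom C (Dom C f) (Cod C g)) \<and>
     (\<forall>f\<in>Ar C. Cmp C f (Idn C (Dom C f)) = f \<and> Cmp C (Idn C (Cod C f)) f = f) \<and>
     (\<forall>f\<in>Ar C. \<forall>g\<in>Ar C. \<forall>h\<in>Ar C. Cod C f = Dom C g \<and> Cod C g = Dom C h \<longrightarrow>
        Cmp C h (Cmp C g f) = Cmp C (Cmp C h g) f)"

record ('o, 'a, 'p, 'b) funct =
  on_ob :: "'o \<Rightarrow> 'p"
  on_ar :: "'a \<Rightarrow> 'b"

definition is_functor :: "('o, 'a) cat \<Rightarrow> ('p, 'b) cat \<Rightarrow> ('o, 'a, 'p, 'b) funct \<Rightarrow> bool" where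
  "is_functor C D F \<longleftrightarrow> category C \<and> category D \<and>
     (\<forall>a\<in>Ob C. on_ob F a \<in> Ob D) \<and>
     (\<forall>f\<in>Ar C. on_ar F f \<in> hom D (on_ob F (Dom C f)) (on_ob F (Cod C f))) \<and>
     (\<forall>a\<in>Ob C. on_ar F (Idn C a) = Idn D (on_ob F a)) \<and>
     (\<forall>f\<in>Ar C. \<forall>g\<in>Ar C. Cod C f = Dom C g \<longrightarrow>
        on_ar F (Cmp C g f) = Cmp D (on_ar F g) (on_ar F f))"

definition id_funct :: "('o, 'a, 'o, 'a) funct" where
  "id_funct = \<lparr>on_ob = (\<lambda>a. a), on_ar = (\<lambda>f. f)\<rparr>"

definition comp_funct ::
  "('p, 'b, 'q, 'c) funct \<Rightarrow> ('o, 'a, 'p, 'b) funct \<Rightarrow> ('o, 'a, 'q, 'c) funct"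
  (infixl "\<cdot>" 70) where
  "G \<cdot> F = \<lparr>on_ob = (\<lambda>a. on_ob G (on_ob F a)), on_ar = (\<lambda>f. on_ar G (on_ar F f))\<rparr>"

definition is_nat_trans :: "('o, 'a) cat \<Rightarrow> ('p, 'b) cat \<Rightarrow>
    ('o, 'a, 'p, 'b) funct \<Rightarrow> ('o, 'a, 'p, 'b) funct \<Rightarrow> ('o \<Rightarrow> 'b) \<Rightarrow> bool" where
  "is_nat_trans C D F G \<tau> \<longleftrightarrow> is_functor C D F \<and> is_functor C D G \<and>
     (\<forall>a\<in>Ob C. \<tau> a \<in> hom D (on_ob F a) (on_ob G a)) \<and>
     (\<forall>f\<in>Ar C. Cmp D (on_ar G f) (\<tau> (Dom C f)) = Cmp D (\<tau> (Cod C f)) (on_ar F f))"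

definition is_adjunction :: "('o, 'a) cat \<Rightarrow> ('p, 'b) cat \<Rightarrow>
    ('o, 'a, 'p, 'b) funct \<Rightarrow> ('p, 'b, 'o, 'a) funct \<Rightarrow> ('o \<Rightarrow> 'a) \<Rightarrow> ('p \<Rightarrow> 'b) \<Rightarrow> bool" where
  "is_adjunction C D L R \<eta> \<epsilon> \<longleftrightarrow>
     is_functor C D L \<and> is_functor D C R \<and>
     is_nat_trans C C id_funct (R \<cdot> L) \<eta> \<and>
     is_nat_trans D D (L \<cdot> R) id_funct \<epsilon> \<and>
     (\<forall>a\<in>Ob C. Cmp D (\<epsilon> (on_ob L a)) (on_ar L (\<eta> a)) = Idn D (on_ob L a)) \<and>
     (\<forall>b\<in>Ob D. Cmp C (on_ar R (\<epsilon> b)) (\<eta> (on_ob R b)) = Idn C (on_ob R b))"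

definition is_right_adjoint ::
  "('p, 'b) cat \<Rightarrow> ('o, 'a) cat \<Rightarrow> ('p, 'b, 'o, 'a) funct \<Rightarrow> bool" where
  "is_right_adjoint D C R \<longleftrightarrow> (\<exists>L \<eta> \<epsilon>. is_adjunction C D L R \<eta> \<epsilon>)"

text \<open>In the slice over \<open>X\<close>, the arrow \<open>(f, h, g)\<close> is \<open>h\<close> regarded as an arrow from \<open>f\<close> to \<open>g\<close>.\<close>

definition slice :: "('o, 'a) cat \<Rightarrow> 'o \<Rightarrow> ('a, 'a \<times> 'a \<times> 'a) cat" where
  "slice C X =
     \<lparr>Ob = {f \<in> Ar C. Cod C f = X},
      Ar = {(f, h, g). f \<in> Ar C \<and> Cod C f = X \<and> g \<in> Ar C \<and> Cod C g = X \<and>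
                       h \<in> hom C (Dom C f) (Dom C g) \<and> Cmp C g h = f},
      Dom = (\<lambda>(f, h, g). f),
      Cod = (\<lambda>(f, h, g). g),
      Idn = (\<lambda>f. (f, Idn C (Dom C f), f)),
      Cmp = (\<lambda>(_, k, l) (f, h, _). (f, Cmp C k h, l))\<rparr>"

definition slice_funct ::
  "('o, 'a, 'p, 'b) funct \<Rightarrow> ('a, 'a \<times> 'a \<times> 'a, 'b, 'b \<times> 'b \<times> 'b) funct" where
  "slice_funct F =
     \<lparr>on_ob = on_ar F, on_ar = (\<lambda>(f, h, g). (on_ar F f, on_ar F h, on_ar F g))\<rparr>"

definition local_right_adjoint ::
  "('o, 'a) cat \<Rightarrow> ('p, 'b) cat \<Rightarrow> ('o, 'a, 'p, 'b) funct \<Rightarrow> bool" where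
  "local_right_adjoint C D F \<longleftrightarrow> is_functor C D F \<and>
     (\<forall>X\<in>Ob C. is_right_adjoint (slice C X) (slice D (on_ob F X)) (slice_funct F))"


section \<open>Pullbacks and cartesian monads\<close>

text \<open>\<open>p\<close>, \<open>q\<close> are the projections of a pullback of \<open>f\<close> and \<open>g\<close>, with \<open>f p = g q\<close>.\<close>

definition is_pullback :: "('o, 'a) cat \<Rightarrow> 'a \<Rightarrow> 'a \<Rightarrow> 'a \<Rightarrow> 'a \<Rightarrow> bool" where
  "is_pullback C p q f g \<longleftrightarrow>
     p \<in> Ar C \<and> q \<in> Ar C \<and> f \<in> Ar C \<and> g \<in> Ar C \<and>
     Dom C p = Dom C q \<and> Cod C p = Dom C f \<and> Cod C q = Dom C g \<and> Cod C f = Cod C g \<and>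
     Cmp C f p = Cmp C g q \<and>
     (\<forall>h\<in>Ar C. \<forall>k\<in>Ar C.
        Dom C h = Dom C k \<and> Cod C h = Dom C f \<and> Cod C k = Dom C g \<and> Cmp C f h = Cmp C g k \<longrightarrow>
        (\<exists>!u. u \<in> hom C (Dom C h) (Dom C p) \<and> Cmp C p u = h \<and> Cmp C q u = k))"

definition preserves_pullbacks ::
  "('o, 'a) cat \<Rightarrow> ('p, 'b) cat \<Rightarrow> ('o, 'a, 'p, 'b) funct \<Rightarrow> bool" where
  "preserves_pullbacks C D F \<longleftrightarrow>
     (\<forall>p q f g. is_pullback C p q f g \<longrightarrow>
        is_pullback D (on_ar F p) (on_ar F q) (on_ar F f) (on_ar F g))"

definition cartesian_nat_trans :: "('o, 'a) cat \<Rightarrow> ('p, 'b) cat \<Rightarrow>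
    ('o, 'a, 'p, 'b) funct \<Rightarrow> ('o, 'a, 'p, 'b) funct \<Rightarrow> ('o \<Rightarrow> 'b) \<Rightarrow> bool" where
  "cartesian_nat_trans C D F G \<tau> \<longleftrightarrow> is_nat_trans C D F G \<tau> \<and>
     (\<forall>f\<in>Ar C. is_pullback D (\<tau> (Dom C f)) (on_ar F f) (on_ar G f) (\<tau> (Cod C f)))"

record ('o, 'a) monad =
  endo :: "('o, 'a, 'o, 'a) funct"
  unit :: "'o \<Rightarrow> 'a"
  mult :: "'o \<Rightarrow> 'a"

definition is_monad :: "('o, 'a) cat \<Rightarrow> ('o, 'a) monad \<Rightarrow> bool" where
  "is_monad C M \<longleftrightarrow>
     (let T = endo M; \<eta> = unit M; \<mu> = mult M in
      is_functor C C T \<and>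
      is_nat_trans C C id_funct T \<eta> \<and>
      is_nat_trans C C (T \<cdot> T) T \<mu> \<and>
      (\<forall>a\<in>Ob C. Cmp C (\<mu> a) (\<eta> (on_ob T a)) = Idn C (on_ob T a) \<and>
                Cmp C (\<mu> a) (on_ar T (\<eta> a)) = Idn C (on_ob T a) \<and>
                Cmp C (\<mu> a) (\<mu> (on_ob T a)) = Cmp C (\<mu> a) (on_ar T (\<mu> a))))"

definition cartesian_monad :: "('o, 'a) cat \<Rightarrow> ('o, 'a) monad \<Rightarrow> bool" where
  "cartesian_monad C M \<longleftrightarrow> is_monad C M \<and>
     preserves_pullbacks C C (endo M) \<and>
     cartesian_nat_trans C C id_funct (endo M) (unit M) \<and>
     cartesian_nat_trans C C (endo M \<cdot> endo M) (endo M) (mult M)"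

definition strongly_cartesian_monad :: "('o, 'a) cat \<Rightarrow> ('o, 'a) monad \<Rightarrow> bool" where
  "strongly_cartesian_monad C M \<longleftrightarrow> cartesian_monad C M \<and> local_right_adjoint C C (endo M)"

definition induced_monad :: "('o, 'a, 'p, 'b) funct \<Rightarrow> ('p, 'b, 'o, 'a) funct \<Rightarrow>
    ('o \<Rightarrow> 'a) \<Rightarrow> ('p \<Rightarrow> 'b) \<Rightarrow> ('o, 'a) monad" where
  "induced_monad L R \<eta> \<epsilon> =
     \<lparr>endo = R \<cdot> L, unit = \<eta>, mult = (\<lambda>a. on_ar R (\<epsilon> (on_ob L a)))\<rparr>"


section \<open>Expressions and judgements\<close>

type_synonym var = nat

datatype (evars: 'v, ecns: 'w) expr = Var 'v | App 'w "('v, 'w) expr list"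
  for map: map_expr

type_synonym ('v, 'w) ctx = "('v \<times> ('v, 'w) expr) list"

datatype (rvars: 'v, rcns: 'w) rhs =
    Typ "('v, 'w) expr"
  | Trm "('v, 'w) expr" "('v, 'w) expr"
  | TypEq "('v, 'w) expr" "('v, 'w) expr"
  | TrmEq "('v, 'w) expr" "('v, 'w) expr" "('v, 'w) expr"  \<comment> \<open>\<open>TrmEq t t' T\<close> is \<open>t = t' : T\<close>\<close>
  for map: map_rhs

datatype (jvars: 'v, jcns: 'w) jud =
    Jud "('v \<times> ('v, 'w) expr) list" "('v, 'w) rhs"  (infix "\<turnstile>" 55)
  for map: map_jud

definition cvars :: "('v, 'w) ctx \<Rightarrow> 'v set" where
  "cvars \<Gamma> = (\<Union>(x, T)\<in>set \<Gamma>. insert x (evars T))"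

fun is_jud :: "('v, 'w) jud \<Rightarrow> bool" where
  "is_jud (\<Gamma> \<turnstile> R) = distinct (map fst \<Gamma>)"

text \<open>\<open>map_expr (ren xs ys) id T\<close> is the simultaneous substitution \<open>T[xs/ys]\<close>.\<close>

definition ren :: "'v list \<Rightarrow> 'v list \<Rightarrow> 'v \<Rightarrow> 'v" where
  "ren xs ys z = (case map_of (zip ys xs) z of None \<Rightarrow> z | Some x \<Rightarrow> x)"

fun boundary :: "('v, 'w) jud \<Rightarrow> ('v, 'w) jud list" where
  "boundary (\<Gamma> \<turnstile> Typ T) = (if \<Gamma> = [] then [] else [butlast \<Gamma> \<turnstile> Typ (snd (last \<Gamma>))])"
| "boundary (\<Gamma> \<turnstile> Trm t T) = [\<Gamma> \<turnstile> Typ T]"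
| "boundary (\<Gamma> \<turnstile> TypEq T T') = [\<Gamma> \<turnstile> Typ T, \<Gamma> \<turnstile> Typ T']"
| "boundary (\<Gamma> \<turnstile> TrmEq t t' T) = [\<Gamma> \<turnstile> Trm t T, \<Gamma> \<turnstile> Trm t' T]"

datatype rule =
    TrmRefl | TrmSym | TrmTrans | TypRefl | TypSym | TypTrans | TrmConv | TrmEqConv
  | Perm "var \<Rightarrow> var" | Weak var

text \<open>
  \<open>rule_app r Js J\<close>: the partial function \<open>r\<close> on lists of judgements is defined at \<open>Js\<close>, with
  value \<open>J\<close>.
\<close>

inductive rule_app :: "rule \<Rightarrow> (var, 'w) jud list \<Rightarrow> (var, 'w) jud \<Rightarrow> bool" where
  "rule_app TrmRefl [\<Gamma> \<turnstile> Trm t T] (\<Gamma> \<turnstile> TrmEq t t T)"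
| "rule_app TrmSym [\<Gamma> \<turnstile> TrmEq t1 t2 T] (\<Gamma> \<turnstile> TrmEq t2 t1 T)"
| "rule_app TrmTrans [\<Gamma> \<turnstile> TrmEq t1 t2 T, \<Gamma> \<turnstile> TrmEq t2 t3 T] (\<Gamma> \<turnstile> TrmEq t1 t3 T)"
| "rule_app TypRefl [\<Gamma> \<turnstile> Typ T] (\<Gamma> \<turnstile> TypEq T T)"
| "rule_app TypSym [\<Gamma> \<turnstile> TypEq T1 T2] (\<Gamma> \<turnstile> TypEq T2 T1)"
| "rule_app TypTrans [\<Gamma> \<turnstile> TypEq T1 T2, \<Gamma> \<turnstile> TypEq T2 T3] (\<Gamma> \<turnstile> TypEq T1 T3)"
| "rule_app TrmConv [\<Gamma> \<turnstile> TypEq T1 T2, \<Gamma> \<turnstile> Trm t T1] (\<Gamma> \<turnstile> Trm t T2)"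
| "rule_app TrmEqConv [\<Gamma> \<turnstile> TypEq T1 T2, \<Gamma> \<turnstile> TrmEq t1 t2 T1] (\<Gamma> \<turnstile> TrmEq t1 t2 T2)"
| "bij \<sigma> \<Longrightarrow> rule_app (Perm \<sigma>) [J] (map_jud \<sigma> id J)"
| "y \<notin> cvars \<Gamma> \<union> cvars \<Delta> \<Longrightarrow>
     rule_app (Weak y) [\<Gamma> \<turnstile> Typ T, \<Gamma> @ \<Delta> \<turnstile> R] (\<Gamma> @ (y, T) # \<Delta> \<turnstile> R)"


section \<open>The category of generalized algebraic theories with weakening\<close>

record ('c, 'd) gat =
  TyC :: "'c set"
  TmC :: "'d set"
  Ax :: "(var, 'c + 'd) jud set"

inductive_set derived :: "('c, 'd) gat \<Rightarrow> (var, 'c + 'd) jud set" for T :: "('c, 'd) gat" where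
  basic: "J \<in> Ax T \<Longrightarrow> \<forall>B\<in>set (boundary J). B \<in> derived T \<Longrightarrow> J \<in> derived T"
| rule: "rule_app r Js J \<Longrightarrow> \<forall>K\<in>set Js. K \<in> derived T \<Longrightarrow> J \<in> derived T"

definition introduces_type :: "(var, 'c + 'd) jud \<Rightarrow> 'c \<Rightarrow> bool" where
  "introduces_type J A \<longleftrightarrow> (\<exists>\<Gamma>. J = \<Gamma> \<turnstile> Typ (App (Inl A) (map (Var \<circ> fst) \<Gamma>)))"

definition introduces_term :: "(var, 'c + 'd) jud \<Rightarrow> 'd \<Rightarrow> bool" where
  "introduces_term J f \<longleftrightarrow> (\<exists>\<Gamma> T. J = \<Gamma> \<turnstile> Trm (App (Inr f) (map (Var \<circ> fst) \<Gamma>)) T)"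

definition is_equality :: "('v, 'w) jud \<Rightarrow> bool" where
  "is_equality J \<longleftrightarrow> (\<exists>\<Gamma> T T'. J = \<Gamma> \<turnstile> TypEq T T') \<or> (\<exists>\<Gamma> t t' T. J = \<Gamma> \<turnstile> TrmEq t t' T)"

definition is_gat :: "('c, 'd) gat \<Rightarrow> bool" where
  "is_gat T \<longleftrightarrow>
     (\<forall>J\<in>Ax T. is_jud J \<and> jcns J \<subseteq> TyC T <+> TmC T) \<and>
     (\<forall>A\<in>TyC T. \<exists>!J. J \<in> Ax T \<and> introduces_type J A) \<and>
     (\<forall>f\<in>TmC T. \<exists>!J. J \<in> Ax T \<and> introduces_term J f) \<and>
     (\<forall>J\<in>Ax T. (\<exists>A\<in>TyC T. introduces_type J A) \<or> (\<exists>f\<in>TmC T. introduces_term J f) \<or>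
               is_equality J) \<and>
     Ax T \<subseteq> derived T"

text \<open>
  Derived type (resp. term) judgements by the length of the context, which is one less than the
  degree.
\<close>

definition type_juds :: "('c, 'd) gat \<Rightarrow> nat \<Rightarrow> (var, 'c + 'd) jud set" where
  "type_juds T k = {J \<in> derived T. \<exists>\<Gamma> S. J = \<Gamma> \<turnstile> Typ S \<and> length \<Gamma> = k}"

definition term_juds :: "('c, 'd) gat \<Rightarrow> nat \<Rightarrow> (var, 'c + 'd) jud set" where
  "term_juds T k = {J \<in> derived T. \<exists>\<Gamma> s S. J = \<Gamma> \<turnstile> Trm s S \<and> length \<Gamma> = k}"

inductive_set jeq :: "('c, 'd) gat \<Rightarrow> ((var, 'c + 'd) jud \<times> (var, 'c + 'd) jud) set"
  for T :: "('c, 'd) gat" where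
  jeq_type:
  "\<lbrakk> \<Gamma> \<turnstile> Typ S \<in> derived T; \<Delta> \<turnstile> Typ S' \<in> derived T; length \<Gamma> = length \<Delta>;
     \<forall>i\<le>length \<Gamma>. take i \<Gamma> \<turnstile> TypEq ((map snd \<Gamma> @ [S]) ! i)
        (map_expr (ren (take i (map fst \<Gamma>)) (take i (map fst \<Delta>))) id ((map snd \<Delta> @ [S']) ! i))
        \<in> derived T \<rbrakk>
   \<Longrightarrow> (\<Gamma> \<turnstile> Typ S, \<Delta> \<turnstile> Typ S') \<in> jeq T"
| jeq_term:
  "\<lbrakk> \<Gamma> \<turnstile> Trm s S \<in> derived T; \<Delta> \<turnstile> Trm t S' \<in> derived T;
     (\<Gamma> \<turnstile> Typ S, \<Delta> \<turnstile> Typ S') \<in> jeq T;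
     \<Gamma> \<turnstile> TrmEq s (map_expr (ren (map fst \<Gamma>) (map fst \<Delta>)) id t) S \<in> derived T \<rbrakk>
   \<Longrightarrow> (\<Gamma> \<turnstile> Trm s S, \<Delta> \<turnstile> Trm t S') \<in> jeq T"

type_synonym ('c, 'd) interp = "(var, 'c + 'd) jud \<Rightarrow> (var, 'c + 'd) jud"

definition is_interp :: "('c, 'd) gat \<Rightarrow> ('c, 'd) gat \<Rightarrow> ('c, 'd) interp \<Rightarrow> bool" where
  "is_interp T U \<phi> \<longleftrightarrow>
     \<phi> \<in> derived T \<rightarrow> derived U \<and>
     (\<forall>J\<in>derived T. boundary (\<phi> J) = map \<phi> (boundary J)) \<and>
     (\<forall>r Js J K. set Js \<subseteq> derived T \<and> rule_app r Js J \<and> rule_app r (map \<phi> Js) K \<longrightarrow> \<phi> J = K)"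

text \<open>
  Interpretations are total functions here, but \<open>interp_eq\<close> ignores their values off
  \<open>derived T\<close>.
\<close>

definition interp_eq ::
  "('c, 'd) gat \<Rightarrow> ('c, 'd) gat \<Rightarrow> (('c, 'd) interp \<times> ('c, 'd) interp) set" where
  "interp_eq T U = {(\<phi>, \<psi>). is_interp T U \<phi> \<and> is_interp T U \<psi> \<and>
     (\<forall>k. \<forall>J \<in> type_juds T k \<union> term_juds T k. (\<phi> J, \<psi> J) \<in> jeq U)}"

type_synonym ('c, 'd) gat_arrow = "('c, 'd) gat \<times> ('c, 'd) interp set \<times> ('c, 'd) gat"

definition gat_cat :: "(('c, 'd) gat, ('c, 'd) gat_arrow) cat" where
  "gat_cat =
     \<lparr>Ob = {T. is_gat T},
      Ar = {(T, a, U). is_gat T \<and> is_gat U \<and> a \<in> {\<phi>. is_interp T U \<phi>} // interp_eq T U},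
      Dom = (\<lambda>(T, a, U). T),
      Cod = (\<lambda>(T, a, U). U),
      Idn = (\<lambda>T. (T, interp_eq T T `` {id}, T)),
      Cmp = (\<lambda>(_, b, V) (T, a, _). (T, interp_eq T V `` {\<psi> \<circ> \<phi> | \<phi> \<psi>. \<phi> \<in> a \<and> \<psi> \<in> b}, V))\<rparr>"


section \<open>Type-and-term structures\<close>

text \<open>
  The graph generating \<open>\<H>\<close>. The vertices \<open>TyO k\<close> and \<open>TmO k\<close> are the objects written
  \<open>n\<close> and \<open>n\<^sub>t\<close> with \<open>n = k + 1\<close>, so that \<open>k\<close> is a context length and no side
  condition \<open>n \<ge> 1\<close> is needed.
\<close>

datatype hob = TyO nat | TmO nat
datatype har = Ext nat | Tm nat

fun src :: "har \<Rightarrow> hob" where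
  "src (Ext k) = TyO k"
| "src (Tm k) = TyO k"

fun tgt :: "har \<Rightarrow> hob" where
  "tgt (Ext k) = TyO (Suc k)"
| "tgt (Tm k) = TmO k"

text \<open>
  A presheaf on the category freely generated by a graph is given by its values on the vertices and
  on the edges, and naturality is naturality at the edges. The sets are subsets of the type
  \<open>'u\<close>, which plays the role of a universe of small sets.
\<close>

record 'u psh =
  elts :: "hob \<Rightarrow> 'u set"
  bd :: "har \<Rightarrow> 'u \<Rightarrow> 'u"

definition is_psh :: "'u psh \<Rightarrow> bool" where
  "is_psh X \<longleftrightarrow> (\<forall>e. bd X e \<in> elts X (tgt e) \<rightarrow> elts X (src e))"

type_synonym 'u psh_arrow = "'u psh \<times> (hob \<Rightarrow> 'u \<Rightarrow> 'u) \<times> 'u psh"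

definition psh_cat :: "('u psh, 'u psh_arrow) cat" where
  "psh_cat =
     \<lparr>Ob = {X. is_psh X},
      Ar = {(X, f, Y). is_psh X \<and> is_psh Y \<and> (\<forall>h. f h \<in> elts X h \<rightarrow>\<^sub>E elts Y h) \<and>
              (\<forall>e. \<forall>x\<in>elts X (tgt e). f (src e) (bd X e x) = bd Y e (f (tgt e) x))},
      Dom = (\<lambda>(X, f, Y). X),
      Cod = (\<lambda>(X, f, Y). Y),
      Idn = (\<lambda>X. (X, \<lambda>h. \<lambda>x\<in>elts X h. x, X)),
      Cmp = (\<lambda>(_, g, Z) (X, f, _). (X, \<lambda>h. compose (elts X h) (g h) (f h), Z))\<rparr>"


section \<open>The weakening monad\<close>

text \<open>
  Equivalence classes of judgements have to become elements of the universe \<open>'u\<close>. They are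
  encoded by a representative and a fixed injection of judgements into \<open>'u\<close>. As \<open>'u\<close> is
  infinite, it has room for the judgements over \<open>'u\<close>-small alphabets.
\<close>

type_synonym 'u con = "nat \<times> 'u"
type_synonym 'u sgat = "('u con, 'u con) gat"
type_synonym 'u sjud = "(var, 'u con + 'u con) jud"

lemma ex_inj_jud: "\<exists>f :: 'u::infinite sjud \<Rightarrow> 'u. inj f"
proof -
  obtain i :: "nat \<Rightarrow> 'u" where i: "inj i"
    using infinite_countable_subset[OF infinite_UNIV[where 'a = 'u]] by auto
  obtain p :: "'u \<times> 'u \<Rightarrow> 'u" where p: "inj p"
    using card_of_Times_same_infinite[OF infinite_UNIV[where 'a = 'u]]
    unfolding card_of_ordIso[symmetric] by (auto simp: bij_betw_def)
  have [simp]: "i m = i n \<longleftrightarrow> m = n" "p x = p y \<longleftrightarrow> x = y" for m n x y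
    using i p by (auto dest: injD)
  define c where "c = (\<lambda>w :: 'u con + 'u con.
    case w of Inl (n, a) \<Rightarrow> p (i 0, p (i n, a)) | Inr (n, a) \<Rightarrow> p (i 1, p (i n, a)))"
  have [simp]: "c v = c w \<longleftrightarrow> v = w" for v w
    by (auto simp: c_def split: sum.splits)
  define l where "l = (\<lambda>xs. foldr (\<lambda>x r. p (i 1, p (x, r))) xs (p (i 0, i 0)))"
  have l [simp]: "l (map f xs) = l (map g ys) \<longleftrightarrow> map f xs = map g ys"
    for f :: "'b \<Rightarrow> 'u" and g :: "'c \<Rightarrow> 'u" and xs ys
  proof (induction xs arbitrary: ys)
    case Nil
    then show ?case by (cases ys) (auto simp: l_def)
  next
    case (Cons x xs)
    then show ?case by (cases ys) (auto simp: l_def)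
  qed
  define e where "e = rec_expr (\<lambda>v :: var. p (i 0, i v)) (\<lambda>w es. p (i 1, p (c w, l (map snd es))))"
  have e_simps: "e (Var v) = p (i 0, i v)" "e (App w es) = p (i 1, p (c w, l (map e es)))"
    for v w es by (simp_all add: e_def o_def)
  have e [simp]: "e s = e t \<longleftrightarrow> s = t" for s t
  proof (induction s arbitrary: t)
    case (Var v)
    then show ?case by (cases t) (auto simp: e_simps)
  next
    case (App w es)
    have "map e es = map e es' \<longleftrightarrow> es = es'" for es'
      using App by (induction es arbitrary: es') (auto simp: Cons_eq_map_conv)
    then show ?case by (cases t) (auto simp: e_simps)
  qed
  define r where "r = (\<lambda>R. case R of Typ T \<Rightarrow> p (i 0, e T)
       | Trm t T \<Rightarrow> p (i 1, p (e t, e T))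
       | TypEq T T' \<Rightarrow> p (i 2, p (e T, e T'))
       | TrmEq t t' T \<Rightarrow> p (i 3, p (e t, p (e t', e T))))"
  have r [simp]: "r R = r R' \<longleftrightarrow> R = R'" for R R'
    by (cases R; cases R') (simp_all add: r_def)
  define b where "b = (\<lambda>(x, T). p (i x, e T))"
  have "inj b"
    by (auto simp: b_def intro: injI)
  then have b: "map b \<Gamma> = map b \<Delta> \<longleftrightarrow> \<Gamma> = \<Delta>" for \<Gamma> \<Delta>
    by (rule inj_map_eq_map)
  define g where "g = (\<lambda>J. case J of \<Gamma> \<turnstile> R \<Rightarrow> p (l (map b \<Gamma>), r R))"
  have "g J = g K \<longleftrightarrow> J = K" for J K
    by (cases J; cases K) (simp add: g_def b)
  then have "inj g"
    by (simp add: inj_def)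
  then show ?thesis by blast
qed

definition encode :: "'j set \<Rightarrow> 'u" where
  "encode C = (SOME f :: 'j \<Rightarrow> 'u. inj f) (SOME J. J \<in> C)"

fun juds_at :: "('c, 'd) gat \<Rightarrow> hob \<Rightarrow> (var, 'c + 'd) jud set" where
  "juds_at T (TyO k) = type_juds T k"
| "juds_at T (TmO k) = term_juds T k"

definition cls :: "'u sgat \<Rightarrow> 'u sjud \<Rightarrow> 'u" where
  "cls T J = encode (jeq T `` {J})"

definition rep :: "'u sgat \<Rightarrow> hob \<Rightarrow> 'u \<Rightarrow> 'u sjud" where
  "rep T h x = (SOME J. J \<in> juds_at T h \<and> cls T J = x)"

definition V :: "('u sgat, ('u con, 'u con) gat_arrow, 'u psh, 'u psh_arrow) funct" where
  "V =
     (let ob = (\<lambda>T. \<lparr>elts = (\<lambda>h. cls T ` juds_at T h),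
                     bd = (\<lambda>e x. cls T (hd (boundary (rep T (tgt e) x))))\<rparr>)
      in \<lparr>on_ob = ob,
          on_ar = (\<lambda>(T, a, U).
            (ob T, \<lambda>h. \<lambda>x\<in>elts (ob T) h. cls U ((SOME \<phi>. \<phi> \<in> a) (rep T h x)), ob U))\<rparr>)"

text \<open>
  \<open>free_ctx X k A\<close> is the context \<open>x\<^sub>1 : A\<^sub>1, \<dots>, x\<^sub>k : A\<^sub>k(x\<^sub>1, \<dots>, x\<^sub>k\<^sub>-\<^sub>1)\<close> in which
  \<open>A\<close>, an element of \<open>elts X (TyO k)\<close>, is introduced. The variable \<open>x\<^sub>i\<^sub>+\<^sub>1\<close> is the
  number \<open>i\<close>.
\<close>

definition gen_app :: "'w \<Rightarrow> nat \<Rightarrow> (var, 'w) expr" where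
  "gen_app w k = App w (map Var [0..<k])"

fun free_ctx :: "'u psh \<Rightarrow> nat \<Rightarrow> 'u \<Rightarrow> (var, 'u con + 'u con) ctx" where
  "free_ctx X 0 A = []"
| "free_ctx X (Suc k) A =
     (let B = bd X (Ext k) A in free_ctx X k B @ [(k, gen_app (Inl (k, B)) k)])"

fun gen_jud :: "'u psh \<Rightarrow> hob \<Rightarrow> 'u \<Rightarrow> 'u sjud" where
  "gen_jud X (TyO k) A = free_ctx X k A \<turnstile> Typ (gen_app (Inl (k, A)) k)"
| "gen_jud X (TmO k) a =
     (let A = bd X (Tm k) a
      in free_ctx X k A \<turnstile> Trm (gen_app (Inr (k, a)) k) (gen_app (Inl (k, A)) k))"

definition free_gat :: "'u psh \<Rightarrow> 'u sgat" where
  "free_gat X =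
     \<lparr>TyC = {(k, A). A \<in> elts X (TyO k)},
      TmC = {(k, a). a \<in> elts X (TmO k)},
      Ax = {gen_jud X h x | h x. x \<in> elts X h}\<rparr>"

definition gat_unit :: "'u psh \<Rightarrow> 'u psh_arrow" where
  "gat_unit X =
     (X, \<lambda>h. \<lambda>x\<in>elts X h. cls (free_gat X) (gen_jud X h x), on_ob V (free_gat X))"

text \<open>
  The morphism from the free theory on \<open>X\<close> to \<open>T\<close> corresponding to \<open>h : X \<rightarrow> V T\<close>
  under the adjunction.
\<close>

definition transpose ::
  "'u psh \<Rightarrow> 'u sgat \<Rightarrow> 'u psh_arrow \<Rightarrow> ('u con, 'u con) gat_arrow" where
  "transpose X T h =
     (THE m. m \<in> hom gat_cat (free_gat X) T \<and> Cmp psh_cat (on_ar V m) (gat_unit X) = h)"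

definition G :: "('u psh, 'u psh_arrow, 'u sgat, ('u con, 'u con) gat_arrow) funct" where
  "G = \<lparr>on_ob = free_gat,
        on_ar = (\<lambda>f. let X = Dom psh_cat f; Y = Cod psh_cat f
                     in transpose X (free_gat Y) (Cmp psh_cat (gat_unit Y) f))\<rparr>"

text \<open>
  As \<open>on_ar V m\<close> composed with the unit is the identity, \<open>gat_counit T\<close> sends the basic
  judgement introducing the constant \<open>[J]\<close> to \<open>J\<close>, up to the equivalence of judgements.
\<close>

definition gat_counit :: "'u sgat \<Rightarrow> ('u con, 'u con) gat_arrow" where
  "gat_counit T = transpose (on_ob V T) T (Idn psh_cat (on_ob V T))"

definition weakening_monad :: "('u psh, 'u psh_arrow) monad" where
  "weakening_monad = induced_monad G V gat_unit gat_counit"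

end

theory Submission
  imports Defs
begin

text \<open>
  A free theory has no equality axioms. Hence its derived equalities are the reflexive ones, and
  equivalent judgements are those that differ by a renaming of variables. Moreover every derived
  type is a constant \<open>A\<close> applied to variables \<open>y\<^sub>1, \<dots>, y\<^sub>k\<close> of its context, and
  the type of \<open>y\<^sub>k\<close> is forced to be the boundary of \<open>A\<close> applied to
  \<open>y\<^sub>1, \<dots>, y\<^sub>k\<^sub>-\<^sub>1\<close> (\<open>derived_free_gat\<close>). So an element \<open>w\<close> of
  \<open>W X\<close> is determined by its boundary and its \<^emph>\<open>top\<close>: the list \<open>sel w\<close> of the
  positions in the context of the variables to which the head constant is applied, and the head
  constant \<open>lab w\<close>, an element of \<open>X\<close>. The only condition on the top of a type
  concerns the last selected position: the top found there must be the list without its last entry,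
  together with the boundary of the label. For a term, the top of its type must be the same list with the
  boundary of the label (\<open>top_W\<close>). It follows that an arrow \<open>Y \<rightarrow> W X\<close> is the same thing
  as a family of tops indexed by the elements of \<open>Y\<close> that satisfies this condition
  (\<open>top_data_arrow\<close>, \<open>ex_arrow\<close>, \<open>arrow_eqI\<close>). All later identities are
  checked on tops.

  The transpose of \<open>F : X \<rightarrow> W Y\<close> replaces each constant of \<open>X\<close> in a judgement by the
  judgement over \<open>Y\<close> that \<open>F\<close> assigns to it. This is an interpretation, and it is the
  only one up to equivalence with the right values on the basic judgements: interpretations commute
  with the permutations of the variables and so cannot introduce a variable (\<open>interp_vars\<close>),
  which pins down their values on the basic judgements and then, by the rules, everywhere
  (\<open>transpose_eq\<close>). The resulting formulas are: \<open>W f\<close> keeps positions and applies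
  \<open>f\<close> to labels; the unit selects all positions; the multiplication composes the list of
  positions of an element with that of its label. The target is always a free theory here. This
  matters, because the transpose is a strict function on judgements, and a type of the context of a
  judgement cannot in general be exchanged for an equal one.

  Fix a structure \<open>Y\<close> and lists of positions \<open>s\<close> occurring in an arrow out of \<open>Y\<close>. Let
  \<open>nodes Y s\<close> consist of the elements \<open>y\<close> of \<open>Y\<close>, each one placed at the object at
  which the label of \<open>y\<close> lives, with the boundary that goes to the last selected position. The
  condition on tops says exactly that labels form an arrow out of \<open>nodes Y s\<close>. So arrows
  \<open>Y \<rightarrow> W Z\<close> with positions \<open>s\<close> are the arrows \<open>nodes Y s \<rightarrow> Z\<close>
  (\<open>ex_mate\<close>). As positions are unchanged by \<open>W f\<close>, this gives a left adjoint on each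
  slice, and also the preservation of pullbacks. The unit is cartesian because an element with all
  positions selected is determined by its label. The multiplication is cartesian because a judgement
  over \<open>X\<close>, together with a decomposition of its image over \<open>Y\<close>, has exactly one
  decomposition over \<open>X\<close>: its positions are given, and its labels are given on all nodes
  (\<open>mult_cartesian\<close>).
\<close>

section \<open>Right adjoints from universal arrows\<close>

lemma homD: "f \<in> hom C a b \<Longrightarrow> f \<in> Ar C \<and> Dom C f = a \<and> Cod C f = b"
  by (simp add: hom_def)

lemma hom_arrow: "f \<in> Ar C \<Longrightarrow> f \<in> hom C (Dom C f) (Cod C f)"
  by (simp add: hom_def)

lemma hom_ob:
  assumes "category C" "f \<in> hom C a b" shows "a \<in> Ob C" "b \<in> Ob C"
  using assms by (auto simp: category_def hom_def)

lemma comp_hom: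
  assumes "category C" "f \<in> hom C a b" "g \<in> hom C b c" shows "Cmp C g f \<in> hom C a c"
  using assms unfolding category_def hom_def by fastforce

lemma comp_assoc:
  assumes "category C" "f \<in> hom C a b" "g \<in> hom C b c" "h \<in> hom C c d"
  shows "Cmp C h (Cmp C g f) = Cmp C (Cmp C h g) f"
  using assms unfolding category_def hom_def by fastforce

lemma idn_hom: "category C \<Longrightarrow> a \<in> Ob C \<Longrightarrow> Idn C a \<in> hom C a a"
  by (simp add: category_def)

lemma idn_comp:
  assumes "category C" "f \<in> hom C a b"
  shows "Cmp C f (Idn C a) = f" "Cmp C (Idn C b) f = f"
  using assms by (auto simp: category_def hom_def)

lemma functor_hom:
  assumes "is_functor C D F" "f \<in> hom C a b" shows "on_ar F f \<in> hom D (on_ob F a) (on_ob F b)"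
  using assms by (auto simp: is_functor_def hom_def)

lemma functor_ob: "is_functor C D F \<Longrightarrow> a \<in> Ob C \<Longrightarrow> on_ob F a \<in> Ob D"
  by (simp add: is_functor_def)

lemma functor_comp:
  assumes "is_functor C D F" "f \<in> hom C a b" "g \<in> hom C b c"
  shows "on_ar F (Cmp C g f) = Cmp D (on_ar F g) (on_ar F f)"
  using assms by (auto simp: is_functor_def hom_def)

lemma functor_idn: "is_functor C D F \<Longrightarrow> a \<in> Ob C \<Longrightarrow> on_ar F (Idn C a) = Idn D (on_ob F a)"
  by (simp add: is_functor_def)

lemma functor_cat: "is_functor C D F \<Longrightarrow> category C" "is_functor C D F \<Longrightarrow> category D"
  by (simp_all add: is_functor_def)

lemma is_functor_id: "category C \<Longrightarrow> is_functor C C id_funct"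
  by (auto simp: is_functor_def id_funct_def category_def hom_def)

lemma is_functor_comp:
  assumes "is_functor C D F" "is_functor D E H" shows "is_functor C E (H \<cdot> F)"
  using assms by (auto simp: is_functor_def comp_funct_def hom_def)

text \<open>
  Functoriality of the left adjoint, naturality of the counit and the triangle identities are all
  equations between arrows out of an object \<open>l a\<close>. By universality it suffices to compare their
  composites with \<open>u a\<close>.
\<close>

lemma right_adjoint_if_universal_arrows:
  assumes R: "is_functor D C R"
    and univ: "\<And>a. a \<in> Ob C \<Longrightarrow> \<exists>b u. b \<in> Ob D \<and> u \<in> hom C a (on_ob R b) \<and>
      (\<forall>b'\<in>Ob D. \<forall>k\<in>hom C a (on_ob R b'). \<exists>!m. m \<in> hom D b b' \<and> Cmp C (on_ar R m) u = k)"
  shows "is_right_adjoint D C R"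
proof -
  note cD = functor_cat(1)[OF R] and cC = functor_cat(2)[OF R]
  obtain l u where l: "\<And>a. a \<in> Ob C \<Longrightarrow> l a \<in> Ob D"
    and u: "\<And>a. a \<in> Ob C \<Longrightarrow> u a \<in> hom C a (on_ob R (l a))"
    and ex1: "\<And>a b' k. a \<in> Ob C \<Longrightarrow> b' \<in> Ob D \<Longrightarrow> k \<in> hom C a (on_ob R b') \<Longrightarrow>
        \<exists>!m. m \<in> hom D (l a) b' \<and> Cmp C (on_ar R m) (u a) = k"
    using univ by metis
  define t where "t a b k = (THE m. m \<in> hom D (l a) b \<and> Cmp C (on_ar R m) (u a) = k)" for a b k
  have t: "t a b k \<in> hom D (l a) b" "Cmp C (on_ar R (t a b k)) (u a) = k"
    if "a \<in> Ob C" "b \<in> Ob D" "k \<in> hom C a (on_ob R b)" for a b k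
    using theI'[OF ex1[OF that]] by (auto simp: t_def)
  have eq: "m = m'" if "a \<in> Ob C" "m \<in> hom D (l a) b" "m' \<in> hom D (l a) b"
    "Cmp C (on_ar R m) (u a) = Cmp C (on_ar R m') (u a)" for a b m m'
  proof -
    have "b \<in> Ob D" using hom_ob[OF cD that(2)] by simp
    moreover have "Cmp C (on_ar R m) (u a) \<in> hom C a (on_ob R b)"
      using comp_hom[OF cC u functor_hom[OF R that(2)]] that by simp
    ultimately show ?thesis using ex1[OF that(1)] that by metis
  qed
  define L where "L = \<lparr>on_ob = l, on_ar = \<lambda>f. t (Dom C f) (l (Cod C f)) (Cmp C (u (Cod C f)) f)\<rparr>"
  define e where "e b = t (on_ob R b) b (Idn C (on_ob R b))" for b
  have L: "on_ar L f \<in> hom D (l a) (l a')" "Cmp C (on_ar R (on_ar L f)) (u a) = Cmp C (u a') f"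
    if f: "f \<in> hom C a a'" for f a a'
  proof -
    have a: "a \<in> Ob C" "a' \<in> Ob C" using hom_ob[OF cC f] by auto
    have "Cmp C (u a') f \<in> hom C a (on_ob R (l a'))" using comp_hom[OF cC f u] a by simp
    from t[OF a(1) l[OF a(2)] this]
    show "on_ar L f \<in> hom D (l a) (l a')" "Cmp C (on_ar R (on_ar L f)) (u a) = Cmp C (u a') f"
      using homD[OF f] by (auto simp: L_def)
  qed
  have e: "e b \<in> hom D (l (on_ob R b)) b" "Cmp C (on_ar R (e b)) (u (on_ob R b)) = Idn C (on_ob R b)"
    if "b \<in> Ob D" for b
    using t[OF functor_ob[OF R that] that idn_hom[OF cC functor_ob[OF R that]]] by (auto simp: e_def)
  have Lf: "is_functor C D L"
    unfolding is_functor_def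
  proof (intro conjI ballI impI cC cD)
    fix a assume a: "a \<in> Ob C" then show "on_ob L a \<in> Ob D" by (simp add: L_def l)
    have "on_ar L (Idn C a) = Idn D (l a)"
    proof (rule eq[OF a])
      show "Cmp C (on_ar R (on_ar L (Idn C a))) (u a) = Cmp C (on_ar R (Idn D (l a))) (u a)"
        using L(2)[OF idn_hom[OF cC a]] functor_idn[OF R l[OF a]] idn_comp[OF cC u[OF a]] by simp
    qed (use L(1)[OF idn_hom[OF cC a]] idn_hom[OF cD l[OF a]] in auto)
    then show "on_ar L (Idn C a) = Idn D (on_ob L a)" by (simp add: L_def)
  next
    fix f assume "f \<in> Ar C"
    then show "on_ar L f \<in> hom D (on_ob L (Dom C f)) (on_ob L (Cod C f))"
      using L(1)[OF hom_arrow] by (simp add: L_def)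
  next
    fix f g assume fg: "f \<in> Ar C" "g \<in> Ar C" "Cod C f = Dom C g"
    define a b c where abc: "a = Dom C f" "b = Dom C g" "c = Cod C g"
    have f: "f \<in> hom C a b" and g: "g \<in> hom C b c" using fg by (auto simp: hom_def abc)
    note gf = comp_hom[OF cC f g]
    have a: "a \<in> Ob C" and b: "b \<in> Ob C" and c: "c \<in> Ob C"
      using hom_ob[OF cC f] hom_ob[OF cC g] by auto
    show "on_ar L (Cmp C g f) = Cmp D (on_ar L g) (on_ar L f)"
    proof (rule eq[OF a L(1)[OF gf] comp_hom[OF cD L(1)[OF f] L(1)[OF g]]])
      have "Cmp C (on_ar R (Cmp D (on_ar L g) (on_ar L f))) (u a)
          = Cmp C (on_ar R (on_ar L g)) (Cmp C (on_ar R (on_ar L f)) (u a))"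
        using functor_comp[OF R L(1)[OF f] L(1)[OF g]]
          comp_assoc[OF cC u[OF a] functor_hom[OF R L(1)[OF f]] functor_hom[OF R L(1)[OF g]]]
        by simp
      also have "\<dots> = Cmp C (Cmp C (on_ar R (on_ar L g)) (u b)) f"
        using L(2)[OF f] comp_assoc[OF cC f u[OF b] functor_hom[OF R L(1)[OF g]]] by simp
      also have "\<dots> = Cmp C (u c) (Cmp C g f)"
        using L(2)[OF g] comp_assoc[OF cC f g u[OF c]] by simp
      finally show "Cmp C (on_ar R (on_ar L (Cmp C g f))) (u a)
          = Cmp C (on_ar R (Cmp D (on_ar L g) (on_ar L f))) (u a)"
        using L(2)[OF gf] by simp
    qed
  qed
  have "is_adjunction C D L R u e"
    unfolding is_adjunction_def
  proof (intro conjI ballI Lf R)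
    show "is_nat_trans C C id_funct (R \<cdot> L) u"
      unfolding is_nat_trans_def
    proof (intro conjI ballI is_functor_id cC is_functor_comp[OF Lf R])
      fix a assume "a \<in> Ob C"
      then show "u a \<in> hom C (on_ob id_funct a) (on_ob (R \<cdot> L) a)"
        using u by (simp add: id_funct_def comp_funct_def L_def)
    next
      fix f assume "f \<in> Ar C"
      then show "Cmp C (on_ar (R \<cdot> L) f) (u (Dom C f)) = Cmp C (u (Cod C f)) (on_ar id_funct f)"
        using L(2)[OF hom_arrow] by (simp add: id_funct_def comp_funct_def)
    qed
    show "is_nat_trans D D (L \<cdot> R) id_funct e"
      unfolding is_nat_trans_def
    proof (intro conjI ballI is_functor_id cD is_functor_comp[OF R Lf])
      fix a assume "a \<in> Ob D"
      then show "e a \<in> hom D (on_ob (L \<cdot> R) a) (on_ob id_funct a)"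
        using e by (simp add: id_funct_def comp_funct_def L_def)
    next
      fix f assume fD: "f \<in> Ar D"
      define a b where ab: "a = Dom D f" "b = Cod D f"
      have f: "f \<in> hom D a b" using fD by (simp add: hom_def ab)
      have a: "a \<in> Ob D" and b: "b \<in> Ob D" using hom_ob[OF cD f] by auto
      note Rf = functor_hom[OF R f]
      have Ra: "on_ob R a \<in> Ob C" "on_ob R b \<in> Ob C" using functor_ob[OF R] a b by auto
      have "Cmp D f (e a) = Cmp D (e b) (on_ar L (on_ar R f))"
      proof (rule eq[OF Ra(1) comp_hom[OF cD e(1)[OF a] f] comp_hom[OF cD L(1)[OF Rf] e(1)[OF b]]])
        have "Cmp C (on_ar R (Cmp D f (e a))) (u (on_ob R a)) = on_ar R f"
          using functor_comp[OF R e(1)[OF a] f] e(2)[OF a] idn_comp[OF cC Rf]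
            comp_assoc[OF cC u[OF Ra(1)] functor_hom[OF R e(1)[OF a]] Rf] by simp
        moreover have "Cmp C (on_ar R (Cmp D (e b) (on_ar L (on_ar R f)))) (u (on_ob R a))
            = Cmp C (on_ar R (e b)) (Cmp C (u (on_ob R b)) (on_ar R f))"
          using functor_comp[OF R L(1)[OF Rf] e(1)[OF b]] L(2)[OF Rf]
            comp_assoc[OF cC u[OF Ra(1)] functor_hom[OF R L(1)[OF Rf]] functor_hom[OF R e(1)[OF b]]]
          by simp
        moreover have "\<dots> = on_ar R f"
          using comp_assoc[OF cC Rf u[OF Ra(2)] functor_hom[OF R e(1)[OF b]]] e(2)[OF b]
            idn_comp[OF cC Rf] by simp
        ultimately show "Cmp C (on_ar R (Cmp D f (e a))) (u (on_ob R a))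
            = Cmp C (on_ar R (Cmp D (e b) (on_ar L (on_ar R f)))) (u (on_ob R a))" by simp
      qed
      then show "Cmp D (on_ar id_funct f) (e (Dom D f)) = Cmp D (e (Cod D f)) (on_ar (L \<cdot> R) f)"
        by (simp add: id_funct_def comp_funct_def ab)
    qed
    fix a assume a: "a \<in> Ob C"
    note Lu = L[OF u[OF a]] and la = l[OF a]
    have Rl: "on_ob R (l a) \<in> Ob C" by (rule functor_ob[OF R la])
    have "Cmp D (e (l a)) (on_ar L (u a)) = Idn D (l a)"
    proof (rule eq[OF a comp_hom[OF cD Lu(1) e(1)[OF la]] idn_hom[OF cD la]])
      have "Cmp C (on_ar R (Cmp D (e (l a)) (on_ar L (u a)))) (u a)
          = Cmp C (on_ar R (e (l a))) (Cmp C (u (on_ob R (l a))) (u a))"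
        using functor_comp[OF R Lu(1) e(1)[OF la]] Lu(2)
          comp_assoc[OF cC u[OF a] functor_hom[OF R Lu(1)] functor_hom[OF R e(1)[OF la]]] by simp
      also have "\<dots> = u a"
        using comp_assoc[OF cC u[OF a] u[OF Rl] functor_hom[OF R e(1)[OF la]]] e(2)[OF la]
          idn_comp[OF cC u[OF a]] by simp
      finally show "Cmp C (on_ar R (Cmp D (e (l a)) (on_ar L (u a)))) (u a)
          = Cmp C (on_ar R (Idn D (l a))) (u a)"
        using functor_idn[OF R la] idn_comp[OF cC u[OF a]] by simp
    qed
    then show "Cmp D (e (on_ob L a)) (on_ar L (u a)) = Idn D (on_ob L a)" by (simp add: L_def)
  qed (use e(2) in auto)
  then show ?thesis unfolding is_right_adjoint_def by blast
qed

lemma hom_slice: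
  "x \<in> hom (slice C X) f g \<longleftrightarrow> (\<exists>h. x = (f, h, g) \<and> f \<in> Ar C \<and> Cod C f = X \<and> g \<in> Ar C \<and> Cod C g = X \<and>
     h \<in> hom C (Dom C f) (Dom C g) \<and> Cmp C g h = f)"
  by (cases x) (auto simp: hom_def slice_def)

lemma category_slice:
  assumes C: "category C" shows "category (slice C X)"
proof -
  have comp: "Cmp C l (Cmp C k h) = f" "Cmp C k h \<in> hom C (Dom C f) (Dom C l)"
    if "f \<in> Ar C" "g \<in> Ar C" "l \<in> Ar C" "h \<in> hom C (Dom C f) (Dom C g)" "k \<in> hom C (Dom C g) (Dom C l)"
      "Cmp C g h = f" "Cmp C l k = g" for f g l h k
    using comp_assoc[OF C that(4,5) hom_arrow[OF that(3)]] comp_hom[OF C that(4,5)] that by auto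
  show ?thesis
    unfolding category_def
  proof (intro conjI ballI impI)
    fix f g assume "f \<in> Ar (slice C X)" "g \<in> Ar (slice C X)" "Cod (slice C X) f = Dom (slice C X) g"
    then show "Cmp (slice C X) g f \<in> hom (slice C X) (Dom (slice C X) f) (Cod (slice C X) g)"
      unfolding hom_slice by (auto simp: slice_def comp)
  next
    fix f g h assume "f \<in> Ar (slice C X)" "g \<in> Ar (slice C X)" "h \<in> Ar (slice C X)"
      "Cod (slice C X) f = Dom (slice C X) g \<and> Cod (slice C X) g = Dom (slice C X) h"
    then show "Cmp (slice C X) h (Cmp (slice C X) g f) = Cmp (slice C X) (Cmp (slice C X) h g) f"
      by (auto simp: slice_def comp_assoc[OF C])
  next
    fix a assume "a \<in> Ob (slice C X)"
    then show "Idn (slice C X) a \<in> hom (slice C X) a a"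
      unfolding hom_slice using idn_hom[OF C] idn_comp[OF C hom_arrow[of a C]] hom_ob[OF C hom_arrow[of a C]]
      by (auto simp: slice_def)
  qed (auto simp: slice_def idn_comp[OF C])
qed

lemma is_functor_slice:
  assumes F: "is_functor C D F"
  shows "is_functor (slice C X) (slice D (on_ob F X)) (slice_funct F)"
proof -
  note cC = functor_cat(1)[OF F] and cD = functor_cat(2)[OF F]
  have Far: "on_ar F f \<in> Ar D" "Dom D (on_ar F f) = on_ob F (Dom C f)"
    "Cod D (on_ar F f) = on_ob F (Cod C f)" if "f \<in> Ar C" for f
    using functor_hom[OF F hom_arrow[OF that]] by (auto simp: hom_def)
  have Fc: "Cmp D (on_ar F g) (on_ar F h) = on_ar F (Cmp C g h)"
    if "g \<in> Ar C" "h \<in> hom C a (Dom C g)" for g h a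
    using functor_comp[OF F that(2) hom_arrow[OF that(1)]] by simp
  show ?thesis
    unfolding is_functor_def
  proof (intro conjI ballI impI category_slice cC cD)
    fix f assume "f \<in> Ar (slice C X)"
    then show "on_ar (slice_funct F) f \<in> hom (slice D (on_ob F X)) (on_ob (slice_funct F) (Dom (slice C X) f))
            (on_ob (slice_funct F) (Cod (slice C X) f))"
      unfolding hom_slice by (auto simp: slice_def slice_funct_def Far Fc functor_hom[OF F])
  next
    fix f g assume "f \<in> Ar (slice C X)" "g \<in> Ar (slice C X)" "Cod (slice C X) f = Dom (slice C X) g"
    then show "on_ar (slice_funct F) (Cmp (slice C X) g f)
       = Cmp (slice D (on_ob F X)) (on_ar (slice_funct F) g) (on_ar (slice_funct F) f)"
      by (auto simp: slice_def slice_funct_def functor_comp[OF F])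
  qed (use cC in \<open>auto simp: slice_def slice_funct_def Far functor_idn[OF F] category_def\<close>)
qed

section \<open>Type-and-term structures\<close>

abbreviation phom :: "'u psh \<Rightarrow> 'u psh \<Rightarrow> 'u psh_arrow set" where
  "phom \<equiv> hom psh_cat"

abbreviation pcomp :: "'u psh_arrow \<Rightarrow> 'u psh_arrow \<Rightarrow> 'u psh_arrow" where
  "pcomp \<equiv> Cmp psh_cat"

definition ap :: "'u psh_arrow \<Rightarrow> hob \<Rightarrow> 'u \<Rightarrow> 'u" where
  "ap F = fst (snd F)"

definition mk_arr :: "'u psh \<Rightarrow> 'u psh \<Rightarrow> (hob \<Rightarrow> 'u \<Rightarrow> 'u) \<Rightarrow> 'u psh_arrow" where
  "mk_arr X Y f = (X, \<lambda>h. \<lambda>x\<in>elts X h. f h x, Y)"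

lemma bd_in: "is_psh X \<Longrightarrow> x \<in> elts X (tgt e) \<Longrightarrow> bd X e x \<in> elts X (src e)"
  by (auto simp: is_psh_def)

lemma hom_psh_iff:
  "F \<in> phom X Y \<longleftrightarrow> (\<exists>f. F = (X, f, Y) \<and> is_psh X \<and> is_psh Y \<and> (\<forall>h. f h \<in> elts X h \<rightarrow>\<^sub>E elts Y h) \<and>
     (\<forall>e. \<forall>x\<in>elts X (tgt e). f (src e) (bd X e x) = bd Y e (f (tgt e) x)))"
  by (cases F) (auto simp: hom_def psh_cat_def)

lemma
  assumes "F \<in> phom X Y"
  shows hom_psh: "is_psh X" "is_psh Y"
    and ap_in: "x \<in> elts X h \<Longrightarrow> ap F h x \<in> elts Y h"
    and ap_bd: "x \<in> elts X (tgt e) \<Longrightarrow> ap F (src e) (bd X e x) = bd Y e (ap F (tgt e) x)"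
  using assms by (force simp: hom_psh_iff ap_def PiE_def Pi_def)+

lemma hom_psh_eqI:
  assumes "F \<in> phom X Y" "F' \<in> phom X Y" "\<And>h x. x \<in> elts X h \<Longrightarrow> ap F h x = ap F' h x"
  shows "F = F'"
proof -
  obtain f f' where *: "F = (X, f, Y)" "F' = (X, f', Y)" "\<And>h. f h \<in> elts X h \<rightarrow>\<^sub>E elts Y h"
     "\<And>h. f' h \<in> elts X h \<rightarrow>\<^sub>E elts Y h"
    using assms(1,2) unfolding hom_psh_iff by blast
  have "f h = f' h" for h
    by (rule PiE_ext[OF *(3,4)]) (use assms(3) * in \<open>auto simp: ap_def\<close>)
  then show ?thesis using * by auto
qed

lemma mk_arr_hom:
  assumes "is_psh X" "is_psh Y" "\<And>h x. x \<in> elts X h \<Longrightarrow> f h x \<in> elts Y h"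
    "\<And>e x. x \<in> elts X (tgt e) \<Longrightarrow> f (src e) (bd X e x) = bd Y e (f (tgt e) x)"
  shows "mk_arr X Y f \<in> phom X Y"
  using assms by (auto simp: hom_psh_iff mk_arr_def bd_in)

lemma ap_mk_arr: "x \<in> elts X h \<Longrightarrow> ap (mk_arr X Y f) h x = f h x"
  by (simp add: ap_def mk_arr_def)

lemma Idn_psh: "Idn psh_cat X = mk_arr X X (\<lambda>h x. x)"
  by (simp add: psh_cat_def mk_arr_def)

lemma Cmp_psh:
  assumes "F \<in> phom X Y" "H \<in> phom Y Z"
  shows "pcomp H F = mk_arr X Z (\<lambda>h x. ap H h (ap F h x))"
  using assms[unfolded hom_psh_iff] by (auto simp: psh_cat_def mk_arr_def ap_def compose_def)

lemma ap_comp: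
  assumes "F \<in> phom X Y" "H \<in> phom Y Z" "x \<in> elts X h"
  shows "ap (pcomp H F) h x = ap H h (ap F h x)"
  using assms by (simp add: Cmp_psh ap_mk_arr)

lemma idn_hom_psh: "is_psh X \<Longrightarrow> Idn psh_cat X \<in> phom X X"
  by (auto simp: Idn_psh intro!: mk_arr_hom)

lemma ap_idn: "x \<in> elts X h \<Longrightarrow> ap (Idn psh_cat X) h x = x"
  by (simp add: Idn_psh ap_mk_arr)

lemma Ob_psh: "X \<in> Ob psh_cat \<longleftrightarrow> is_psh X"
  by (simp add: psh_cat_def)

lemma category_psh: "category psh_cat"
proof -
  have cmp: "pcomp H F \<in> phom X Z"
    if "F \<in> phom X Y" "H \<in> phom Y Z" for X Y Z :: "'a psh" and F H
    unfolding Cmp_psh[OF that]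
  proof (rule mk_arr_hom[OF hom_psh(1)[OF that(1)] hom_psh(2)[OF that(2)]])
    fix h x assume "x \<in> elts X h"
    then show "ap H h (ap F h x) \<in> elts Z h" by (intro ap_in[OF that(2)] ap_in[OF that(1)])
  next
    fix e x assume x: "x \<in> elts X (tgt e)"
    show "ap H (src e) (ap F (src e) (bd X e x)) = bd Z e (ap H (tgt e) (ap F (tgt e) x))"
      by (simp add: ap_bd[OF that(1) x] ap_bd[OF that(2) ap_in[OF that(1) x]])
  qed
  note idn = idn_hom_psh
  show ?thesis
    unfolding category_def
  proof (intro conjI ballI impI)
    fix F :: "'a psh_arrow" assume "F \<in> Ar psh_cat"
    then obtain X Y where F: "F \<in> phom X Y" by (auto simp: hom_def)
    note d = homD[OF F] hom_psh[OF F]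
    from d show "Dom psh_cat F \<in> Ob psh_cat" "Cod psh_cat F \<in> Ob psh_cat" by (auto simp: Ob_psh)
    have "pcomp F (Idn psh_cat X) = F"
      by (rule hom_psh_eqI[OF cmp[OF idn F] F])
         (simp_all add: d ap_comp[OF idn F] ap_idn)
    with d show "pcomp F (Idn psh_cat (Dom psh_cat F)) = F" by simp
    have "pcomp (Idn psh_cat Y) F = F"
      by (rule hom_psh_eqI[OF cmp[OF F idn] F])
         (simp_all add: d ap_comp[OF F idn] ap_idn ap_in[OF F])
    with d show "pcomp (Idn psh_cat (Cod psh_cat F)) F = F" by simp
  next
    fix X :: "'a psh" assume "X \<in> Ob psh_cat"
    then show "Idn psh_cat X \<in> phom X X" by (simp add: idn Ob_psh)
  next
    fix F H :: "'a psh_arrow" assume "F \<in> Ar psh_cat" "H \<in> Ar psh_cat" "Cod psh_cat F = Dom psh_cat H"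
    then show "pcomp H F \<in> phom (Dom psh_cat F) (Cod psh_cat H)"
      using cmp[OF hom_arrow] by (auto simp: hom_def)
  next
    fix F H K :: "'a psh_arrow" assume "F \<in> Ar psh_cat" "H \<in> Ar psh_cat" "K \<in> Ar psh_cat"
      "Cod psh_cat F = Dom psh_cat H \<and> Cod psh_cat H = Dom psh_cat K"
    then obtain X Y Z Z' where h: "F \<in> phom X Y" "H \<in> phom Y Z" "K \<in> phom Z Z'"
      by (auto simp: hom_def)
    show "pcomp K (pcomp H F) = pcomp (pcomp K H) F"
    proof (rule hom_psh_eqI[OF cmp[OF cmp[OF h(1,2)] h(3)] cmp[OF h(1) cmp[OF h(2,3)]]])
      fix h x assume x: "x \<in> elts X h"
      then show "ap (pcomp K (pcomp H F)) h x = ap (pcomp (pcomp K H) F) h x"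
        by (simp add: ap_comp[OF cmp[OF h(1,2)] h(3)] ap_comp[OF h(1) cmp[OF h(2,3)]] ap_comp[OF h(1,2)]
           ap_comp[OF h(2,3) ap_in[OF h(1) x]])
    qed
  qed
qed

lemmas comp_hom_psh = comp_hom[OF category_psh]

text \<open>
  The iterated boundary, from level \<open>n\<close> down to level \<open>i \<le> n\<close>; for \<open>i > n\<close> the
  value \<open>x\<close> is a default.
\<close>

fun bd_to :: "'u psh \<Rightarrow> nat \<Rightarrow> nat \<Rightarrow> 'u \<Rightarrow> 'u" where
  "bd_to X 0 i x = x"
| "bd_to X (Suc n) i x = (if Suc n \<le> i then x else bd_to X n i (bd X (Ext n) x))"

text \<open>
  The free category on the graph is a partial order, so there is at most one restriction map from
  \<open>h\<close> to \<open>h'\<close>. The last equation is a default. The strict part of the order is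
  \<open>below\<close>.
\<close>

fun restr :: "'u psh \<Rightarrow> hob \<Rightarrow> hob \<Rightarrow> 'u \<Rightarrow> 'u" where
  "restr X (TyO n) (TyO i) x = bd_to X n i x"
| "restr X (TmO n) (TyO i) x = bd_to X n i (bd X (Tm n) x)"
| "restr X h (TmO i) x = x"

fun below :: "hob \<Rightarrow> hob \<Rightarrow> bool" where
  "below (TyO i) (TyO n) \<longleftrightarrow> i < n"
| "below (TyO i) (TmO n) \<longleftrightarrow> i \<le> n"
| "below (TmO i) h \<longleftrightarrow> False"

lemma bd_to_self [simp]: "bd_to X n n x = x"
  by (cases n) auto

lemma
  assumes "is_psh X"
  shows bd_Ext_in: "x \<in> elts X (TyO (Suc n)) \<Longrightarrow> bd X (Ext n) x \<in> elts X (TyO n)"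
    and bd_Tm_in: "x \<in> elts X (TmO n) \<Longrightarrow> bd X (Tm n) x \<in> elts X (TyO n)"
  using bd_in[OF assms, of x "Ext n"] bd_in[OF assms, of x "Tm n"] by auto

lemma bd_to_in: "is_psh X \<Longrightarrow> i \<le> n \<Longrightarrow> x \<in> elts X (TyO n) \<Longrightarrow> bd_to X n i x \<in> elts X (TyO i)"
proof (induction n arbitrary: x)
  case (Suc n)
  then show ?case using bd_Ext_in[of X x n] by (cases "i = Suc n") auto
qed auto

lemma restr_in: "is_psh X \<Longrightarrow> below h' h \<Longrightarrow> x \<in> elts X h \<Longrightarrow> restr X h h' x \<in> elts X h'"
  using bd_to_in[of X] bd_Tm_in[of X x] by (cases h; cases h') auto

lemma ap_bd_to:
  assumes F: "F \<in> phom X Y"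
  shows "i \<le> n \<Longrightarrow> x \<in> elts X (TyO n) \<Longrightarrow> ap F (TyO i) (bd_to X n i x) = bd_to Y n i (ap F (TyO n) x)"
proof (induction n arbitrary: x)
  case (Suc n)
  have "bd X (Ext n) x \<in> elts X (TyO n)" using bd_in[OF hom_psh(1)[OF F], of x "Ext n"] Suc.prems by simp
  with Suc show ?case using ap_bd[OF F, of x "Ext n"] by (auto simp: le_Suc_eq)
qed auto

lemma ap_restr:
  assumes F: "F \<in> phom X Y" and "below h' h" "x \<in> elts X h"
  shows "ap F h' (restr X h h' x) = restr Y h h' (ap F h x)"
proof (cases h)
  case (TyO n)
  then show ?thesis using assms by (cases h') (auto simp: ap_bd_to[OF F])
next
  case (TmO n)
  have "bd X (Tm n) x \<in> elts X (TyO n)" using bd_in[OF hom_psh(1)[OF F], of x "Tm n"] assms TmO by simp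
  then show ?thesis using assms TmO ap_bd[OF F, of x "Tm n"] by (cases h') (auto simp: ap_bd_to[OF F])
qed

lemma bd_eq_restr: "bd X e x = restr X (tgt e) (src e) x"
  by (cases e) auto

section \<open>Derived judgements of a free theory\<close>

text \<open>
  In a free theory a constant carries its number of arguments as the first component.
\<close>

definition type_app :: "'u \<Rightarrow> var list \<Rightarrow> (var, 'u con + 'u con) expr" where
  "type_app A ys = App (Inl (length ys, A)) (map Var ys)"

definition term_app :: "'u \<Rightarrow> var list \<Rightarrow> (var, 'u con + 'u con) expr" where
  "term_app a ys = App (Inr (length ys, a)) (map Var ys)"

lemma map_Var_eq [simp]: "map Var ys = map Var zs \<longleftrightarrow> ys = zs"
  by (rule inj_map_eq_map) (simp add: inj_def)

lemma type_app_eq [simp]: "type_app A ys = type_app B zs \<longleftrightarrow> A = B \<and> ys = zs"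
  by (auto simp: type_app_def)

lemma term_app_eq [simp]: "term_app A ys = term_app B zs \<longleftrightarrow> A = B \<and> ys = zs"
  by (auto simp: term_app_def)

lemma evars_app [simp]: "evars (type_app A ys) = set ys" "evars (term_app A ys) = set ys"
  by (auto simp: type_app_def term_app_def)

lemma map_app [simp]:
  "map_expr \<sigma> id (type_app A ys) = type_app A (map \<sigma> ys)" "map_expr \<sigma> id (term_app A ys) = term_app A (map \<sigma> ys)"
  "map_expr \<sigma> (\<lambda>w. w) (type_app A ys) = type_app A (map \<sigma> ys)"
  "map_expr \<sigma> (\<lambda>w. w) (term_app A ys) = term_app A (map \<sigma> ys)"
  by (auto simp: type_app_def term_app_def)

type_synonym 'u sctx = "(var, 'u con + 'u con) ctx"
type_synonym 'u sexpr = "(var, 'u con + 'u con) expr"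

text \<open>
  Only the type of the last argument is prescribed. That type is itself well formed, so it prescribes
  the type of the preceding argument, and so on: \<open>wf_type_chain\<close>. As the context enters through
  membership only, the predicate is visibly stable under weakening.
\<close>

inductive wf_type :: "'u psh \<Rightarrow> 'u sctx \<Rightarrow> 'u sexpr \<Rightarrow> bool" for X \<Gamma> where
  nil: "A \<in> elts X (TyO 0) \<Longrightarrow> wf_type X \<Gamma> (type_app A [])"
| snoc: "A \<in> elts X (TyO (Suc (length ys))) \<Longrightarrow> (y, type_app (bd X (Ext (length ys)) A) ys) \<in> set \<Gamma>
    \<Longrightarrow> wf_type X \<Gamma> (type_app A (ys @ [y]))"

inductive wf_ctx :: "'u psh \<Rightarrow> 'u sctx \<Rightarrow> bool" for X where
  nil: "wf_ctx X []"
| snoc: "wf_ctx X \<Gamma> \<Longrightarrow> wf_type X \<Gamma> T \<Longrightarrow> x \<notin> fst ` set \<Gamma> \<Longrightarrow> wf_ctx X (\<Gamma> @ [(x, T)])"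

definition wf_term :: "'u psh \<Rightarrow> 'u sctx \<Rightarrow> 'u sexpr \<Rightarrow> 'u sexpr \<Rightarrow> bool" where
  "wf_term X \<Gamma> t T \<longleftrightarrow> (\<exists>a ys. a \<in> elts X (TmO (length ys)) \<and> t = term_app a ys \<and>
     T = type_app (bd X (Tm (length ys)) a) ys \<and> wf_type X \<Gamma> T)"

text \<open>
  In a free theory the only derivable equalities are instances of reflexivity.
\<close>

fun wf_jud :: "'u psh \<Rightarrow> 'u sjud \<Rightarrow> bool" where
  "wf_jud X (\<Gamma> \<turnstile> Typ T) \<longleftrightarrow> wf_ctx X \<Gamma> \<and> wf_type X \<Gamma> T"
| "wf_jud X (\<Gamma> \<turnstile> Trm t T) \<longleftrightarrow> wf_ctx X \<Gamma> \<and> wf_term X \<Gamma> t T"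
| "wf_jud X (\<Gamma> \<turnstile> TypEq T T') \<longleftrightarrow> wf_ctx X \<Gamma> \<and> wf_type X \<Gamma> T \<and> T = T'"
| "wf_jud X (\<Gamma> \<turnstile> TrmEq t t' T) \<longleftrightarrow> wf_ctx X \<Gamma> \<and> wf_term X \<Gamma> t T \<and> t = t'"

lemma wf_type_cases':
  assumes "wf_type X \<Gamma> T"
  obtains A where "T = type_app A []" "A \<in> elts X (TyO 0)"
  | A ys y where "T = type_app A (ys @ [y])" "A \<in> elts X (TyO (Suc (length ys)))"
      "(y, type_app (bd X (Ext (length ys)) A) ys) \<in> set \<Gamma>"
  using assms by (auto elim: wf_type.cases)

lemma wf_type_type_app:
  assumes "wf_type X \<Gamma> T" obtains A ys where "T = type_app A ys" "A \<in> elts X (TyO (length ys))"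
  using assms by (auto elim!: wf_type_cases')

lemma wf_type_snocD:
  assumes "wf_type X \<Gamma> (type_app A (ys @ [y]))"
  shows "(y, type_app (bd X (Ext (length ys)) A) ys) \<in> set \<Gamma>"
  using assms by (auto elim: wf_type.cases)

lemma wf_type_mono: "wf_type X \<Gamma> T \<Longrightarrow> set \<Gamma> \<subseteq> set \<Delta> \<Longrightarrow> wf_type X \<Delta> T"
  by (auto elim!: wf_type_cases' intro: wf_type.intros)

lemma wf_term_mono: "wf_term X \<Gamma> t T \<Longrightarrow> set \<Gamma> \<subseteq> set \<Delta> \<Longrightarrow> wf_term X \<Delta> t T"
  unfolding wf_term_def using wf_type_mono by blast

lemma wf_ctx_snoc_iff:
  "wf_ctx X (\<Gamma> @ [(x, T)]) \<longleftrightarrow> wf_ctx X \<Gamma> \<and> wf_type X \<Gamma> T \<and> x \<notin> fst ` set \<Gamma>"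
  by (auto elim: wf_ctx.cases intro: wf_ctx.snoc)

lemma wf_ctx_distinct: "wf_ctx X \<Gamma> \<Longrightarrow> distinct (map fst \<Gamma>)"
  by (induction rule: wf_ctx.induct) auto

lemma wf_ctx_append: "wf_ctx X (\<Gamma> @ \<Delta>) \<Longrightarrow> wf_ctx X \<Gamma>"
proof (induction \<Delta> rule: rev_induct)
  case (snoc p \<Delta>)
  then show ?case using wf_ctx_snoc_iff[of X "\<Gamma> @ \<Delta>" "fst p" "snd p"] by auto
qed auto

lemma wf_ctx_type: "wf_ctx X \<Gamma> \<Longrightarrow> (x, T) \<in> set \<Gamma> \<Longrightarrow> wf_type X \<Gamma> T"
proof (induction rule: wf_ctx.induct)
  case (snoc \<Gamma> S y)
  then have "wf_type X \<Gamma> T" by auto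
  then show ?case by (rule wf_type_mono) auto
qed auto

lemma wf_type_vars: "wf_ctx X \<Gamma> \<Longrightarrow> wf_type X \<Gamma> T \<Longrightarrow> evars T \<subseteq> fst ` set \<Gamma>"
proof (induction arbitrary: T rule: wf_ctx.induct)
  case nil
  then show ?case by (auto elim!: wf_type_cases')
next
  case (snoc \<Gamma> S x)
  from snoc.prems show ?case
  proof (cases rule: wf_type_cases')
    case (2 A ys y)
    then have "y = x \<and> type_app (bd X (Ext (length ys)) A) ys = S \<or> y \<in> fst ` set \<Gamma> \<and> wf_type X \<Gamma> (type_app (bd X (Ext (length ys)) A) ys)"
      using wf_ctx_type[OF snoc.hyps(1)] by force
    then have "y \<in> fst ` set (\<Gamma> @ [(x, S)])" "wf_type X \<Gamma> (type_app (bd X (Ext (length ys)) A) ys)"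
      using snoc.hyps by auto
    with snoc.IH[OF this(2)] show ?thesis using 2 by auto
  qed auto
qed

lemma wf_ctx_vars:
  assumes \<Gamma>: "wf_ctx X \<Gamma>" shows "cvars \<Gamma> = fst ` set \<Gamma>"
  proof
    show "cvars \<Gamma> \<subseteq> fst ` set \<Gamma>"
      unfolding cvars_def
    proof (intro UN_least, clarify)
      fix x T y assume "(x, T) \<in> set \<Gamma>" "y \<in> insert x (evars T)"
      then show "y \<in> fst ` set \<Gamma>" using wf_type_vars[OF \<Gamma> wf_ctx_type[OF \<Gamma>]] by force
    qed
  qed (auto simp: cvars_def)

text \<open>
  The type of the last argument is again a type over the context, with the other arguments and the
  boundary of the head constant. So the claim follows by induction.
\<close>

lemma wf_type_chain:
  assumes \<Gamma>: "wf_ctx X \<Gamma>"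
  shows "wf_type X \<Gamma> (type_app A ys) \<Longrightarrow> i < length ys \<Longrightarrow>
    (ys ! i, type_app (bd_to X (length ys) i A) (take i ys)) \<in> set \<Gamma>"
proof (induction ys arbitrary: A rule: rev_induct)
  case (snoc y ys)
  note y = wf_type_snocD[OF snoc.prems(1)]
  show ?case
  proof (cases "i = length ys")
    case False
    then have "i < length ys" using snoc.prems by simp
    with snoc.IH[OF wf_ctx_type[OF \<Gamma> y]] show ?thesis by (auto simp: nth_append)
  qed (use y in auto)
qed simp

abbreviation map_ctx :: "('v \<Rightarrow> 'v) \<Rightarrow> ('v, 'w) ctx \<Rightarrow> ('v, 'w) ctx" where
  "map_ctx \<sigma> \<Gamma> \<equiv> map (map_prod \<sigma> (map_expr \<sigma> id)) \<Gamma>"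

lemma wf_type_map: "wf_type X \<Gamma> T \<Longrightarrow> wf_type X (map_ctx \<sigma> \<Gamma>) (map_expr \<sigma> id T)"
proof (erule wf_type_cases')
  fix A ys y assume 2: "T = type_app A (ys @ [y])" "A \<in> elts X (TyO (Suc (length ys)))"
    "(y, type_app (bd X (Ext (length ys)) A) ys) \<in> set \<Gamma>"
  then have "(\<sigma> y, type_app (bd X (Ext (length ys)) A) (map \<sigma> ys)) \<in> set (map_ctx \<sigma> \<Gamma>)"
    by (force intro: rev_image_eqI)
  with 2 wf_type.snoc[of A X "map \<sigma> ys"] show ?thesis by simp
qed (simp add: wf_type.nil)

lemma wf_term_map: "wf_term X \<Gamma> t T \<Longrightarrow> wf_term X (map_ctx \<sigma> \<Gamma>) (map_expr \<sigma> id t) (map_expr \<sigma> id T)"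
  unfolding wf_term_def using wf_type_map[of X \<Gamma> _ \<sigma>] by (metis length_map map_app)

lemma wf_ctx_map: "wf_ctx X \<Gamma> \<Longrightarrow> inj \<sigma> \<Longrightarrow> wf_ctx X (map_ctx \<sigma> \<Gamma>)"
proof (induction rule: wf_ctx.induct)
  case (snoc \<Gamma> T x)
  then have "\<sigma> x \<notin> fst ` set (map_ctx \<sigma> \<Gamma>)" by (auto simp: inj_def image_iff)
  moreover have "map_ctx \<sigma> (\<Gamma> @ [(x, T)]) = map_ctx \<sigma> \<Gamma> @ [(\<sigma> x, map_expr \<sigma> id T)]" by simp
  ultimately show ?case using snoc wf_type_map[of X \<Gamma> T \<sigma>] wf_ctx_snoc_iff by metis
qed (simp add: wf_ctx.nil)

lemma wf_jud_map: "wf_jud X J \<Longrightarrow> inj \<sigma> \<Longrightarrow> wf_jud X (map_jud \<sigma> id J)"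
  by (cases "(X, J)" rule: wf_jud.cases) (auto simp: wf_ctx_map wf_type_map wf_term_map)

lemma wf_ctx_insert:
  "wf_ctx X (\<Gamma> @ \<Delta>) \<Longrightarrow> wf_type X \<Gamma> T \<Longrightarrow> y \<notin> fst ` set (\<Gamma> @ \<Delta>) \<Longrightarrow> wf_ctx X (\<Gamma> @ (y, T) # \<Delta>)"
proof (induction \<Delta> rule: rev_induct)
  case Nil
  then show ?case by (simp add: wf_ctx_snoc_iff)
next
  case (snoc p \<Delta>)
  obtain z U where p: "p = (z, U)" by force
  have *: "wf_ctx X (\<Gamma> @ \<Delta>)" "wf_type X (\<Gamma> @ \<Delta>) U" "z \<notin> fst ` set (\<Gamma> @ \<Delta>)"
    using snoc.prems(1) wf_ctx_snoc_iff[of X "\<Gamma> @ \<Delta>" z U] by (auto simp: p)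
  have "wf_type X (\<Gamma> @ (y, T) # \<Delta>) U" by (rule wf_type_mono[OF *(2)]) auto
  then show ?case
    using wf_ctx_snoc_iff[of X "\<Gamma> @ (y, T) # \<Delta>" z U] snoc * by (auto simp: p)
qed

lemma wf_jud_insert:
  assumes "wf_jud X (\<Gamma> @ \<Delta> \<turnstile> R)" "wf_type X \<Gamma> T" "y \<notin> fst ` set (\<Gamma> @ \<Delta>)"
  shows "wf_jud X (\<Gamma> @ (y, T) # \<Delta> \<turnstile> R)"
proof -
  have "wf_ctx X (\<Gamma> @ \<Delta>)" using assms(1) by (cases R) auto
  from wf_ctx_insert[OF this assms(2,3)] assms(1) show ?thesis
    by (cases R) (auto intro: wf_type_mono wf_term_mono)
qed

lemma fst_free_ctx [simp]: "map fst (free_ctx X k A) = [0..<k]"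
  by (induction k arbitrary: A) (auto simp: Let_def)

lemma gen_app_eq: "gen_app (Inl (k, A)) k = type_app A [0..<k]" "gen_app (Inr (k, A)) k = term_app A [0..<k]"
  by (simp_all add: gen_app_def type_app_def term_app_def)

lemma wf_free_ctx:
  assumes "is_psh X"
  shows "A \<in> elts X (TyO k) \<Longrightarrow> wf_ctx X (free_ctx X k A) \<and> wf_type X (free_ctx X k A) (type_app A [0..<k])"
proof (induction k arbitrary: A)
  case 0
  then show ?case by (auto intro: wf_ctx.nil wf_type.nil)
next
  case (Suc k)
  let ?B = "bd X (Ext k) A"
  have "fst ` set (free_ctx X k ?B) = {0..<k}"
    using arg_cong[OF fst_free_ctx[of X k ?B], of set] by (simp only: set_map set_upt)
  then show ?case
    using Suc.IH[OF bd_Ext_in[OF assms Suc.prems]] wf_type.snoc[of A X "[0..<k]" k] Suc.prems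
    by (simp add: Let_def gen_app_eq wf_ctx_snoc_iff)
qed

lemma wf_gen_jud: "is_psh X \<Longrightarrow> x \<in> elts X h \<Longrightarrow> wf_jud X (gen_jud X h x)"
  by (cases h) (auto simp: Let_def gen_app_eq wf_free_ctx wf_term_def bd_Tm_in intro!: exI[of _ "[0..<_]"])

lemma wf_if_derived:
  assumes X: "is_psh X" and J: "J \<in> derived (free_gat X)" shows "wf_jud X J"
  using J
proof (induction rule: derived.induct)
  case (basic J)
  then show ?case by (auto simp: free_gat_def wf_gen_jud[OF X])
next
  case (rule r Js J)
  then have "\<forall>K\<in>set Js. wf_jud X K" by auto
  with rule(1) show ?case
  proof (cases rule: rule_app.cases)
    case (9 \<sigma> J)
    with \<open>\<forall>K\<in>set Js. wf_jud X K\<close> show ?thesis by (simp add: wf_jud_map bij_is_inj)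
  next
    case (10 y \<Gamma> \<Delta> T R)
    then have "y \<notin> fst ` set (\<Gamma> @ \<Delta>)" by (auto simp: cvars_def)
    with 10 \<open>\<forall>K\<in>set Js. wf_jud X K\<close> show ?thesis by (simp add: wf_jud_insert)
  qed auto
qed

text \<open>
  The rules rename by permutations of all variables only, so a bijection between two lists of variables
  has to be extended. This is possible because the two lists have equally many variables missing from
  their union.
\<close>

lemma ex_bij_map:
  assumes "distinct xs" "distinct ys" "length xs = length ys"
  shows "\<exists>\<sigma>. bij (\<sigma> :: nat \<Rightarrow> nat) \<and> map \<sigma> xs = ys"
proof -
  let ?U = "set xs \<union> set ys"
  have "card (?U - set xs) = card (?U - set ys)"
    using assms by (simp add: card_Diff_subset distinct_card)
  then obtain g where g: "bij_betw g (?U - set xs) (?U - set ys)"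
    using finite_same_card_bij[of "?U - set xs" "?U - set ys"] by auto
  define f where "f v = (case map_of (zip xs ys) v of Some w \<Rightarrow> w | None \<Rightarrow> if v \<in> ?U then g v else v)" for v
  have f1: "f (xs ! i) = ys ! i" if "i < length xs" for i
    using that assms map_of_zip_nth[of xs ys i] by (simp add: f_def)
  have f2: "f v = (if v \<in> ?U then g v else v)" if "v \<notin> set xs" for v
  proof -
    have "map_of (zip xs ys) v = None" using that assms(3) by (simp add: map_of_zip_is_None)
    then show ?thesis by (simp add: f_def)
  qed
  have "bij_betw f (set xs) (set ys)"
    unfolding bij_betw_def
  proof
    have m: "map f xs = ys" by (rule nth_equalityI) (simp_all add: f1 assms)
    then show "f ` set xs = set ys" by (metis set_map)
    from m assms(2) show "inj_on f (set xs)" by (metis distinct_map)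
  qed
 moreover have "bij_betw f (?U - set xs) (?U - set ys)"
    using g by (rule bij_betw_cong[THEN iffD1, rotated]) (auto simp: f2)
  ultimately have "bij_betw f (set xs \<union> (?U - set xs)) (set ys \<union> (?U - set ys))"
    by (rule bij_betw_combine) auto
  moreover have "bij_betw f (- ?U) (- ?U)"
    using bij_betw_id by (rule bij_betw_cong[THEN iffD1, rotated]) (auto simp: f2 id_def)
  ultimately have "bij_betw f ((set xs \<union> (?U - set xs)) \<union> - ?U) ((set ys \<union> (?U - set ys)) \<union> - ?U)"
    by (rule bij_betw_combine) auto
  moreover have "(set xs \<union> (?U - set xs)) \<union> - ?U = UNIV" "(set ys \<union> (?U - set ys)) \<union> - ?U = UNIV" by auto
  ultimately have "bij f" by simp
  moreover have "map f xs = ys" by (rule nth_equalityI) (auto simp: f1 assms)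
  ultimately show ?thesis by blast
qed

lemma gen_jud_derived:
  assumes X: "is_psh X" and "x \<in> elts X h" shows "gen_jud X h x \<in> derived (free_gat X)"
proof -
  have ax: "gen_jud X h x \<in> Ax (free_gat X)" if "x \<in> elts X h" for h x
    using that by (auto simp: free_gat_def)
  have *: "gen_jud X (TyO k) A \<in> derived (free_gat X)" if "A \<in> elts X (TyO k)" for k A
    using that
  proof (induction k arbitrary: A)
    case 0
    show ?case by (rule derived.basic[OF ax[OF 0]]) simp
  next
    case (Suc k)
    show ?case
      by (rule derived.basic[OF ax[OF Suc.prems]])
         (use Suc.IH[OF bd_Ext_in[OF X Suc.prems]] in \<open>simp add: Let_def\<close>)
  qed
  show ?thesis
  proof (cases h)
    case (TmO k)
    show ?thesis
      by (rule derived.basic[OF ax[OF assms(2)]])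
         (use *[OF bd_Tm_in[OF X assms(2)[unfolded TmO]]] in \<open>simp add: Let_def TmO\<close>)
  qed (use * assms(2) in simp)
qed

text \<open>
  If all variables of the context are arguments, the last variable of the context has to be the last
  argument: if the last argument occurred earlier, all arguments, and so all variables, would precede the
  last variable of the context. So the context is forced, from the end to the beginning.
\<close>

lemma wf_ctx_full:
  assumes "wf_ctx X \<Gamma>" "wf_type X \<Gamma> (type_app A (map \<sigma> [0..<k]))" "fst ` set \<Gamma> \<subseteq> \<sigma> ` {0..<k}"
  shows "\<Gamma> = map_ctx \<sigma> (free_ctx X k A)"
  using assms
proof (induction arbitrary: A k rule: wf_ctx.induct)
  case nil
  then show ?case by (cases k) (auto dest: wf_type_snocD)
next
  case (snoc \<Gamma> S x)
  then obtain l where k: "k = Suc l" by (cases k) auto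
  let ?B = "bd X (Ext l) A"
  have mem: "(\<sigma> l, type_app ?B (map \<sigma> [0..<l])) \<in> set (\<Gamma> @ [(x, S)])"
    using wf_type_snocD[of X "\<Gamma> @ [(x, S)]" A "map \<sigma> [0..<l]" "\<sigma> l"] snoc.prems(1) by (simp add: k)
  have "(\<sigma> l, type_app ?B (map \<sigma> [0..<l])) \<notin> set \<Gamma>"
  proof
    assume m: "(\<sigma> l, type_app ?B (map \<sigma> [0..<l])) \<in> set \<Gamma>"
    then have "\<sigma> ` {0..<l} \<subseteq> fst ` set \<Gamma>"
      using wf_type_vars[OF snoc.hyps(1) wf_ctx_type[OF snoc.hyps(1) m]] by simp
    moreover have "\<sigma> l \<in> fst ` set \<Gamma>" using m by force
    moreover have "{0..<k} = insert l {0..<l}" by (auto simp: k)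
    ultimately have "\<sigma> ` {0..<k} \<subseteq> fst ` set \<Gamma>" by auto
    moreover have "x \<in> \<sigma> ` {0..<k}" using snoc.prems by auto
    ultimately show False using snoc.hyps by blast
  qed
  with mem have x: "x = \<sigma> l" "S = type_app ?B (map \<sigma> [0..<l])" by auto
  have "fst ` set \<Gamma> \<subseteq> \<sigma> ` {0..<l}"
  proof
    fix v assume v: "v \<in> fst ` set \<Gamma>"
    moreover have "\<sigma> l \<notin> fst ` set \<Gamma>" using snoc.hyps(3) unfolding x(1) .
    moreover have "fst ` set \<Gamma> \<subseteq> \<sigma> ` {0..<k}" using snoc.prems(2) by simp
    ultimately have "v \<in> \<sigma> ` {0..<k}" "v \<noteq> \<sigma> l" using v by blast+
    then show "v \<in> \<sigma> ` {0..<l}" by (auto simp: k less_Suc_eq)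
  qed
  from snoc.IH[OF snoc.hyps(2)[unfolded x] this] show ?case
    by (simp add: k Let_def gen_app_eq x)
qed

lemma wf_type_remove: "wf_type X (\<Gamma> @ (y, S) # \<Delta>) T \<Longrightarrow> y \<notin> evars T \<Longrightarrow> wf_type X (\<Gamma> @ \<Delta>) T"
  by (erule wf_type_cases') (auto intro: wf_type.intros)

lemma wf_ctx_remove:
  "wf_ctx X (\<Gamma> @ (y, S) # \<Delta>) \<Longrightarrow> y \<notin> cvars \<Delta> \<Longrightarrow> wf_ctx X (\<Gamma> @ \<Delta>)"
proof (induction \<Delta> rule: rev_induct)
  case Nil
  then show ?case by (simp add: wf_ctx_append)
next
  case (snoc p \<Delta>)
  obtain z U where p: "p = (z, U)" by force
  have *: "wf_ctx X (\<Gamma> @ (y, S) # \<Delta>)" "wf_type X (\<Gamma> @ (y, S) # \<Delta>) U" "z \<notin> fst ` set (\<Gamma> @ (y, S) # \<Delta>)"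
    using snoc.prems(1) wf_ctx_snoc_iff[of X "\<Gamma> @ (y, S) # \<Delta>" z U] by (auto simp: p)
  have "y \<notin> evars U" "y \<notin> cvars \<Delta>" using snoc.prems(2) by (auto simp: p cvars_def)
  then show ?case
    using wf_ctx_snoc_iff[of X "\<Gamma> @ \<Delta>" z U] snoc.IH[OF *(1)] * wf_type_remove[OF *(2)]
    by (auto simp: p)
qed

text \<open>
  Take the last variable \<open>y\<close> that is not an argument. All variables after it are arguments, and by
  \<open>wf_type_chain\<close> their types mention arguments only. So \<open>y\<close> can be deleted, and the
  judgement is a weakening.
\<close>

lemma unused_variable:
  assumes \<Gamma>: "wf_ctx X \<Gamma>" "wf_type X \<Gamma> (type_app A ys)" and ex: "\<not> fst ` set \<Gamma> \<subseteq> set ys"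
  obtains \<Gamma>1 y S \<Delta> where "\<Gamma> = \<Gamma>1 @ (y, S) # \<Delta>" "y \<notin> cvars \<Gamma>1 \<union> cvars \<Delta>" "wf_ctx X (\<Gamma>1 @ \<Delta>)"
    "wf_type X (\<Gamma>1 @ \<Delta>) (type_app A ys)" "wf_ctx X \<Gamma>1" "wf_type X \<Gamma>1 S"
proof -
  have "\<exists>p\<in>set \<Gamma>. fst p \<notin> set ys" using ex by auto
  then obtain \<Gamma>1 p \<Delta> where "\<Gamma> = \<Gamma>1 @ p # \<Delta>" "fst p \<notin> set ys" and \<Delta>: "\<forall>q\<in>set \<Delta>. fst q \<in> set ys"
    using split_list_last_prop[of \<Gamma> "\<lambda>p. fst p \<notin> set ys"] by auto
  then obtain y S where s: "\<Gamma> = \<Gamma>1 @ (y, S) # \<Delta>" and y: "y \<notin> set ys" by (cases p) auto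
  have 1: "wf_ctx X \<Gamma>1" "wf_type X \<Gamma>1 S" "y \<notin> fst ` set \<Gamma>1"
    using wf_ctx_append[of X "\<Gamma>1 @ [(y, S)]" \<Delta>] \<Gamma>(1) by (auto simp: s wf_ctx_snoc_iff)
  have d: "distinct (map fst \<Gamma>)" by (rule wf_ctx_distinct[OF \<Gamma>(1)])
  have "y \<notin> cvars \<Delta>"
  proof
    assume "y \<in> cvars \<Delta>"
    then obtain z U where z: "(z, U) \<in> set \<Delta>" "y = z \<or> y \<in> evars U" by (auto simp: cvars_def)
    have "z \<in> set ys" using \<Delta> z by auto
    then obtain i where i: "i < length ys" "z = ys ! i" by (auto simp: in_set_conv_nth)
    have "U = type_app (bd_to X (length ys) i A) (take i ys)"
      by (rule eq_key_imp_eq_value[OF d _ wf_type_chain[OF \<Gamma> i(1)]]) (use z(1) in \<open>simp add: s i\<close>)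
    then show False using z y \<open>z \<in> set ys\<close> by (auto dest: in_set_takeD)
  qed
  moreover have "y \<notin> cvars \<Gamma>1" using 1 wf_ctx_vars by blast
  ultimately show ?thesis
    using that[OF s] 1 wf_ctx_remove[OF \<Gamma>(1)[unfolded s]] wf_type_remove[OF \<Gamma>(2)[unfolded s]] y by auto
qed

text \<open>
  The arguments are distinct, because the type of a variable tells at which place of the chain it
  occurs.
\<close>

lemma renamed_gen_jud:
  assumes X: "is_psh X" and \<Gamma>: "wf_ctx X \<Gamma>" "wf_type X \<Gamma> (type_app A ys)" "fst ` set \<Gamma> \<subseteq> set ys"
    and A: "A \<in> elts X (TyO (length ys))"
  shows "\<exists>\<sigma>. bij \<sigma> \<and> ys = map \<sigma> [0..<length ys] \<and> \<Gamma> = map_ctx \<sigma> (free_ctx X (length ys) A)"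
proof -
  have "distinct ys"
  proof (rule ccontr)
    assume "\<not> distinct ys"
    then obtain xs zs vs y where ys: "ys = xs @ [y] @ zs @ [y] @ vs" using not_distinct_decomp by blast
    define i j where "i = length xs" and "j = Suc (length xs + length zs)"
    have ij: "i < length ys" "j < length ys" "ys ! i = ys ! j" "i < j"
      by (auto simp: ys i_def j_def nth_append)
    have "type_app (bd_to X (length ys) i A) (take i ys) = type_app (bd_to X (length ys) j A) (take j ys)"
      by (rule eq_key_imp_eq_value[OF wf_ctx_distinct[OF \<Gamma>(1)] wf_type_chain[OF \<Gamma>(1,2) ij(1)]])
        (use wf_type_chain[OF \<Gamma>(1,2) ij(2)] ij(3) in simp)
    then have "length (take i ys) = length (take j ys)" by simp
    with ij show False by simp
  qed
  then obtain \<sigma> where \<sigma>: "bij \<sigma>" "map \<sigma> [0..<length ys] = ys"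
    using ex_bij_map[of "[0..<length ys]" ys] by auto
  have "\<sigma> ` {0..<length ys} = set ys" using arg_cong[OF \<sigma>(2), of set] by simp
  then show ?thesis using wf_ctx_full[OF \<Gamma>(1), of A \<sigma> "length ys"] \<Gamma> \<sigma> by auto
qed

text \<open>
  A judgement with an unused variable is the weakening of a shorter one; a judgement without unused
  variables is a renamed basic judgement.
\<close>

lemma derived_type:
  assumes X: "is_psh X"
  shows "wf_ctx X \<Gamma> \<Longrightarrow> wf_type X \<Gamma> T \<Longrightarrow> \<Gamma> \<turnstile> Typ T \<in> derived (free_gat X)"
proof (induction "length \<Gamma>" arbitrary: \<Gamma> T rule: less_induct)
  case less
  obtain A ys where T: "T = type_app A ys" and A: "A \<in> elts X (TyO (length ys))"
    using wf_type_type_app[OF less.prems(2)] by blast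
  show ?case
  proof (cases "fst ` set \<Gamma> \<subseteq> set ys")
    case True
    from renamed_gen_jud[OF X less.prems[unfolded T] True A]
    obtain \<sigma> where \<sigma>: "bij \<sigma>" "map \<sigma> [0..<length ys] = ys" "\<Gamma> = map_ctx \<sigma> (free_ctx X (length ys) A)" by auto
    have "map_jud \<sigma> id (gen_jud X (TyO (length ys)) A) = \<Gamma> \<turnstile> Typ T"
      by (simp add: gen_app_eq \<sigma> T)
    with derived.rule[OF rule_app.intros(9)[OF \<sigma>(1)], of "gen_jud X (TyO (length ys)) A" "free_gat X"]
    show ?thesis using gen_jud_derived[OF X A] by simp
  next
    case False
    from unused_variable[OF less.prems(1) less.prems(2)[unfolded T] False]
    obtain \<Gamma>1 y S \<Delta> where *: "\<Gamma> = \<Gamma>1 @ (y, S) # \<Delta>" "y \<notin> cvars \<Gamma>1 \<union> cvars \<Delta>" "wf_ctx X (\<Gamma>1 @ \<Delta>)"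
    "wf_type X (\<Gamma>1 @ \<Delta>) (type_app A ys)" "wf_ctx X \<Gamma>1" "wf_type X \<Gamma>1 S" by blast
    have "\<Gamma>1 \<turnstile> Typ S \<in> derived (free_gat X)" "\<Gamma>1 @ \<Delta> \<turnstile> Typ T \<in> derived (free_gat X)"
      using less.hyps * T by auto
    with derived.rule[OF rule_app.intros(10)[OF *(2)], of S "Typ T" "free_gat X"] show ?thesis
      by (simp add: *(1))
  qed
qed

lemma derived_term:
  assumes X: "is_psh X"
  shows "wf_ctx X \<Gamma> \<Longrightarrow> wf_term X \<Gamma> t T \<Longrightarrow> \<Gamma> \<turnstile> Trm t T \<in> derived (free_gat X)"
proof (induction "length \<Gamma>" arbitrary: \<Gamma> rule: less_induct)
  case less
  obtain a ys where t: "t = term_app a ys" "T = type_app (bd X (Tm (length ys)) a) ys" "a \<in> elts X (TmO (length ys))"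
      and T: "wf_type X \<Gamma> (type_app (bd X (Tm (length ys)) a) ys)"
    using less.prems(2) by (auto simp: wf_term_def)
  show ?case
  proof (cases "fst ` set \<Gamma> \<subseteq> set ys")
    case True
    from renamed_gen_jud[OF X less.prems(1) T True bd_Tm_in[OF X t(3)]]
    obtain \<sigma> where \<sigma>: "bij \<sigma>" "map \<sigma> [0..<length ys] = ys"
      "\<Gamma> = map_ctx \<sigma> (free_ctx X (length ys) (bd X (Tm (length ys)) a))" by auto
    have "map_jud \<sigma> id (gen_jud X (TmO (length ys)) a) = \<Gamma> \<turnstile> Trm t T"
      by (simp add: gen_app_eq \<sigma> t Let_def)
    with derived.rule[OF rule_app.intros(9)[OF \<sigma>(1)], of "gen_jud X (TmO (length ys)) a" "free_gat X"]
    show ?thesis using gen_jud_derived[OF X t(3)] by simp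
  next
    case False
    from unused_variable[OF less.prems(1) T False]
    obtain \<Gamma>1 y S \<Delta> where *: "\<Gamma> = \<Gamma>1 @ (y, S) # \<Delta>" "y \<notin> cvars \<Gamma>1 \<union> cvars \<Delta>" "wf_ctx X (\<Gamma>1 @ \<Delta>)"
    "wf_type X (\<Gamma>1 @ \<Delta>) (type_app (bd X (Tm (length ys)) a) ys)" "wf_ctx X \<Gamma>1" "wf_type X \<Gamma>1 S" by blast
    have "\<Gamma>1 \<turnstile> Typ S \<in> derived (free_gat X)" using derived_type[OF X] * by simp
    moreover have "\<Gamma>1 @ \<Delta> \<turnstile> Trm t T \<in> derived (free_gat X)"
      by (rule less.hyps) (use * t in \<open>auto simp: wf_term_def\<close>)
    ultimately show ?thesis
      using derived.rule[OF rule_app.intros(10)[OF *(2)], of S "Trm t T" "free_gat X"] by (simp add: *(1))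
  qed
qed

theorem derived_free_gat:
  assumes X: "is_psh X"
  shows "J \<in> derived (free_gat X) \<longleftrightarrow> wf_jud X J"
proof
  assume "wf_jud X J"
  then show "J \<in> derived (free_gat X)"
  proof (cases "(X, J)" rule: wf_jud.cases)
    case (3 _ \<Gamma> T T')
    with \<open>wf_jud X J\<close> derived.rule[OF rule_app.intros(4)[of \<Gamma> T], of "free_gat X"] derived_type[OF X, of \<Gamma> T]
    show ?thesis by auto
  next
    case (4 _ \<Gamma> t t' T)
    with \<open>wf_jud X J\<close> derived.rule[OF rule_app.intros(1)[of \<Gamma> t T], of "free_gat X"] derived_term[OF X, of \<Gamma> t T]
    show ?thesis by auto
  qed (auto simp: derived_type[OF X] derived_term[OF X])
qed (rule wf_if_derived[OF X])

lemma is_gat_free_gat: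
  assumes X: "is_psh X" shows "is_gat (free_gat X)"
proof -
  have gj: "is_jud (gen_jud X h x)" for h x by (cases h) (auto simp: Let_def)
  have cc: "(y, T) \<in> set (free_ctx X k A) \<Longrightarrow> A \<in> elts X (TyO k) \<Longrightarrow> ecns T \<subseteq> Inl ` {(k, A). A \<in> elts X (TyO k)}"
    for y T k A
  proof (induction k arbitrary: A)
    case (Suc k)
    then show ?case using bd_Ext_in[OF X Suc.prems(2)] by (auto simp: Let_def gen_app_def)
  qed simp
  have cns: "jcns (gen_jud X h x) \<subseteq> TyC (free_gat X) <+> TmC (free_gat X)" if "x \<in> elts X h" for h x
  proof (cases h)
    case (TyO k)
    then show ?thesis using that cc[of _ _ k x] by (fastforce simp: free_gat_def gen_app_def Plus_def)
  next
    case (TmO k)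
    then show ?thesis using that cc[of _ _ k "bd X (Tm k) x"] bd_Tm_in[OF X, of x k]
      by (fastforce simp: free_gat_def gen_app_def Plus_def Let_def)
  qed
  have ity: "introduces_type (gen_jud X h x) A \<longleftrightarrow> (\<exists>k. h = TyO k \<and> A = (k, x))" for h x A
  proof (cases h)
    case (TyO k)
    have "map Var [0..<k] = map (Var \<circ> fst) (free_ctx X k x)"
      using arg_cong[OF fst_free_ctx[of X k x], of "map Var"] by (metis map_map)
    then show ?thesis using TyO by (auto simp: introduces_type_def gen_app_def)
  qed (auto simp: introduces_type_def Let_def)
  have itm: "introduces_term (gen_jud X h x) a \<longleftrightarrow> (\<exists>k. h = TmO k \<and> a = (k, x))" for h x a
  proof (cases h)
    case (TmO k)
    have "map Var [0..<k] = map (Var \<circ> fst) (free_ctx X k (bd X (Tm k) x))"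
      using arg_cong[OF fst_free_ctx[of X k "bd X (Tm k) x"], of "map Var"] by (metis map_map)
    then show ?thesis using TmO by (auto simp: introduces_term_def gen_app_def Let_def)
  qed (auto simp: introduces_term_def)
  have ax: "Ax (free_gat X) = {gen_jud X h x | h x. x \<in> elts X h}"
    "TyC (free_gat X) = {(k, A). A \<in> elts X (TyO k)}" "TmC (free_gat X) = {(k, a). a \<in> elts X (TmO k)}"
    by (auto simp: free_gat_def)
  show ?thesis
    unfolding is_gat_def
  proof (intro conjI ballI)
    fix J assume "J \<in> Ax (free_gat X)"
    then obtain h x where J: "J = gen_jud X h x" "x \<in> elts X h" by (auto simp: ax)
    then show "is_jud J" "jcns J \<subseteq> TyC (free_gat X) <+> TmC (free_gat X)" using gj cns by auto
    show "(\<exists>A\<in>TyC (free_gat X). introduces_type J A) \<or> (\<exists>f\<in>TmC (free_gat X). introduces_term J f) \<or> is_equality J"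
      using J by (cases h) (auto simp: ity itm ax simp del: gen_jud.simps)
  next
    fix A assume "A \<in> TyC (free_gat X)"
    then obtain k B where "A = (k, B)" "B \<in> elts X (TyO k)" by (auto simp: ax)
    then show "\<exists>!J. J \<in> Ax (free_gat X) \<and> introduces_type J A"
      by (intro ex1I[of _ "gen_jud X (TyO k) B"]) (auto simp: ity ax simp del: gen_jud.simps)
  next
    fix a assume "a \<in> TmC (free_gat X)"
    then obtain k b where "a = (k, b)" "b \<in> elts X (TmO k)" by (auto simp: ax)
    then show "\<exists>!J. J \<in> Ax (free_gat X) \<and> introduces_term J a"
      by (intro ex1I[of _ "gen_jud X (TmO k) b"]) (auto simp: itm ax simp del: gen_jud.simps)
  next
    show "Ax (free_gat X) \<subseteq> derived (free_gat X)" using gen_jud_derived[OF X] by (auto simp: ax)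
  qed
qed

section \<open>Equality of judgements in a free theory\<close>

fun pos :: "'v list \<Rightarrow> 'v \<Rightarrow> nat" where
  "pos [] y = 0"
| "pos (x # xs) y = (if x = y then 0 else Suc (pos xs y))"

lemma pos_less: "y \<in> set xs \<Longrightarrow> pos xs y < length xs"
  by (induction xs) auto

lemma nth_pos: "y \<in> set xs \<Longrightarrow> xs ! pos xs y = y"
  by (induction xs) auto

lemma pos_nth: "distinct xs \<Longrightarrow> i < length xs \<Longrightarrow> pos xs (xs ! i) = i"
  by (metis nth_eq_iff_index_eq nth_mem nth_pos pos_less)

lemma pos_append: "y \<in> set xs \<Longrightarrow> pos (xs @ zs) y = pos xs y"
  by (induction xs) auto

lemma pos_take: "y \<in> set (take i xs) \<Longrightarrow> pos (take i xs) y = pos xs y"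
  by (metis append_take_drop_id pos_append)

lemma ren_pos: "length xs = length ys \<Longrightarrow> y \<in> set ys \<Longrightarrow> ren xs ys y = xs ! pos ys y"
  by (induction xs ys rule: list_induct2) (auto simp: ren_def)

definition rename :: "('v \<Rightarrow> 'x) \<Rightarrow> ('v, 'w) expr \<Rightarrow> ('x, 'w) expr" where
  "rename \<sigma> = map_expr \<sigma> id"

lemma rename_app [simp]:
  "rename \<sigma> (type_app A ys) = type_app A (map \<sigma> ys)" "rename \<sigma> (term_app A ys) = term_app A (map \<sigma> ys)"
  by (simp_all add: rename_def)

lemma rename_rename: "rename \<sigma> (rename \<tau> E) = rename (\<lambda>v. \<sigma> (\<tau> v)) E"
  by (simp add: rename_def expr.map_comp o_def id_def)

lemma rename_cong: "(\<And>v. v \<in> evars E \<Longrightarrow> \<sigma> v = \<tau> v) \<Longrightarrow> rename \<sigma> E = rename \<tau> E"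
  unfolding rename_def by (rule expr.map_cong) auto

lemma rename_ident: "(\<And>v. v \<in> evars E \<Longrightarrow> \<sigma> v = v) \<Longrightarrow> rename \<sigma> E = E"
  using rename_cong[of E \<sigma> id] expr.map_id[of E] by (simp add: rename_def)

text \<open>
  The empty list marks the equality judgements, so \<open>exps J \<noteq> []\<close> says that \<open>J\<close> is a type or
  term judgement.
\<close>

fun exps :: "('v, 'w) jud \<Rightarrow> ('v, 'w) expr list" where
  "exps (\<Gamma> \<turnstile> Typ T) = map snd \<Gamma> @ [T]"
| "exps (\<Gamma> \<turnstile> Trm t T) = map snd \<Gamma> @ [T, t]"
| "exps J = []"

fun vars :: "('v, 'w) jud \<Rightarrow> 'v list" where
  "vars (\<Gamma> \<turnstile> R) = map fst \<Gamma>"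

text \<open>
  Replacing variables by their positions in the context gives a normal form for judgements up to
  renaming. Type and term judgements remain distinguishable: the last entry of the list has a
  type-constant as its head in the first case, and a term-constant in the second.
\<close>

definition canon :: "('v, 'w) jud \<Rightarrow> (nat, 'w) expr list" where
  "canon J = map (rename (pos (vars J))) (exps J)"

lemma wf_jud_distinct: "wf_jud X J \<Longrightarrow> distinct (vars J)"
  by (cases "(X, J)" rule: wf_jud.cases) (auto intro: wf_ctx_distinct)

text \<open>
  The value on equality judgements is a default.
\<close>

fun kind :: "('v, 'w) jud \<Rightarrow> hob" where
  "kind (\<Gamma> \<turnstile> Typ T) = TyO (length \<Gamma>)"
| "kind (\<Gamma> \<turnstile> Trm t T) = TmO (length \<Gamma>)"
| "kind (\<Gamma> \<turnstile> R) = TyO 0"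

lemma juds_at_free:
  assumes "is_psh X"
  shows "juds_at (free_gat X) h = {J. wf_jud X J \<and> exps J \<noteq> [] \<and> kind J = h}"
proof -
  have "J \<in> juds_at (free_gat X) h \<longleftrightarrow> wf_jud X J \<and> exps J \<noteq> [] \<and> kind J = h" for J
    by (cases h; cases J rule: exps.cases)
       (auto simp: type_juds_def term_juds_def derived_free_gat[OF assms])
  then show ?thesis by blast
qed

lemma wf_ctx_nth_vars:
  assumes "wf_ctx X \<Gamma>" "i < length \<Gamma>"
  shows "wf_type X (take i \<Gamma>) (snd (\<Gamma> ! i))" "wf_ctx X (take i \<Gamma>)"
    "evars (snd (\<Gamma> ! i)) \<subseteq> set (take i (map fst \<Gamma>))"
proof -
  have "wf_ctx X (take (Suc i) \<Gamma>)" using wf_ctx_append[of X "take (Suc i) \<Gamma>" "drop (Suc i) \<Gamma>"] assms by simp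
  moreover have "take (Suc i) \<Gamma> = take i \<Gamma> @ [(fst (\<Gamma> ! i), snd (\<Gamma> ! i))]"
    using assms(2) by (simp add: take_Suc_conv_app_nth)
  ultimately have *: "wf_ctx X (take i \<Gamma>)" "wf_type X (take i \<Gamma>) (snd (\<Gamma> ! i))"
    using wf_ctx_snoc_iff by metis+
  then show "wf_type X (take i \<Gamma>) (snd (\<Gamma> ! i))" "wf_ctx X (take i \<Gamma>)" by auto
  show "evars (snd (\<Gamma> ! i)) \<subseteq> set (take i (map fst \<Gamma>))"
    using wf_type_vars[OF *] by (simp add: take_map)
qed

lemma exps_nth_vars:
  assumes "wf_jud X (\<Gamma> \<turnstile> Typ T)" "i \<le> length \<Gamma>"
  shows "evars ((map snd \<Gamma> @ [T]) ! i) \<subseteq> set (take i (map fst \<Gamma>))"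
proof (cases "i = length \<Gamma>")
  case True
  then show ?thesis using wf_type_vars[of X \<Gamma> T] assms by (simp add: nth_append)
next
  case False
  then show ?thesis using wf_ctx_nth_vars(3)[of X \<Gamma> i] assms by (simp add: nth_append)
qed

lemma wf_term_vars: "wf_ctx X \<Gamma> \<Longrightarrow> wf_term X \<Gamma> t T \<Longrightarrow> evars t = evars T \<and> evars T \<subseteq> fst ` set \<Gamma>"
  using wf_type_vars by (fastforce simp: wf_term_def)

lemma exps_vars:
  assumes "wf_jud X J" "E \<in> set (exps J)" shows "evars E \<subseteq> set (vars J)"
proof (cases J rule: exps.cases)
  case (1 \<Gamma> T)
  then show ?thesis using assms wf_type_vars[of X \<Gamma>] wf_ctx_type[of X \<Gamma>] by fastforce
next
  case (2 \<Gamma> t T)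
  then show ?thesis
    using assms wf_term_vars[of X \<Gamma>] wf_type_vars[of X \<Gamma>] wf_ctx_type[of X \<Gamma>] by fastforce
qed (use assms in auto)

text \<open>
  The substitution in the definition of the equivalence of judgements sends a variable to the one at the
  same position of the other context.
\<close>

lemma canonical_eq_iff:
  assumes "evars E \<subseteq> set (take i xs)" "evars E' \<subseteq> set (take i ys)" "length xs = length ys" "distinct xs"
  shows "E = map_expr (ren (take i xs) (take i ys)) id E' \<longleftrightarrow> rename (pos xs) E = rename (pos ys) E'"
proof -
  have l: "length (take i xs) = length (take i ys)" using assms(3) by simp
  have r: "map_expr (ren (take i xs) (take i ys)) id E' = rename (\<lambda>v. take i xs ! pos ys v) E'"
    unfolding rename_def[symmetric]
    by (rule rename_cong) (use assms in \<open>auto simp: ren_pos[OF l] pos_take\<close>)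
  have p: "pos xs (take i xs ! pos ys v) = pos ys v" if "v \<in> evars E'" for v
  proof -
    have v: "v \<in> set (take i ys)" using that assms(2) by auto
    have "pos ys v < length (take i xs)" using pos_less[OF v] pos_take[OF v] l by simp
    then show ?thesis using pos_nth[OF assms(4), of "pos ys v"] by simp
  qed
  have q: "take i xs ! pos xs v = v" if "v \<in> evars E" for v
    using that assms(1) pos_take[of v i xs] nth_pos[of v "take i xs"] by auto
  show ?thesis
    unfolding r
  proof
    assume E: "E = rename (\<lambda>v. take i xs ! pos ys v) E'"
    show "rename (pos xs) E = rename (pos ys) E'"
      unfolding E rename_rename by (rule rename_cong) (rule p)
  next
    assume e: "rename (pos xs) E = rename (pos ys) E'"
    have "E = rename (\<lambda>v. take i xs ! v) (rename (pos xs) E)"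
      by (simp add: rename_rename rename_ident q)
    then show "E = rename (\<lambda>v. take i xs ! pos ys v) E'" unfolding e rename_rename .
  qed
qed

lemma type_app_neq_term_app [simp]: "type_app A ys \<noteq> term_app a zs" "term_app a zs \<noteq> type_app A ys"
  by (auto simp: type_app_def term_app_def)

lemma jeq_free_types:
  assumes X: "is_psh X" and wf: "wf_jud X (\<Gamma> \<turnstile> Typ S)" "wf_jud X (\<Delta> \<turnstile> Typ S')"
  shows "(\<Gamma> \<turnstile> Typ S, \<Delta> \<turnstile> Typ S') \<in> jeq (free_gat X) \<longleftrightarrow> canon (\<Gamma> \<turnstile> Typ S) = canon (\<Delta> \<turnstile> Typ S')"
proof -
  let ?E = "map snd \<Gamma> @ [S]" and ?F = "map snd \<Delta> @ [S']"
  have key: "?E ! i = map_expr (ren (take i (map fst \<Gamma>)) (take i (map fst \<Delta>))) id (?F ! i) \<longleftrightarrow>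
      rename (pos (map fst \<Gamma>)) (?E ! i) = rename (pos (map fst \<Delta>)) (?F ! i)"
    if "length \<Gamma> = length \<Delta>" "i \<le> length \<Gamma>" for i
    by (rule canonical_eq_iff[OF exps_nth_vars[OF wf(1)] exps_nth_vars[OF wf(2)]])
       (use that wf_jud_distinct[OF wf(1)] in auto)
  have canon: "canon (\<Gamma> \<turnstile> Typ S) = canon (\<Delta> \<turnstile> Typ S') \<longleftrightarrow> length \<Gamma> = length \<Delta> \<and>
      (\<forall>i\<le>length \<Gamma>. rename (pos (map fst \<Gamma>)) (?E ! i) = rename (pos (map fst \<Delta>)) (?F ! i))"
    unfolding canon_def list_eq_iff_nth_eq by (auto simp: less_Suc_eq_le simp del: map_append)
  show ?thesis
    unfolding canon
  proof
    assume "(\<Gamma> \<turnstile> Typ S, \<Delta> \<turnstile> Typ S') \<in> jeq (free_gat X)"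
    then show "length \<Gamma> = length \<Delta> \<and>
      (\<forall>i\<le>length \<Gamma>. rename (pos (map fst \<Gamma>)) (?E ! i) = rename (pos (map fst \<Delta>)) (?F ! i))"
    proof (cases rule: jeq.cases)
      case jeq_type
      then have "?E ! i = map_expr (ren (take i (map fst \<Gamma>)) (take i (map fst \<Delta>))) id (?F ! i)"
        if "i \<le> length \<Gamma>" for i
        using that by (simp add: derived_free_gat[OF X])
      then show ?thesis using key jeq_type by simp
    qed
  next
    assume *: "length \<Gamma> = length \<Delta> \<and>
      (\<forall>i\<le>length \<Gamma>. rename (pos (map fst \<Gamma>)) (?E ! i) = rename (pos (map fst \<Delta>)) (?F ! i))"
    show "(\<Gamma> \<turnstile> Typ S, \<Delta> \<turnstile> Typ S') \<in> jeq (free_gat X)"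
    proof (rule jeq.jeq_type)
      show "\<forall>i\<le>length \<Gamma>. take i \<Gamma> \<turnstile> TypEq (?E ! i)
        (map_expr (ren (take i (map fst \<Gamma>)) (take i (map fst \<Delta>))) id (?F ! i)) \<in> derived (free_gat X)"
      proof (intro allI impI)
        fix i assume i: "i \<le> length \<Gamma>"
        have "wf_ctx X (take i \<Gamma>) \<and> wf_type X (take i \<Gamma>) (?E ! i)"
          using wf wf_ctx_nth_vars[of X \<Gamma> i] i by (cases "i = length \<Gamma>") (auto simp: nth_append)
        then show "take i \<Gamma> \<turnstile> TypEq (?E ! i)
          (map_expr (ren (take i (map fst \<Gamma>)) (take i (map fst \<Delta>))) id (?F ! i)) \<in> derived (free_gat X)"
          using key[of i] * i by (simp add: derived_free_gat[OF X])
      qed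
    qed (use * wf in \<open>auto simp: derived_free_gat[OF X]\<close>)
  qed
qed

lemma wf_jud_boundary_term: "is_psh X \<Longrightarrow> wf_jud X (\<Gamma> \<turnstile> Trm t T) \<Longrightarrow> wf_jud X (\<Gamma> \<turnstile> Typ T)"
  by (auto simp: wf_term_def)

lemma canon_Trm: "canon (\<Gamma> \<turnstile> Trm t T) = canon (\<Gamma> \<turnstile> Typ T) @ [rename (pos (map fst \<Gamma>)) t]"
  by (simp add: canon_def)

lemma jeq_free_terms:
  assumes X: "is_psh X" and wf: "wf_jud X (\<Gamma> \<turnstile> Trm s S)" "wf_jud X (\<Delta> \<turnstile> Trm t S')"
  shows "(\<Gamma> \<turnstile> Trm s S, \<Delta> \<turnstile> Trm t S') \<in> jeq (free_gat X) \<longleftrightarrow> canon (\<Gamma> \<turnstile> Trm s S) = canon (\<Delta> \<turnstile> Trm t S')"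
proof -
  note wf' = wf[THEN wf_jud_boundary_term[OF X]]
  have "(\<Gamma> \<turnstile> Trm s S, \<Delta> \<turnstile> Trm t S') \<in> jeq (free_gat X) \<longleftrightarrow> (\<Gamma> \<turnstile> Typ S, \<Delta> \<turnstile> Typ S') \<in> jeq (free_gat X) \<and>
      s = map_expr (ren (map fst \<Gamma>) (map fst \<Delta>)) id t"
    using wf by (auto simp: derived_free_gat[OF X] elim: jeq.cases intro: jeq.jeq_term)
  moreover have "s = map_expr (ren (map fst \<Gamma>) (map fst \<Delta>)) id t \<longleftrightarrow>
      rename (pos (map fst \<Gamma>)) s = rename (pos (map fst \<Delta>)) t" if "length \<Gamma> = length \<Delta>"
    using canonical_eq_iff[of s "length \<Gamma>" "map fst \<Gamma>" t "map fst \<Delta>"] wf that wf_jud_distinct[OF wf(1)]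
      exps_vars[OF wf(1)] exps_vars[OF wf(2)] by simp
  moreover have "length \<Gamma> = length \<Delta>" if "canon (\<Gamma> \<turnstile> Typ S) = canon (\<Delta> \<turnstile> Typ S')"
    using arg_cong[OF that, of length] by (simp add: canon_def)
  ultimately show ?thesis unfolding canon_Trm jeq_free_types[OF X wf'] by auto
qed

lemma last_canon_type: "wf_jud X (\<Gamma> \<turnstile> Typ S) \<Longrightarrow> \<exists>A ys. last (canon (\<Gamma> \<turnstile> Typ S)) = type_app A ys"
  by (auto simp: canon_def elim!: wf_type_type_app)

lemma last_canon_term: "wf_jud X (\<Gamma> \<turnstile> Trm t S) \<Longrightarrow> \<exists>A ys. last (canon (\<Gamma> \<turnstile> Trm t S)) = term_app A ys"
  by (auto simp: canon_def wf_term_def)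

lemma jeq_free_iff:
  assumes X: "is_psh X" and wf: "wf_jud X J" "wf_jud X K" and ne: "exps J \<noteq> []" "exps K \<noteq> []"
  shows "(J, K) \<in> jeq (free_gat X) \<longleftrightarrow> canon J = canon K"
proof (cases J rule: exps.cases)
  case (1 \<Gamma> S)
  show ?thesis
  proof (cases K rule: exps.cases)
    case K: (2 \<Delta> t T)
    then have "(J, K) \<notin> jeq (free_gat X)" using 1 by (auto elim: jeq.cases)
    moreover have "canon J \<noteq> canon K" using last_canon_type last_canon_term wf 1 K by (metis type_app_neq_term_app(1))
    ultimately show ?thesis by simp
  qed (use 1 jeq_free_types[OF X] wf ne in auto)
next
  case (2 \<Gamma> s S)
  show ?thesis
  proof (cases K rule: exps.cases)
    case K: (1 \<Delta> T)
    then have "(J, K) \<notin> jeq (free_gat X)" using 2 by (auto elim: jeq.cases)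
    moreover have "canon J \<noteq> canon K" using last_canon_type last_canon_term wf 2 K by (metis type_app_neq_term_app(1))
    ultimately show ?thesis by simp
  qed (use 2 jeq_free_terms[OF X] wf ne in auto)
qed (use ne in auto)

lemma jeq_free_wf:
  assumes X: "is_psh X" and "(J, K) \<in> jeq (free_gat X)"
  shows "wf_jud X J" "wf_jud X K" "exps J \<noteq> []" "exps K \<noteq> []"
  using assms(2) by (auto elim!: jeq.cases simp flip: derived_free_gat[OF X])

text \<open>
  Equal codes come from equal representatives, so the encoded classes meet.
\<close>

lemma encode_eq:
  assumes inj: "\<exists>f :: 'j \<Rightarrow> 'u. inj f" and "A \<noteq> {}" "B \<noteq> {}" and "(encode A :: 'u) = encode B"
  shows "(A :: 'j set) \<inter> B \<noteq> {}"
proof -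
  let ?f = "SOME f :: 'j \<Rightarrow> 'u. inj f"
  have "inj ?f" using inj by (rule someI_ex)
  then have "(SOME J. J \<in> A) = (SOME J. J \<in> B)" using assms(4) by (simp add: encode_def inj_eq)
  moreover have "(SOME J. J \<in> A) \<in> A" "(SOME J. J \<in> B) \<in> B" using assms(2,3) by (simp_all add: some_in_eq)
  ultimately show ?thesis by auto
qed

lemma cls_eq_iff:
  fixes X :: "'u::infinite psh"
  assumes X: "is_psh X" and J: "wf_jud X J" "exps J \<noteq> []" and K: "wf_jud X K" "exps K \<noteq> []"
  shows "cls (free_gat X) J = cls (free_gat X) K \<longleftrightarrow> canon J = canon K"
proof
  assume "cls (free_gat X) J = cls (free_gat X) K"
  then obtain J' where "(J, J') \<in> jeq (free_gat X)" "(K, J') \<in> jeq (free_gat X)"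
    using encode_eq[OF ex_inj_jud, of "jeq (free_gat X) `` {J}" "jeq (free_gat X) `` {K}"]
      jeq_free_iff[OF X J(1) J(1) J(2) J(2)] jeq_free_iff[OF X K(1) K(1) K(2) K(2)] unfolding cls_def by blast
  then show "canon J = canon K"
    using jeq_free_iff[OF X J(1) _ J(2)] jeq_free_iff[OF X K(1) _ K(2)] jeq_free_wf[OF X] by metis
next
  assume c: "canon J = canon K"
  have "jeq (free_gat X) `` {J} = jeq (free_gat X) `` {K}"
  proof -
    have "(J, L) \<in> jeq (free_gat X) \<longleftrightarrow> (K, L) \<in> jeq (free_gat X)" for L
      using jeq_free_iff[OF X J(1) _ J(2), of L] jeq_free_iff[OF X K(1) _ K(2), of L] jeq_free_wf[OF X] c by metis
    then show ?thesis by auto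
  qed
  then show "cls (free_gat X) J = cls (free_gat X) K" by (simp add: cls_def)
qed

lemma kind_eq_if_canon_eq:
  assumes "wf_jud X J" "exps J \<noteq> []" "wf_jud X K" "exps K \<noteq> []" "canon J = canon K"
  shows "kind J = kind K"
proof -
  have l: "length (canon L) = length (exps L)" for L :: "'a sjud" by (simp add: canon_def)
  show ?thesis
    using assms l[of J] l[of K] last_canon_type[of X] last_canon_term[of X]
    by (cases J rule: exps.cases; cases K rule: exps.cases; simp del: wf_jud.simps) (metis type_app_neq_term_app)+
qed

section \<open>The presheaf of judgements of a free theory\<close>

abbreviation W :: "'u psh \<Rightarrow> 'u psh" where
  "W X \<equiv> on_ob V (free_gat X)"

lemma elts_W: "elts (W X) h = cls (free_gat X) ` juds_at (free_gat X) h"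
  by (simp add: V_def Let_def)

lemma elts_WE:
  assumes X: "is_psh X" and "w \<in> elts (W X) h"
  obtains J where "w = cls (free_gat X) J" "wf_jud X J" "exps J \<noteq> []" "kind J = h"
  using assms(2) by (auto simp: elts_W juds_at_free[OF X])

lemma cls_in_W: "is_psh X \<Longrightarrow> wf_jud X J \<Longrightarrow> exps J \<noteq> [] \<Longrightarrow> cls (free_gat X) J \<in> elts (W X) (kind J)"
  by (auto simp: elts_W juds_at_free)

lemma rep_W:
  assumes X: "is_psh X" and "w \<in> elts (W X) h"
  shows "wf_jud X (rep (free_gat X) h w)" "exps (rep (free_gat X) h w) \<noteq> []" "kind (rep (free_gat X) h w) = h"
    "cls (free_gat X) (rep (free_gat X) h w) = w"
proof -
  obtain J where J: "J \<in> juds_at (free_gat X) h \<and> cls (free_gat X) J = w"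
    using assms(2) by (auto simp: elts_W)
  have "rep (free_gat X) h w \<in> juds_at (free_gat X) h \<and> cls (free_gat X) (rep (free_gat X) h w) = w"
    unfolding rep_def by (rule someI[of _ J]) (rule J)
  then show "wf_jud X (rep (free_gat X) h w)" "exps (rep (free_gat X) h w) \<noteq> []" "kind (rep (free_gat X) h w) = h"
    "cls (free_gat X) (rep (free_gat X) h w) = w"
    by (auto simp: juds_at_free[OF X])
qed

lemma canon_rep:
  fixes X :: "'u::infinite psh"
  assumes X: "is_psh X" and J: "wf_jud X J" "exps J \<noteq> []"
  shows "canon (rep (free_gat X) (kind J) (cls (free_gat X) J)) = canon J"
  using rep_W[OF X cls_in_W[OF X J]] cls_eq_iff[OF X] J by blast

fun bd_jud :: "('v, 'w) jud \<Rightarrow> ('v, 'w) jud" where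
  "bd_jud (\<Gamma> \<turnstile> Typ T) = butlast \<Gamma> \<turnstile> Typ (snd (last \<Gamma>))"
| "bd_jud (\<Gamma> \<turnstile> Trm t T) = \<Gamma> \<turnstile> Typ T"
| "bd_jud J = J"

text \<open>
  Passing to the boundary deletes the last entry of the normal form: positions with respect to the
  context and to its initial segment agree on the variables of the latter. Hence boundaries are well
  defined on classes.
\<close>

lemma boundary_bd_jud:
  assumes X: "is_psh X" and J: "wf_jud X J" "exps J \<noteq> []" "kind J = tgt e"
  shows "boundary J = [bd_jud J]" "wf_jud X (bd_jud J)" "exps (bd_jud J) \<noteq> []" "kind (bd_jud J) = src e"
    "canon (bd_jud J) = butlast (canon J)"
proof -
  have "boundary J = [bd_jud J] \<and> wf_jud X (bd_jud J) \<and> exps (bd_jud J) \<noteq> [] \<and> kind (bd_jud J) = src e \<and>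
    canon (bd_jud J) = butlast (canon J)"
  proof (cases J rule: exps.cases)
    case (1 \<Gamma> T)
    then obtain k where e: "e = Ext k" "length \<Gamma> = Suc k" using J by (cases e) auto
    then obtain \<Delta> p where "\<Gamma> = \<Delta> @ [p]" by (cases \<Gamma> rule: rev_cases) auto
    then obtain x S where \<Gamma>: "\<Gamma> = \<Delta> @ [(x, S)]" by (cases p) auto
    have wf: "wf_ctx X \<Delta>" "wf_type X \<Delta> S" using J 1 \<Gamma> by (auto simp: wf_ctx_snoc_iff)
    have "canon (\<Delta> \<turnstile> Typ S) = butlast (canon J)"
    proof -
      have "rename (pos (map fst \<Delta>)) E = rename (pos (map fst \<Delta> @ [x])) E" if "E \<in> set (exps (\<Delta> \<turnstile> Typ S))" for E
        using exps_vars[of X "\<Delta> \<turnstile> Typ S" E] that wf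
        by (intro rename_cong) (auto simp: pos_append subset_iff)
      then show ?thesis by (simp add: canon_def 1 \<Gamma> butlast_append)
    qed
    then show ?thesis using 1 \<Gamma> e wf by simp
  next
    case (2 \<Gamma> t T)
    then show ?thesis using J wf_jud_boundary_term[OF X, of \<Gamma> t T] by (cases e) (auto simp: canon_Trm)
  qed (use J in auto)
  then show "boundary J = [bd_jud J]" "wf_jud X (bd_jud J)" "exps (bd_jud J) \<noteq> []" "kind (bd_jud J) = src e"
    "canon (bd_jud J) = butlast (canon J)" by auto
qed

lemma bd_W:
  fixes X :: "'u::infinite psh"
  assumes X: "is_psh X" and J: "wf_jud X J" "exps J \<noteq> []" "kind J = tgt e"
  shows "bd (W X) e (cls (free_gat X) J) = cls (free_gat X) (bd_jud J)"
proof -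
  let ?K = "rep (free_gat X) (tgt e) (cls (free_gat X) J)"
  have K: "wf_jud X ?K" "exps ?K \<noteq> []" "kind ?K = tgt e" "canon ?K = canon J"
    using rep_W[OF X cls_in_W[OF X J(1,2)]] canon_rep[OF X J(1,2)] by (auto simp: J(3))
  have "bd (W X) e (cls (free_gat X) J) = cls (free_gat X) (bd_jud ?K)"
    using boundary_bd_jud(1)[OF X K(1-3)] by (simp add: V_def Let_def)
  also have "\<dots> = cls (free_gat X) (bd_jud J)"
    using cls_eq_iff[OF X] boundary_bd_jud[OF X K(1-3)] boundary_bd_jud[OF X J] K(4) by simp
  finally show ?thesis .
qed

lemma is_psh_W:
  fixes X :: "'u::infinite psh"
  assumes X: "is_psh X" shows "is_psh (W X)"
  unfolding is_psh_def
proof (intro allI funcsetI)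
  fix e w assume "w \<in> elts (W X) (tgt e)"
  then obtain J where J: "w = cls (free_gat X) J" "wf_jud X J" "exps J \<noteq> []" "kind J = tgt e"
    using elts_WE[OF X] by metis
  show "bd (W X) e w \<in> elts (W X) (src e)"
    using cls_in_W[OF X boundary_bd_jud(2,3)[OF X J(2-4)]] bd_W[OF X J(2-4)] boundary_bd_jud(4)[OF X J(2-4)] J(1) by simp
qed

section \<open>Positions and labels\<close>

text \<open>
  If an element of \<open>W X\<close> at \<open>h\<close> selects the positions \<open>js\<close>, then its label is
  an element of \<open>X\<close> at \<open>lab_ob h js\<close>. The boundary of the label is again a label, namely
  of the restriction of the element to \<open>par_ob h js\<close>, which selects \<open>par_sel h js\<close>. For a
  type judgement this restriction is the type of the last selected variable; for a term judgement it is
  the type of the term.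
\<close>

fun lab_ob :: "hob \<Rightarrow> nat list \<Rightarrow> hob" where
  "lab_ob (TyO n) js = TyO (length js)"
| "lab_ob (TmO n) js = TmO (length js)"

fun par_ob :: "hob \<Rightarrow> nat list \<Rightarrow> hob" where
  "par_ob (TyO n) js = TyO (last js)"
| "par_ob (TmO n) js = TyO n"

fun par_sel :: "hob \<Rightarrow> nat list \<Rightarrow> nat list" where
  "par_sel (TyO n) js = butlast js"
| "par_sel (TmO n) js = js"

text \<open>
  The positions to which the head constant of a normal form is applied, and the head constant without
  its number of arguments. The head is always applied to variables, so the value 0 is a default.
\<close>

fun esel :: "(nat, 'u con + 'u con) expr \<Rightarrow> nat list" where
  "esel (App c es) = map (\<lambda>e. case e of Var i \<Rightarrow> i | _ \<Rightarrow> 0) es"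
| "esel (Var i) = []"

fun elab :: "(nat, 'u con + 'u con) expr \<Rightarrow> 'u" where
  "elab (App (Inl p) es) = snd p"
| "elab (App (Inr p) es) = snd p"

lemma esel_app [simp]: "esel (type_app A ys) = ys" "esel (term_app A ys) = ys"
  by (simp_all add: type_app_def term_app_def o_def)

lemma elab_app [simp]: "elab (type_app A ys) = A" "elab (term_app A ys) = A"
  by (simp_all add: type_app_def term_app_def)

definition sel :: "'u psh \<Rightarrow> hob \<Rightarrow> 'u \<Rightarrow> nat list" where
  "sel X h w = esel (last (canon (rep (free_gat X) h w)))"

definition lab :: "'u psh \<Rightarrow> hob \<Rightarrow> 'u \<Rightarrow> 'u" where
  "lab X h w = elab (last (canon (rep (free_gat X) h w)))"

lemma sel_cls:
  fixes X :: "'u::infinite psh"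
  assumes "is_psh X" "wf_jud X J" "exps J \<noteq> []"
  shows "sel X (kind J) (cls (free_gat X) J) = esel (last (canon J))"
    "lab X (kind J) (cls (free_gat X) J) = elab (last (canon J))"
  by (simp_all add: sel_def lab_def canon_rep[OF assms])

lemma last_canon_Typ [simp]: "last (canon (\<Gamma> \<turnstile> Typ T)) = rename (pos (map fst \<Gamma>)) T"
  and last_canon_Trm [simp]: "last (canon (\<Gamma> \<turnstile> Trm t T)) = rename (pos (map fst \<Gamma>)) t"
  by (simp_all add: canon_def)

lemma bd_to_cls:
  fixes X :: "'u::infinite psh"
  assumes X: "is_psh X"
  shows "wf_jud X (\<Gamma> \<turnstile> Typ T) \<Longrightarrow> i < length \<Gamma> \<Longrightarrow>
    bd_to (W X) (length \<Gamma>) i (cls (free_gat X) (\<Gamma> \<turnstile> Typ T)) = cls (free_gat X) (take i \<Gamma> \<turnstile> Typ (snd (\<Gamma> ! i)))"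
proof (induction \<Gamma> arbitrary: T rule: rev_induct)
  case (snoc p \<Gamma>)
  have "bd (W X) (Ext (length \<Gamma>)) (cls (free_gat X) (\<Gamma> @ [p] \<turnstile> Typ T)) = cls (free_gat X) (\<Gamma> \<turnstile> Typ (snd p))"
    using bd_W[OF X snoc.prems(1), of "Ext (length \<Gamma>)"] by simp
  moreover have "wf_jud X (\<Gamma> \<turnstile> Typ (snd p))"
    using boundary_bd_jud(2)[OF X snoc.prems(1), of "Ext (length \<Gamma>)"] by simp
  ultimately show ?case
    using snoc by (cases "i = length \<Gamma>") (auto simp: nth_append)
qed simp

text \<open>
  This is well-formedness of the head expression, read in terms of positions: the last argument of a type
  is a variable whose type is the boundary of the head constant applied to the other arguments.
\<close>

lemma top_W:
  fixes X :: "'u::infinite psh"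
  assumes X: "is_psh X" and w: "w \<in> elts (W X) h"
  defines "js \<equiv> sel X h w"
  shows "lab X h w \<in> elts X (lab_ob h js)"
    and "tgt e = lab_ob h js \<Longrightarrow> below (par_ob h js) h"
    and "tgt e = lab_ob h js \<Longrightarrow> sel X (par_ob h js) (restr (W X) h (par_ob h js) w) = par_sel h js"
    and "tgt e = lab_ob h js \<Longrightarrow> lab X (par_ob h js) (restr (W X) h (par_ob h js) w) = bd X e (lab X h w)"
proof -
  obtain J where J: "w = cls (free_gat X) J" "wf_jud X J" "exps J \<noteq> []" "kind J = h"
    using elts_WE[OF X w] by metis
  note s = sel_cls[OF X J(2,3), unfolded J(4), folded J(1)]
  have "lab X h w \<in> elts X (lab_ob h js) \<and> (tgt e = lab_ob h js \<longrightarrow> below (par_ob h js) h \<and>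
      sel X (par_ob h js) (restr (W X) h (par_ob h js) w) = par_sel h js \<and>
      lab X (par_ob h js) (restr (W X) h (par_ob h js) w) = bd X e (lab X h w))"
  proof (cases J rule: exps.cases)
    case (1 \<Gamma> T)
    have wf: "wf_ctx X \<Gamma>" "wf_type X \<Gamma> T" and h: "h = TyO (length \<Gamma>)" using J 1 by auto
    from wf(2) show ?thesis
    proof (cases rule: wf_type_cases')
      case (1 A)
      then show ?thesis using s by (cases e) (simp_all add: js_def h \<open>J = _\<close>)
    next
      case (2 A ys y)
      have s2: "js = map (pos (map fst \<Gamma>)) ys @ [pos (map fst \<Gamma>) y]" "lab X h w = A"
        using s 2 by (simp_all add: js_def \<open>J = _\<close>)
      obtain i where i: "i < length \<Gamma>" "\<Gamma> ! i = (y, type_app (bd X (Ext (length ys)) A) ys)"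
        using 2(3) by (auto simp: in_set_conv_nth)
      have y: "pos (map fst \<Gamma>) y = i"
        using pos_nth[OF wf_ctx_distinct[OF wf(1)], of i] i by simp
      have r: "restr (W X) h (TyO i) w = cls (free_gat X) (take i \<Gamma> \<turnstile> Typ (type_app (bd X (Ext (length ys)) A) ys))"
        using bd_to_cls[OF X J(2)[unfolded \<open>J = _\<close>] i(1)] by (simp add: h J(1) \<open>J = _\<close> i)
      have wfi: "wf_jud X (take i \<Gamma> \<turnstile> Typ (type_app (bd X (Ext (length ys)) A) ys))"
        using wf_ctx_nth_vars[OF wf(1) i(1)] i by simp
      have ys: "set ys \<subseteq> set (take i (map fst \<Gamma>))" using wf_ctx_nth_vars(3)[OF wf(1) i(1)] i by simp
      have "map (pos (map fst (take i \<Gamma>))) ys = map (pos (map fst \<Gamma>)) ys"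
        using ys pos_take[of _ i "map fst \<Gamma>"] by (auto simp: take_map)
      then have c: "sel X (TyO i) (restr (W X) h (TyO i) w) = map (pos (map fst \<Gamma>)) ys"
        "lab X (TyO i) (restr (W X) h (TyO i) w) = bd X (Ext (length ys)) A"
        using sel_cls[OF X wfi] i(1) by (simp_all add: r)
      have p: "par_ob h js = TyO i" "par_sel h js = map (pos (map fst \<Gamma>)) ys" "lab_ob h js = TyO (Suc (length ys))"
        by (simp_all add: h s2 y)
      have "e = Ext (length ys)" if "tgt e = TyO (Suc (length ys))" using that by (cases e) auto
      then show ?thesis unfolding p s2(2) using c 2(2) i(1) by (auto simp: h)
    qed
  next
    case (2 \<Gamma> t T)
    have wf: "wf_ctx X \<Gamma>" "wf_term X \<Gamma> t T" and h: "h = TmO (length \<Gamma>)" using J 2 by auto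
    obtain a ys where t: "t = term_app a ys" "T = type_app (bd X (Tm (length ys)) a) ys" "a \<in> elts X (TmO (length ys))"
      using wf(2) by (auto simp: wf_term_def)
    have s2: "js = map (pos (map fst \<Gamma>)) ys" "lab X h w = a" using s by (simp_all add: js_def \<open>J = _\<close> t)
    have r: "bd (W X) (Tm (length \<Gamma>)) w = cls (free_gat X) (\<Gamma> \<turnstile> Typ T)"
      using bd_W[OF X J(2,3), of "Tm (length \<Gamma>)"] by (simp add: J(1) \<open>J = _\<close>)
    show ?thesis
      using sel_cls[OF X wf_jud_boundary_term[OF X J(2)[unfolded \<open>J = _\<close>]]] t
      by (cases e) (auto simp: h s2 s2[unfolded h] r)
  qed (use J in auto)
  then show "lab X h w \<in> elts X (lab_ob h js)"
    "tgt e = lab_ob h js \<Longrightarrow> below (par_ob h js) h"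
    "tgt e = lab_ob h js \<Longrightarrow> sel X (par_ob h js) (restr (W X) h (par_ob h js) w) = par_sel h js"
    "tgt e = lab_ob h js \<Longrightarrow> lab X (par_ob h js) (restr (W X) h (par_ob h js) w) = bd X e (lab X h w)" by auto
qed

text \<open>
  The condition of \<open>top_W\<close> for families \<open>s\<close> of positions and \<open>l\<close> of labels that
  are indexed by the elements of \<open>Y\<close>.
\<close>

definition top_data :: "'u psh \<Rightarrow> 'u psh \<Rightarrow> (hob \<Rightarrow> 'u \<Rightarrow> nat list) \<Rightarrow> (hob \<Rightarrow> 'u \<Rightarrow> 'u) \<Rightarrow> bool" where
  "top_data Y Z s l \<longleftrightarrow> (\<forall>h. \<forall>y\<in>elts Y h. l h y \<in> elts Z (lab_ob h (s h y)) \<and>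
     (\<forall>e. tgt e = lab_ob h (s h y) \<longrightarrow> below (par_ob h (s h y)) h \<and>
        s (par_ob h (s h y)) (restr Y h (par_ob h (s h y)) y) = par_sel h (s h y) \<and>
        l (par_ob h (s h y)) (restr Y h (par_ob h (s h y)) y) = bd Z e (l h y)))"

lemma top_dataD:
  assumes "top_data Y Z s l" "y \<in> elts Y h"
  shows "l h y \<in> elts Z (lab_ob h (s h y))"
    "tgt e = lab_ob h (s h y) \<Longrightarrow> below (par_ob h (s h y)) h"
    "tgt e = lab_ob h (s h y) \<Longrightarrow> s (par_ob h (s h y)) (restr Y h (par_ob h (s h y)) y) = par_sel h (s h y)"
    "tgt e = lab_ob h (s h y) \<Longrightarrow> l (par_ob h (s h y)) (restr Y h (par_ob h (s h y)) y) = bd Z e (l h y)"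
  using assms by (auto simp: top_data_def)

lemma top_data_arrow:
  fixes Z :: "'u::infinite psh"
  assumes F: "F \<in> phom Y (W Z)" and Z: "is_psh Z"
  shows "top_data Y Z (\<lambda>h y. sel Z h (ap F h y)) (\<lambda>h y. lab Z h (ap F h y))"
  unfolding top_data_def
proof (intro allI ballI conjI impI)
  fix h y assume y: "y \<in> elts Y h"
  note t = top_W[OF Z ap_in[OF F y]]
  show "lab Z h (ap F h y) \<in> elts Z (lab_ob h (sel Z h (ap F h y)))" by (rule t(1))
  fix e assume e: "tgt e = lab_ob h (sel Z h (ap F h y))"
  show "below (par_ob h (sel Z h (ap F h y))) h" by (rule t(2)[OF e])
  show "sel Z (par_ob h (sel Z h (ap F h y))) (ap F (par_ob h (sel Z h (ap F h y))) (restr Y h (par_ob h (sel Z h (ap F h y))) y)) =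
            par_sel h (sel Z h (ap F h y))"
    using t(3)[OF e] ap_restr[OF F t(2)[OF e] y] by simp
  show "lab Z (par_ob h (sel Z h (ap F h y))) (ap F (par_ob h (sel Z h (ap F h y))) (restr Y h (par_ob h (sel Z h (ap F h y))) y)) =
           bd Z e (lab Z h (ap F h y))"
    using t(4)[OF e] ap_restr[OF F t(2)[OF e] y] by simp
qed

lemma canon_ne: "exps J \<noteq> [] \<Longrightarrow> canon J \<noteq> []"
  by (simp add: canon_def)

text \<open>
  The normal form of a judgement consists of that of its boundary and of one more expression, which is
  given by its positions and its label.
\<close>

lemma W_eqI:
  fixes X :: "'u::infinite psh"
  assumes X: "is_psh X" and w: "w \<in> elts (W X) h" "w' \<in> elts (W X) h"
    and s: "sel X h w = sel X h w'" and l: "lab X h w = lab X h w'"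
    and b: "\<And>e. tgt e = h \<Longrightarrow> bd (W X) e w = bd (W X) e w'"
  shows "w = w'"
proof -
  obtain J where J: "w = cls (free_gat X) J" "wf_jud X J" "exps J \<noteq> []" "kind J = h"
    using elts_WE[OF X w(1)] by metis
  obtain K where K: "w' = cls (free_gat X) K" "wf_jud X K" "exps K \<noteq> []" "kind K = h"
    using elts_WE[OF X w(2)] by metis
  have sl: "esel (last (canon J)) = esel (last (canon K))" "elab (last (canon J)) = elab (last (canon K))"
    using s l sel_cls[OF X J(2,3)] sel_cls[OF X K(2,3)] J K by auto
  have "butlast (canon J) = butlast (canon K)"
  proof (cases "\<exists>e. tgt e = h")
    case True
    then obtain e where e: "tgt e = h" by blast
    have "cls (free_gat X) (bd_jud J) = cls (free_gat X) (bd_jud K)"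
      using b[OF e] bd_W[OF X J(2,3), of e] bd_W[OF X K(2,3), of e] J K e by simp
    then have "canon (bd_jud J) = canon (bd_jud K)"
      using cls_eq_iff[OF X] boundary_bd_jud(2,3)[OF X J(2,3), of e] boundary_bd_jud(2,3)[OF X K(2,3), of e] J K e by simp
    then show ?thesis using boundary_bd_jud(5)[OF X J(2,3), of e] boundary_bd_jud(5)[OF X K(2,3), of e] J K e by simp
  next
    case False
    then have "h = TyO 0" by (metis tgt.simps hob.exhaust not0_implies_Suc)
    then show ?thesis
      using J(3,4) K(3,4) by (cases J rule: exps.cases; cases K rule: exps.cases) (auto simp: canon_def)
  qed
  moreover have "last (canon J) = last (canon K)"
    using sl J K
    by (cases J rule: exps.cases; cases K rule: exps.cases) (auto simp: wf_term_def elim!: wf_type_type_app)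
  ultimately have "canon J = canon K"
    using append_butlast_last_id[OF canon_ne[OF J(3)]] append_butlast_last_id[OF canon_ne[OF K(3)]] by metis
  then show ?thesis using cls_eq_iff[OF X J(2,3) K(2,3)] J K by simp
qed

lemma arrow_eqI:
  fixes Z :: "'u::infinite psh"
  assumes Z: "is_psh Z" and F: "F \<in> phom Y (W Z)" and F': "F' \<in> phom Y (W Z)"
    and s: "\<And>h y. y \<in> elts Y h \<Longrightarrow> sel Z h (ap F h y) = sel Z h (ap F' h y)"
    and l: "\<And>h y. y \<in> elts Y h \<Longrightarrow> lab Z h (ap F h y) = lab Z h (ap F' h y)"
  shows "F = F'"
proof (rule hom_psh_eqI[OF F F'])
  note Y = hom_psh(1)[OF F]
  have step: "ap F h y = ap F' h y" if y: "y \<in> elts Y h"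
    and "\<And>e. tgt e = h \<Longrightarrow> ap F (src e) (bd Y e y) = ap F' (src e) (bd Y e y)" for h y
    by (rule W_eqI[OF Z ap_in[OF F y] ap_in[OF F' y] s[OF y] l[OF y]])
       (use that ap_bd[OF F] ap_bd[OF F'] in force)
  have ty: "ap F (TyO n) y = ap F' (TyO n) y" if "y \<in> elts Y (TyO n)" for n y
    using that
  proof (induction n arbitrary: y)
    case 0
    show ?case by (rule step[OF 0]) (metis hob.distinct(1) hob.inject(1) nat.distinct(1) tgt.elims)
  next
    case (Suc n)
    show ?case
    proof (rule step[OF Suc.prems])
      fix e assume "tgt e = TyO (Suc n)"
      then have "e = Ext n" by (cases e) auto
      then show "ap F (src e) (bd Y e y) = ap F' (src e) (bd Y e y)"
        using Suc.IH[OF bd_Ext_in[OF Y Suc.prems]] by simp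
    qed
  qed
  fix h y assume y: "y \<in> elts Y h"
  show "ap F h y = ap F' h y"
  proof (cases h)
    case (TyO n)
    then show ?thesis using ty y by simp
  next
    case (TmO n)
    show ?thesis
    proof (rule step[OF y])
      fix e assume "tgt e = h"
      then have "e = Tm n" using TmO by (cases e) auto
      then show "ap F (src e) (bd Y e y) = ap F' (src e) (bd Y e y)"
        using ty[OF bd_Tm_in[OF Y]] y TmO by simp
    qed
  qed
qed

text \<open>
  The judgement with prescribed tops, in the variables \<open>0, 1, 2, \<dots>\<close>. The expression at position
  \<open>i\<close> is given by the top of the restriction of \<open>y\<close> to level \<open>i\<close>. With all
  positions selected this is the context of a basic judgement (\<open>free_ctx_eq\<close>).
\<close>

fun top_ctx :: "'u psh \<Rightarrow> (hob \<Rightarrow> 'u \<Rightarrow> nat list) \<Rightarrow> (hob \<Rightarrow> 'u \<Rightarrow> 'u) \<Rightarrow> nat \<Rightarrow> 'u \<Rightarrow> 'u sctx" where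
  "top_ctx Y s l 0 y = []"
| "top_ctx Y s l (Suc n) y = (let z = bd Y (Ext n) y in
     top_ctx Y s l n z @ [(n, type_app (l (TyO n) z) (s (TyO n) z))])"

fun top_jud :: "'u psh \<Rightarrow> (hob \<Rightarrow> 'u \<Rightarrow> nat list) \<Rightarrow> (hob \<Rightarrow> 'u \<Rightarrow> 'u) \<Rightarrow> hob \<Rightarrow> 'u \<Rightarrow> 'u sjud" where
  "top_jud Y s l (TyO n) y = top_ctx Y s l n y \<turnstile> Typ (type_app (l (TyO n) y) (s (TyO n) y))"
| "top_jud Y s l (TmO n) y = (let z = bd Y (Tm n) y in
     top_ctx Y s l n z \<turnstile> Trm (term_app (l (TmO n) y) (s (TmO n) y)) (type_app (l (TyO n) z) (s (TyO n) z)))"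

lemma top_ctx_fst [simp]: "map fst (top_ctx Y s l n y) = [0..<n]"
  by (induction n arbitrary: y) (auto simp: Let_def)

lemma length_top_ctx [simp]: "length (top_ctx Y s l n y) = n"
  by (metis length_map length_upt minus_nat.diff_0 top_ctx_fst)

lemma top_ctx_mem:
  "i < n \<Longrightarrow> (i, type_app (l (TyO i) (bd_to Y n i y)) (s (TyO i) (bd_to Y n i y))) \<in> set (top_ctx Y s l n y)"
  by (induction n arbitrary: y) (auto simp: Let_def less_Suc_eq)

lemma wf_top_ctx:
  assumes Y: "is_psh Y" and d: "top_data Y Z s l"
  shows "y \<in> elts Y (TyO n) \<Longrightarrow> wf_ctx Z (top_ctx Y s l n y) \<and>
     wf_type Z (top_ctx Y s l n y) (type_app (l (TyO n) y) (s (TyO n) y))"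
proof (induction n arbitrary: y)
  have ty: "wf_type Z (top_ctx Y s l n y) (type_app (l (TyO n) y) (s (TyO n) y))" if y: "y \<in> elts Y (TyO n)" for n y
  proof (cases "s (TyO n) y" rule: rev_cases)
    case Nil
    then show ?thesis using top_dataD(1)[OF d y] by (simp add: wf_type.nil)
  next
    case (snoc js j)
    note t = top_dataD(2-4)[OF d y, of "Ext (length js)"]
    have "j < n" "s (TyO j) (bd_to Y n j y) = js" "l (TyO j) (bd_to Y n j y) = bd Z (Ext (length js)) (l (TyO n) y)"
      using t snoc by auto
    with top_ctx_mem[of j n l Y y s] show ?thesis
      unfolding snoc by (intro wf_type.snoc) (use top_dataD(1)[OF d y] snoc in auto)
  qed
  {
    case 0
    then show ?case using ty[OF 0] by (auto intro: wf_ctx.nil)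
  next
    case (Suc n)
    have "fst ` set (top_ctx Y s l n (bd Y (Ext n) y)) = {0..<n}"
      using arg_cong[OF top_ctx_fst[of Y s l n "bd Y (Ext n) y"], of set] by (simp only: set_map set_upt)
    then show ?case using ty[OF Suc.prems] Suc.IH[OF bd_Ext_in[OF Y Suc.prems]]
      by (auto simp: Let_def wf_ctx_snoc_iff)
  }
qed

lemma wf_top_jud:
  assumes Y: "is_psh Y" and d: "top_data Y Z s l" and y: "y \<in> elts Y h"
  shows "wf_jud Z (top_jud Y s l h y)" "exps (top_jud Y s l h y) \<noteq> []" "kind (top_jud Y s l h y) = h"
    "canon (top_jud Y s l h y) = exps (top_jud Y s l h y)"
proof -
  show wf: "wf_jud Z (top_jud Y s l h y)"
  proof (cases h)
    case (TyO n)
    then show ?thesis using wf_top_ctx[OF Y d] y by simp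
  next
    case (TmO n)
    let ?e = "Tm (length (s (TmO n) y))"
    have "s (TyO n) (bd Y (Tm n) y) = s (TmO n) y" "l (TyO n) (bd Y (Tm n) y) = bd Z ?e (l (TmO n) y)"
      "l (TmO n) y \<in> elts Z (TmO (length (s (TmO n) y)))"
      using top_dataD(1)[OF d y] top_dataD(2-4)[OF d y, of ?e] TmO by auto
    then show ?thesis using wf_top_ctx[OF Y d bd_Tm_in[OF Y y[unfolded TmO]]]
      by (simp add: TmO Let_def wf_term_def)
  qed
  show "exps (top_jud Y s l h y) \<noteq> []" "kind (top_jud Y s l h y) = h" by (cases h; simp add: Let_def)+
  obtain n where v: "vars (top_jud Y s l h y) = [0..<n]" by (cases h) (auto simp: Let_def)
  have "rename (pos [0..<n]) E = E" if "E \<in> set (exps (top_jud Y s l h y))" for E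
  proof (rule rename_ident)
    fix i assume "i \<in> evars E"
    then have "i < n" using exps_vars[OF wf that] v by auto
    then show "pos [0..<n] i = i" using pos_nth[of "[0..<n]" i] by simp
  qed
  then show "canon (top_jud Y s l h y) = exps (top_jud Y s l h y)"
    unfolding canon_def v by (intro map_idI)
qed

text \<open>
  The converse of \<open>top_data_arrow\<close>. By \<open>arrow_eqI\<close> there is no other such arrow.
\<close>

lemma ex_arrow:
  fixes Z :: "'u::infinite psh"
  assumes Y: "is_psh Y" and Z: "is_psh Z" and d: "top_data Y Z s l"
  defines "F \<equiv> mk_arr Y (W Z) (\<lambda>h y. cls (free_gat Z) (top_jud Y s l h y))"
  shows "F \<in> phom Y (W Z)"
    "y \<in> elts Y h \<Longrightarrow> sel Z h (ap F h y) = s h y" "y \<in> elts Y h \<Longrightarrow> lab Z h (ap F h y) = l h y"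
proof -
  note tj = wf_top_jud[OF Y d]
  show "F \<in> phom Y (W Z)"
    unfolding F_def
  proof (rule mk_arr_hom[OF Y is_psh_W[OF Z]])
    fix h y assume "y \<in> elts Y h"
    then show "cls (free_gat Z) (top_jud Y s l h y) \<in> elts (W Z) h" using cls_in_W[OF Z] tj by metis
  next
    fix e y assume y: "y \<in> elts Y (tgt e)"
    have "bd_jud (top_jud Y s l (tgt e) y) = top_jud Y s l (src e) (bd Y e y)"
      by (cases e) (auto simp: Let_def)
    then show "cls (free_gat Z) (top_jud Y s l (src e) (bd Y e y)) = bd (W Z) e (cls (free_gat Z) (top_jud Y s l (tgt e) y))"
      using bd_W[OF Z tj(1-3)[OF y]] by simp
  qed
  assume y: "y \<in> elts Y h"
  have "esel (last (exps (top_jud Y s l h y))) = s h y" "elab (last (exps (top_jud Y s l h y))) = l h y"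
    by (cases h; simp add: Let_def)+
  then show "sel Z h (ap F h y) = s h y" "lab Z h (ap F h y) = l h y"
    using sel_cls[OF Z tj(1,2)[OF y]] tj(3,4)[OF y] y by (simp_all add: F_def ap_mk_arr)
qed

fun lev :: "hob \<Rightarrow> nat" where
  "lev (TyO n) = n" | "lev (TmO n) = n"

lemma top_data_unit: "is_psh X \<Longrightarrow> top_data X X (\<lambda>h x. [0..<lev h]) (\<lambda>h x. x)"
  unfolding top_data_def
proof (intro allI ballI)
  fix h x assume "x \<in> elts X h"
  show "x \<in> elts X (lab_ob h [0..<lev h]) \<and> (\<forall>e. tgt e = lab_ob h [0..<lev h] \<longrightarrow> below (par_ob h [0..<lev h]) h \<and>
     [0..<lev (par_ob h [0..<lev h])] = par_sel h [0..<lev h] \<and> restr X h (par_ob h [0..<lev h]) x = bd X e x)"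
  proof (cases h)
    case (TyO n)
    have "below (TyO (last [0..<n])) (TyO n) \<and> [0..<last [0..<n]] = butlast [0..<n] \<and> bd_to X n (last [0..<n]) x = bd X e x"
      if "tgt e = TyO n" for e
      using that by (cases e) auto
    then show ?thesis using \<open>x \<in> _\<close> TyO by auto
  next
    case (TmO n)
    have "bd X (Tm n) x = bd X e x" if "tgt e = TmO n" for e using that by (cases e) auto
    then show ?thesis using \<open>x \<in> _\<close> TmO by auto
  qed
qed

lemma free_ctx_eq: "free_ctx X k A = top_ctx X (\<lambda>h x. [0..<lev h]) (\<lambda>h x. x) k A"
  by (induction k arbitrary: A) (auto simp: Let_def gen_app_eq)

lemma gen_jud_eq: "gen_jud X h x = top_jud X (\<lambda>h x. [0..<lev h]) (\<lambda>h x. x) h x"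
  by (cases h) (auto simp: Let_def gen_app_eq free_ctx_eq)

lemma gat_unit_eq: "gat_unit X = mk_arr X (W X) (\<lambda>h x. cls (free_gat X) (gen_jud X h x))"
  by (simp add: gat_unit_def mk_arr_def)

lemma unit_top:
  fixes X :: "'u::infinite psh"
  assumes X: "is_psh X"
  shows "gat_unit X \<in> phom X (W X)"
    "x \<in> elts X h \<Longrightarrow> sel X h (ap (gat_unit X) h x) = [0..<lev h]"
    "x \<in> elts X h \<Longrightarrow> lab X h (ap (gat_unit X) h x) = x"
  using ex_arrow[OF X X top_data_unit[OF X]] by (simp_all only: gat_unit_eq gen_jud_eq)

section \<open>Interpretations between free theories\<close>

text \<open>
  Let \<open>s\<close> and \<open>l\<close> be the positions and labels of an arrow \<open>F : X \<rightarrow> W Y\<close>. The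
  translation replaces a constant by the head of its value under \<open>F\<close>, applied to the arguments at
  the positions that this value selects.
\<close>

fun tr_expr :: "(hob \<Rightarrow> 'u \<Rightarrow> nat list) \<Rightarrow> (hob \<Rightarrow> 'u \<Rightarrow> 'u) \<Rightarrow> 'u sexpr \<Rightarrow> 'u sexpr" where
  "tr_expr s l (App (Inl (k, A)) es) =
     App (Inl (length (s (TyO k) A), l (TyO k) A)) (map ((!) es) (s (TyO k) A))"
| "tr_expr s l (App (Inr (k, a)) es) =
     App (Inr (length (s (TmO k) a), l (TmO k) a)) (map ((!) es) (s (TmO k) a))"
| "tr_expr s l (Var x) = Var x"

definition tr_ctx :: "(hob \<Rightarrow> 'u \<Rightarrow> nat list) \<Rightarrow> (hob \<Rightarrow> 'u \<Rightarrow> 'u) \<Rightarrow> 'u sctx \<Rightarrow> 'u sctx" where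
  "tr_ctx s l \<Gamma> = map (\<lambda>p. (fst p, tr_expr s l (snd p))) \<Gamma>"

fun tr_jud :: "(hob \<Rightarrow> 'u \<Rightarrow> nat list) \<Rightarrow> (hob \<Rightarrow> 'u \<Rightarrow> 'u) \<Rightarrow> 'u sjud \<Rightarrow> 'u sjud" where
  "tr_jud s l (\<Gamma> \<turnstile> Typ T) = tr_ctx s l \<Gamma> \<turnstile> Typ (tr_expr s l T)"
| "tr_jud s l (\<Gamma> \<turnstile> Trm t T) = tr_ctx s l \<Gamma> \<turnstile> Trm (tr_expr s l t) (tr_expr s l T)"
| "tr_jud s l (\<Gamma> \<turnstile> TypEq T T') = tr_ctx s l \<Gamma> \<turnstile> TypEq (tr_expr s l T) (tr_expr s l T')"
| "tr_jud s l (\<Gamma> \<turnstile> TrmEq t t' T) = tr_ctx s l \<Gamma> \<turnstile> TrmEq (tr_expr s l t) (tr_expr s l t') (tr_expr s l T)"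

lemma tr_ctx_simps [simp]: "tr_ctx s l [] = []" "tr_ctx s l (p # \<Gamma>) = (fst p, tr_expr s l (snd p)) # tr_ctx s l \<Gamma>"
  "tr_ctx s l (\<Gamma> @ \<Delta>) = tr_ctx s l \<Gamma> @ tr_ctx s l \<Delta>" "map fst (tr_ctx s l \<Gamma>) = map fst \<Gamma>"
  "map snd (tr_ctx s l \<Gamma>) = map (tr_expr s l) (map snd \<Gamma>)" "length (tr_ctx s l \<Gamma>) = length \<Gamma>"
  by (simp_all add: tr_ctx_def)

lemma fst_set_tr_ctx [simp]: "fst ` set (tr_ctx s l \<Gamma>) = fst ` set \<Gamma>"
  using arg_cong[OF tr_ctx_simps(4), of set] by (simp only: set_map)

lemma mem_tr_ctx: "(x, T) \<in> set \<Gamma> \<Longrightarrow> (x, tr_expr s l T) \<in> set (tr_ctx s l \<Gamma>)"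
  by (force simp: tr_ctx_def)

text \<open>
  The positions selected by an element with a context of length \<open>n\<close> are less than \<open>n\<close>: the
  last one by assumption, the others because they are selected at that last position.
\<close>

lemma sel_less:
  assumes X: "is_psh X" and d: "top_data X Y s l"
  shows "x \<in> elts X h \<Longrightarrow> j \<in> set (s h x) \<Longrightarrow> j < lev h"
proof -
  have ty: "x \<in> elts X (TyO n) \<Longrightarrow> j \<in> set (s (TyO n) x) \<Longrightarrow> j < n" for n x j
  proof (induction n arbitrary: x j rule: less_induct)
    case (less n)
    show ?case
    proof (cases "s (TyO n) x" rule: rev_cases)
      case (snoc js i)
      then have i: "i < n" "s (TyO i) (bd_to X n i x) = js"
        using top_dataD(2,3)[OF d less.prems(1), of "Ext (length js)"] by auto
      then show ?thesis
        using less.IH[OF i(1) bd_to_in[OF X less_imp_le[OF i(1)] less.prems(1)], of j] less.prems snoc by auto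
    qed (use less in simp)
  qed
  assume x: "x \<in> elts X h" "j \<in> set (s h x)"
  show "j < lev h"
  proof (cases h)
    case (TmO n)
    have "s (TyO n) (bd X (Tm n) x) = s (TmO n) x"
      using top_dataD(3)[OF d x(1), of "Tm (length (s (TmO n) x))"] TmO by simp
    then show ?thesis using ty[OF bd_Tm_in[OF X]] x TmO by simp
  qed (use ty x in simp)
qed

lemma tr_expr_type_app:
  assumes "is_psh X" "top_data X Y s l" "A \<in> elts X (TyO (length ys))"
  shows "tr_expr s l (type_app A ys) = type_app (l (TyO (length ys)) A) (map ((!) ys) (s (TyO (length ys)) A))"
  using sel_less[OF assms] by (auto simp: type_app_def)

lemma tr_expr_term_app:
  assumes "is_psh X" "top_data X Y s l" "a \<in> elts X (TmO (length ys))"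
  shows "tr_expr s l (term_app a ys) = term_app (l (TmO (length ys)) a) (map ((!) ys) (s (TmO (length ys)) a))"
  using sel_less[OF assms] by (auto simp: term_app_def)

text \<open>
  The expressions that occur in derived judgements. Translation commutes with renaming on them, whereas
  on other expressions a position can exceed the number of arguments.
\<close>

definition atomic :: "'u psh \<Rightarrow> 'u sexpr \<Rightarrow> bool" where
  "atomic X E \<longleftrightarrow> (\<exists>A ys. E = type_app A ys \<and> A \<in> elts X (TyO (length ys))) \<or>
     (\<exists>a ys. E = term_app a ys \<and> a \<in> elts X (TmO (length ys)))"

lemma atomic_type: "wf_type X \<Gamma> T \<Longrightarrow> atomic X T"
  by (auto simp: atomic_def elim!: wf_type_type_app)

lemma atomic_term: "wf_term X \<Gamma> t T \<Longrightarrow> atomic X t" "wf_term X \<Gamma> t T \<Longrightarrow> atomic X T"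
  by (auto simp: atomic_def[of X t] wf_term_def intro: atomic_type)

lemma atomic_ctx: "wf_ctx X \<Gamma> \<Longrightarrow> p \<in> set \<Gamma> \<Longrightarrow> atomic X (snd p)"
  using wf_ctx_type[of X \<Gamma> "fst p" "snd p"] atomic_type by auto

lemma atomic_exps: "wf_jud X J \<Longrightarrow> E \<in> set (exps J) \<Longrightarrow> atomic X E"
  by (cases J rule: exps.cases) (auto intro: atomic_type atomic_term atomic_ctx)

context
  fixes X Y :: "'u::infinite psh" and s l
  assumes X: "is_psh X" and Y: "is_psh Y" and d: "top_data X Y s l"
begin

lemma tr_expr_rename: "atomic X E \<Longrightarrow> tr_expr s l (rename \<sigma> E) = rename \<sigma> (tr_expr s l E)"
  using sel_less[OF X d, where h = "TyO _"] sel_less[OF X d, where h = "TmO _"] unfolding atomic_def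
  by (auto simp: tr_expr_type_app[OF X d] tr_expr_term_app[OF X d])

lemma evars_tr_expr: "atomic X E \<Longrightarrow> evars (tr_expr s l E) \<subseteq> evars E"
  using sel_less[OF X d, where h = "TyO _"] sel_less[OF X d, where h = "TmO _"] unfolding atomic_def
  by (auto simp: tr_expr_type_app[OF X d] tr_expr_term_app[OF X d])

text \<open>
  If the value of \<open>A\<close> selects \<open>j\<close> last, then the translated type has last argument
  \<open>ys ! j\<close>. By \<open>wf_type_chain\<close> the type of this variable is an iterated boundary of
  \<open>A\<close>, whose translation is the required type because \<open>F\<close> commutes with boundaries.
\<close>

lemma wf_type_tr:
  assumes \<Gamma>: "wf_ctx X \<Gamma>" and T: "wf_type X \<Gamma> T" shows "wf_type Y (tr_ctx s l \<Gamma>) (tr_expr s l T)"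
proof -
  obtain A ys where T': "T = type_app A ys" and A: "A \<in> elts X (TyO (length ys))" using wf_type_type_app[OF T] by metis
  let ?k = "length ys"
  show ?thesis
  proof (cases "s (TyO ?k) A" rule: rev_cases)
    case Nil
    then show ?thesis using top_dataD(1)[OF d A] by (simp add: T' tr_expr_type_app[OF X d A] wf_type.nil)
  next
    case (snoc js j)
    note t = top_dataD(2-4)[OF d A, of "Ext (length js)"]
    have j: "j < ?k" "s (TyO j) (bd_to X ?k j A) = js" "l (TyO j) (bd_to X ?k j A) = bd Y (Ext (length js)) (l (TyO ?k) A)"
      using t snoc by auto
    have Aj: "bd_to X ?k j A \<in> elts X (TyO j)" using bd_to_in[OF X _ A] j by simp
    have "(ys ! j, tr_expr s l (type_app (bd_to X ?k j A) (take j ys))) \<in> set (tr_ctx s l \<Gamma>)"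
      by (rule mem_tr_ctx[OF wf_type_chain[OF \<Gamma> T[unfolded T'] j(1)]])
    moreover have "tr_expr s l (type_app (bd_to X ?k j A) (take j ys)) = type_app (bd Y (Ext (length js)) (l (TyO ?k) A)) (map ((!) ys) js)"
      using tr_expr_type_app[OF X d, of "bd_to X ?k j A" "take j ys"] Aj j sel_less[OF X d Aj] by simp
    ultimately show ?thesis
      using wf_type.snoc[of "l (TyO ?k) A" Y "map ((!) ys) js" "ys ! j" "tr_ctx s l \<Gamma>"] top_dataD(1)[OF d A]
      by (simp add: T' tr_expr_type_app[OF X d A] snoc)
  qed
qed

lemma wf_term_tr:
  assumes \<Gamma>: "wf_ctx X \<Gamma>" and t: "wf_term X \<Gamma> t T" shows "wf_term Y (tr_ctx s l \<Gamma>) (tr_expr s l t) (tr_expr s l T)"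
proof -
  obtain a ys where a: "t = term_app a ys" "T = type_app (bd X (Tm (length ys)) a) ys" "a \<in> elts X (TmO (length ys))"
    and T: "wf_type X \<Gamma> T" using t by (auto simp: wf_term_def)
  let ?k = "length ys" and ?js = "s (TmO (length ys)) a"
  have "s (TyO ?k) (bd X (Tm ?k) a) = ?js" "l (TyO ?k) (bd X (Tm ?k) a) = bd Y (Tm (length ?js)) (l (TmO ?k) a)"
    using top_dataD(3,4)[OF d a(3), of "Tm (length ?js)"] by auto
  then show ?thesis
    using wf_type_tr[OF \<Gamma> T] top_dataD(1)[OF d a(3)]
    by (auto simp: wf_term_def a tr_expr_term_app[OF X d a(3)] tr_expr_type_app[OF X d bd_Tm_in[OF X a(3)]])
qed

lemma wf_ctx_tr: "wf_ctx X \<Gamma> \<Longrightarrow> wf_ctx Y (tr_ctx s l \<Gamma>)"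
proof (induction rule: wf_ctx.induct)
  case (snoc \<Gamma> T x)
  then show ?case using wf_type_tr by (simp add: wf_ctx_snoc_iff)
qed (simp add: wf_ctx.nil)

lemma wf_jud_tr: "wf_jud X J \<Longrightarrow> wf_jud Y (tr_jud s l J)"
  by (cases "(X, J)" rule: wf_jud.cases) (auto simp: wf_ctx_tr wf_type_tr wf_term_tr)

lemma exps_tr [simp]: "exps (tr_jud s l J) = map (tr_expr s l) (exps J)" "vars (tr_jud s l J) = vars J" "kind (tr_jud s l J) = kind J"
  by (cases J rule: boundary.cases; simp)+

lemma canon_tr: "wf_jud X J \<Longrightarrow> canon (tr_jud s l J) = map (tr_expr s l) (canon J)"
  by (auto simp: canon_def tr_expr_rename atomic_exps)

lemma tr_ctx_map: "wf_ctx X \<Gamma> \<Longrightarrow> tr_ctx s l (map_ctx \<sigma> \<Gamma>) = map_ctx \<sigma> (tr_ctx s l \<Gamma>)"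
  using tr_expr_rename[of _ \<sigma>, unfolded rename_def] atomic_ctx[of X \<Gamma>] by (auto simp: tr_ctx_def)

lemma tr_jud_map: "wf_jud X J \<Longrightarrow> tr_jud s l (map_jud \<sigma> id J) = map_jud \<sigma> id (tr_jud s l J)"
  using tr_expr_rename[of _ \<sigma>, unfolded rename_def] tr_ctx_map[of _ \<sigma>]
  by (cases J rule: boundary.cases) (auto simp: atomic_type atomic_term)

lemma boundary_tr: "boundary (tr_jud s l J) = map (tr_jud s l) (boundary J)"
proof (cases J rule: boundary.cases)
  case (1 \<Gamma> T)
  then show ?thesis by (cases \<Gamma> rule: rev_cases) auto
qed auto

lemma cvars_tr_ctx: "wf_ctx X (\<Gamma> @ \<Delta>) \<Longrightarrow> cvars (tr_ctx s l \<Gamma>) \<subseteq> cvars \<Gamma> \<and> cvars (tr_ctx s l \<Delta>) \<subseteq> cvars \<Delta>"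
proof
  assume wf: "wf_ctx X (\<Gamma> @ \<Delta>)"
  have "cvars (tr_ctx s l \<Xi>) \<subseteq> cvars \<Xi>" if "set \<Xi> \<subseteq> set (\<Gamma> @ \<Delta>)" for \<Xi>
  proof
    fix v assume "v \<in> cvars (tr_ctx s l \<Xi>)"
    then obtain p where p: "p \<in> set \<Xi>" "v = fst p \<or> v \<in> evars (tr_expr s l (snd p))"
      by (auto simp: cvars_def tr_ctx_def)
    then have "v = fst p \<or> v \<in> evars (snd p)" using evars_tr_expr[OF atomic_ctx[OF wf, of p]] that by auto
    then show "v \<in> cvars \<Xi>"
      unfolding cvars_def by (intro UN_I[OF p(1)]) (auto split: prod.split)
  qed
  from this[of \<Gamma>] this[of \<Delta>]
  show "cvars (tr_ctx s l \<Gamma>) \<subseteq> cvars \<Gamma>" "cvars (tr_ctx s l \<Delta>) \<subseteq> cvars \<Delta>" by auto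
qed

text \<open>
  This is stronger than the preservation of deduction: if a rule applies before the translation then it
  also applies afterwards. For weakening the point is that translation introduces no variables, so that
  freshness is preserved.
\<close>

lemma rule_app_tr:
  assumes r: "rule_app r Js J" and wf: "\<And>K. K \<in> set Js \<Longrightarrow> wf_jud X K"
  shows "rule_app r (map (tr_jud s l) Js) (tr_jud s l J)"
  using r
proof (cases rule: rule_app.cases)
  case (9 \<sigma> K)
  then show ?thesis using tr_jud_map[of K \<sigma>] wf rule_app.intros(9)[of \<sigma> "tr_jud s l K"] by simp
next
  case (10 y \<Gamma> \<Delta> T R)
  have "wf_ctx X (\<Gamma> @ \<Delta>)" using wf[of "\<Gamma> @ \<Delta> \<turnstile> R"] 10 by (cases R) auto
  then have y: "y \<notin> cvars (tr_ctx s l \<Gamma>) \<union> cvars (tr_ctx s l \<Delta>)" using cvars_tr_ctx 10 by blast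
  show ?thesis unfolding 10 using rule_app.intros(10)[OF y] by (cases R) simp_all
qed (simp_all add: rule_app.intros)

end

lemma rule_app_functional: "rule_app r Js J \<Longrightarrow> rule_app r Js K \<Longrightarrow> J = K"
  by (erule rule_app.cases; erule rule_app.cases; simp)

context
  fixes X Y :: "'u::infinite psh" and s l
  assumes X: "is_psh X" and Y: "is_psh Y" and d: "top_data X Y s l"
begin

lemma is_interp_tr: "is_interp (free_gat X) (free_gat Y) (tr_jud s l)"
  unfolding is_interp_def
proof (intro conjI ballI allI impI funcsetI)
  fix J assume "J \<in> derived (free_gat X)"
  then show "tr_jud s l J \<in> derived (free_gat Y)"
    using wf_jud_tr[OF X Y d] derived_free_gat[OF X] derived_free_gat[OF Y] by simp
  show "boundary (tr_jud s l J) = map (tr_jud s l) (boundary J)" by (rule boundary_tr[OF X Y d])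
next
  fix r Js J K assume "set Js \<subseteq> derived (free_gat X) \<and> rule_app r Js J \<and> rule_app r (map (tr_jud s l) Js) K"
  then show "tr_jud s l J = K"
    using rule_app_functional rule_app_tr[OF X Y d, of r Js J] derived_free_gat[OF X] by blast
qed

text \<open>
  Since rules remain applicable after the translation, an interpretation that agrees with the
  translation on the premises of a rule has to agree with it on the conclusion.
\<close>

lemma interp_unique:
  assumes i: "is_interp (free_gat X) (free_gat Y) \<phi>"
    and g: "\<And>h x. x \<in> elts X h \<Longrightarrow> \<phi> (gen_jud X h x) = tr_jud s l (gen_jud X h x)"
    and J: "J \<in> derived (free_gat X)"
  shows "\<phi> J = tr_jud s l J"
  using J
proof (induction rule: derived.induct)
  case (basic J)
  then show ?case using g by (auto simp: free_gat_def)
next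
  case (rule r Js J)
  then have eq: "map \<phi> Js = map (tr_jud s l) Js" and sub: "set Js \<subseteq> derived (free_gat X)" by auto
  have "rule_app r (map \<phi> Js) (tr_jud s l J)"
    unfolding eq using rule_app_tr[OF X Y d rule(1)] sub derived_free_gat[OF X] by blast
  with i rule(1) sub show ?case unfolding is_interp_def by blast
qed

end

lemma finite_evars: "finite (evars E)"
  by (induction E) auto

lemma jvars_eq: "jvars (\<Gamma> \<turnstile> R) = cvars \<Gamma> \<union> rvars R"
  by (force simp: cvars_def elim!: fsts.cases snds.cases intro: fsts.intros snds.intros)

lemma finite_jvars: "finite (jvars J)"
proof (cases J)
  case (Jud \<Gamma> R)
  have "finite (rvars R)" by (cases R) (auto simp: finite_evars)
  then show ?thesis unfolding Jud jvars_eq by (auto simp: finite_evars cvars_def)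
qed

lemma interp_perm:
  assumes i: "is_interp T U \<phi>" and "J \<in> derived T" "bij \<sigma>"
  shows "\<phi> (map_jud \<sigma> id J) = map_jud \<sigma> id (\<phi> J)"
proof -
  have "set [J] \<subseteq> derived T" "rule_app (Perm \<sigma>) [J] (map_jud \<sigma> id J)"
      "rule_app (Perm \<sigma>) (map \<phi> [J]) (map_jud \<sigma> id (\<phi> J))"
    unfolding list.map by (simp add: assms(2), (rule rule_app.intros(9)[OF assms(3)])+)
  with i show ?thesis unfolding is_interp_def by blast
qed

text \<open>
  Otherwise exchange a variable \<open>z\<close> of \<open>\<phi> J\<close> that is not in \<open>J\<close> with a fresh
  one. This fixes \<open>J\<close> but not \<open>\<phi> J\<close>, although \<open>\<phi>\<close> commutes with
  permutations.
\<close>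

lemma interp_vars:
  assumes i: "is_interp T U \<phi>" and J: "J \<in> derived T"
  shows "jvars (\<phi> J) \<subseteq> jvars J"
proof
  fix z assume z: "z \<in> jvars (\<phi> J)"
  show "z \<in> jvars J"
  proof (rule ccontr)
    assume nz: "z \<notin> jvars J"
    obtain w where w: "w \<notin> jvars J \<union> jvars (\<phi> J)"
      using ex_new_if_finite[OF infinite_UNIV_nat, of "jvars J \<union> jvars (\<phi> J)"] finite_jvars by blast
    define \<sigma> where "\<sigma> = id(z := w, w := z)"
    have "\<sigma> (\<sigma> v) = v" for v by (simp add: \<sigma>_def)
    then have "bij \<sigma>" by (intro o_bij[of \<sigma>]) (auto simp: fun_eq_iff)
    have "map_jud \<sigma> id J = map_jud id id J"
      by (rule jud.map_cong0) (use nz w in \<open>auto simp: \<sigma>_def\<close>)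
    then have "map_jud \<sigma> id (\<phi> J) = \<phi> J"
      using interp_perm[OF i J \<open>bij \<sigma>\<close>] by (simp add: jud.map_id)
    then have "\<sigma> ` jvars (\<phi> J) = jvars (\<phi> J)" by (metis jud.set_map(1))
    moreover have "w \<in> \<sigma> ` jvars (\<phi> J)" using z by (auto simp: \<sigma>_def intro: rev_image_eqI)
    ultimately show False using w by auto
  qed
qed

lemma jvars_subset: "wf_jud X J \<Longrightarrow> exps J \<noteq> [] \<Longrightarrow> jvars J \<subseteq> set (vars J)"
proof (cases J rule: exps.cases)
  case (1 \<Gamma> T)
  assume "wf_jud X J"
  then show ?thesis using wf_type_vars[of X \<Gamma> T] by (auto simp: 1 jvars_eq wf_ctx_vars simp del: jud.set)
next
  case (2 \<Gamma> t T)
  assume "wf_jud X J"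
  then show ?thesis using wf_term_vars[of X \<Gamma> t T] by (auto simp: 2 jvars_eq wf_ctx_vars simp del: jud.set)
qed auto

lemma jud_eqI:
  assumes J: "wf_jud X J" "exps J \<noteq> []" and K: "wf_jud X K" "exps K \<noteq> []"
    and v: "vars J = vars K" and c: "canon J = canon K"
  shows "J = K"
proof -
  have e: "exps L = map (rename ((!) (vars L))) (canon L)" if "wf_jud X L" for L
    using exps_vars[OF that] nth_pos[of _ "vars L"]
    by (auto simp: canon_def rename_rename subset_iff intro!: map_idI[symmetric] rename_ident)
  have "exps J = exps K" using e[OF J(1)] e[OF K(1)] v c by simp
  then show ?thesis
    using v kind_eq_if_canon_eq[OF J K c] J(2) K(2)
    by (cases J rule: exps.cases; cases K rule: exps.cases) (auto intro: pair_list_eqI)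
qed

lemma canon_map:
  assumes "inj \<sigma>" "wf_jud X J" shows "canon (map_jud \<sigma> id J) = canon J"
proof -
  have v: "vars (map_jud \<sigma> id J) = map \<sigma> (vars J)" by (cases J) simp
  have e: "exps (map_jud \<sigma> id J) = map (rename \<sigma>) (exps J)"
    by (cases J rule: exps.cases) (auto simp: rename_def)
  have "pos (map \<sigma> xs) (\<sigma> v) = pos xs v" for xs v using assms(1) by (induction xs) (auto simp: inj_eq)
  then show ?thesis by (simp add: canon_def v e rename_rename)
qed

text \<open>
  Judgements with the same normal form are related by a permutation, so they are treated alike by every
  interpretation.
\<close>

lemma renaming_if_canon_eq:
  assumes "wf_jud X J" "exps J \<noteq> []" "wf_jud X K" "exps K \<noteq> []" "canon J = canon K"
  obtains \<sigma> where "bij \<sigma>" "K = map_jud \<sigma> id J"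
proof -
  have "length (vars J) = length (vars K)"
    using kind_eq_if_canon_eq[OF assms] assms by (cases J rule: exps.cases; cases K rule: exps.cases) auto
  then obtain \<sigma> where \<sigma>: "bij \<sigma>" "map \<sigma> (vars J) = vars K"
    using ex_bij_map wf_jud_distinct assms by blast
  have "vars (map_jud \<sigma> id J) = vars K" using \<sigma>(2) by (cases J) simp
  moreover have "exps (map_jud \<sigma> id J) \<noteq> []" using assms(2) by (cases J rule: exps.cases) auto
  moreover have "inj \<sigma>" using \<sigma>(1) by (rule bij_is_inj)
  ultimately have "K = map_jud \<sigma> id J"
    using jud_eqI[OF assms(3,4) wf_jud_map[OF assms(1)]] canon_map[OF _ assms(1)] assms(5) by metis
  then show ?thesis using that \<sigma>(1) by blast
qed

context
  fixes X Y :: "'u::infinite psh" and s l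
  assumes X: "is_psh X" and Y: "is_psh Y" and d: "top_data X Y s l"
begin

lemma gen_jud_facts:
  assumes "x \<in> elts X h"
  shows "wf_jud X (gen_jud X h x)" "exps (gen_jud X h x) \<noteq> []" "kind (gen_jud X h x) = h"
    "vars (gen_jud X h x) = [0..<lev h]"
  using wf_top_jud[OF X top_data_unit[OF X] assms] by (auto simp: gen_jud_eq) (cases h; simp add: Let_def)

text \<open>
  The boundary of an equality judgement has two entries, that of a type or term judgement at most one.
  So an interpretation, which preserves boundaries, cannot turn the latter into an equality.
\<close>

lemma interp_wf:
  assumes i: "is_interp (free_gat X) (free_gat Y) \<phi>" and J: "wf_jud X J" "exps J \<noteq> []"
  shows "wf_jud Y (\<phi> J)" "exps (\<phi> J) \<noteq> []"
proof -
  have D: "J \<in> derived (free_gat X)" using J derived_free_gat[OF X] by simp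
  then have "\<phi> J \<in> derived (free_gat Y)" using i unfolding is_interp_def by auto
  then show "wf_jud Y (\<phi> J)" using derived_free_gat[OF Y] by simp
  have b: "boundary (\<phi> J) = map \<phi> (boundary J)" using i D unfolding is_interp_def by auto
  have "length (boundary J) \<le> 1" using J(2) by (cases J rule: exps.cases) auto
  then have "length (boundary (\<phi> J)) \<le> 1" by (simp add: b)
  then show "exps (\<phi> J) \<noteq> []" by (cases "\<phi> J" rule: exps.cases) auto
qed

text \<open>
  Agreement up to renaming becomes equality once the variables are known. By induction along the boundary
  the context of the value has variables \<open>0, \<dots>, n - 1\<close>, and then one more; this one is
  \<open>n\<close>, as no other variable is available by \<open>interp_vars\<close> and variables are distinct.
\<close>

lemma interp_on_generators:
  assumes i: "is_interp (free_gat X) (free_gat Y) \<phi>"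
    and c: "\<And>h x. x \<in> elts X h \<Longrightarrow> canon (\<phi> (gen_jud X h x)) = canon (tr_jud s l (gen_jud X h x))"
    and x: "x \<in> elts X h"
  shows "\<phi> (gen_jud X h x) = tr_jud s l (gen_jud X h x)"
proof -
  have k: "kind (\<phi> (gen_jud X h x)) = h" if x: "x \<in> elts X h" for h x
  proof -
    note g = gen_jud_facts[OF x]
    have "exps (tr_jud s l (gen_jud X h x)) \<noteq> []" using g by (simp add: exps_tr[OF X Y d])
    then show ?thesis using kind_eq_if_canon_eq[OF interp_wf[OF i g(1,2)] wf_jud_tr[OF X Y d g(1)] _ c[OF x]]
       g exps_tr(3)[OF X Y d] by simp
  qed
  have b: "boundary (\<phi> (gen_jud X h x)) = map \<phi> (boundary (gen_jud X h x))" if x: "x \<in> elts X h" for h x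
    using i gen_jud_derived[OF X x] unfolding is_interp_def by auto
  have ty: "vars (\<phi> (gen_jud X (TyO n) A)) = [0..<n]" if "A \<in> elts X (TyO n)" for n A
    using that
  proof (induction n arbitrary: A)
    case 0
    show ?case using k[OF 0] interp_wf(2)[OF i gen_jud_facts(1,2)[OF 0]]
      by (cases "\<phi> (gen_jud X (TyO 0) A)" rule: exps.cases) (auto simp del: gen_jud.simps)
  next
    case (Suc n)
    let ?J = "gen_jud X (TyO (Suc n)) A"
    note g = gen_jud_facts[OF Suc.prems] and w = interp_wf[OF i gen_jud_facts(1,2)[OF Suc.prems]]
    obtain \<Gamma> T where J: "\<phi> ?J = \<Gamma> \<turnstile> Typ T" "length \<Gamma> = Suc n"
      using k[OF Suc.prems] w(2) by (cases "\<phi> ?J" rule: exps.cases) (auto simp del: gen_jud.simps)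
    then obtain \<Delta> z S where \<Gamma>: "\<Gamma> = \<Delta> @ [(z, S)]" by (cases \<Gamma> rule: rev_cases) auto
    have "boundary ?J = [gen_jud X (TyO n) (bd X (Ext n) A)]" by (simp add: Let_def)
    then have "\<phi> (gen_jud X (TyO n) (bd X (Ext n) A)) = \<Delta> \<turnstile> Typ S"
      using b[OF Suc.prems] J \<Gamma> by (simp del: gen_jud.simps)
    then have \<Delta>: "map fst \<Delta> = [0..<n]" using Suc.IH[OF bd_Ext_in[OF X Suc.prems]] by simp
    have "z \<in> jvars (\<phi> ?J)" unfolding J jvars_eq by (simp add: \<Gamma> cvars_def)
    then have "z \<in> {0..<Suc n}"
      using interp_vars[OF i gen_jud_derived[OF X Suc.prems]] jvars_subset[OF g(1,2)] g(4)
      by (auto simp del: gen_jud.simps)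
    moreover have "z \<notin> set [0..<n]"
      using wf_jud_distinct[OF w(1)] by (simp add: J \<Gamma> \<Delta>[symmetric] del: gen_jud.simps)
    ultimately have "z = n" by auto
    then show ?case by (simp add: J \<Gamma> \<Delta> del: gen_jud.simps)
  qed
  have v: "vars (\<phi> (gen_jud X h x)) = [0..<lev h]"
  proof (cases h)
    case (TmO n)
    obtain \<Gamma> t T where J: "\<phi> (gen_jud X h x) = \<Gamma> \<turnstile> Trm t T"
      using k[OF x] interp_wf(2)[OF i gen_jud_facts(1,2)[OF x]] TmO
      by (cases "\<phi> (gen_jud X h x)" rule: exps.cases) (auto simp del: gen_jud.simps)
    have "boundary (gen_jud X h x) = [gen_jud X (TyO n) (bd X (Tm n) x)]" by (simp add: Let_def TmO)
    then have "\<phi> (gen_jud X (TyO n) (bd X (Tm n) x)) = \<Gamma> \<turnstile> Typ T"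
      using b[OF x] J by (simp del: gen_jud.simps)
    then show ?thesis using ty[OF bd_Tm_in[OF X]] x TmO J by (metis lev.simps(2) vars.simps)
  qed (use ty x in auto)
  note g = gen_jud_facts[OF x]
  show ?thesis
    by (rule jud_eqI[OF interp_wf[OF i g(1,2)] wf_jud_tr[OF X Y d g(1)] _ _ c[OF x]])
       (use g v exps_tr[OF X Y d] in auto)
qed

lemma interp_eq_iff:
  "(\<phi>, \<psi>) \<in> interp_eq (free_gat X) (free_gat Y) \<longleftrightarrow> is_interp (free_gat X) (free_gat Y) \<phi> \<and> is_interp (free_gat X) (free_gat Y) \<psi> \<and>
     (\<forall>J. wf_jud X J \<and> exps J \<noteq> [] \<longrightarrow> canon (\<phi> J) = canon (\<psi> J))"
proof -
  have "(\<exists>k. J \<in> type_juds (free_gat X) k \<union> term_juds (free_gat X) k) \<longleftrightarrow> wf_jud X J \<and> exps J \<noteq> []" for J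
  proof -
    have "(\<exists>k. J \<in> type_juds (free_gat X) k \<union> term_juds (free_gat X) k) \<longleftrightarrow> (\<exists>h. J \<in> juds_at (free_gat X) h)"
      by (metis Un_iff hob.exhaust juds_at.simps)
    then show ?thesis by (simp add: juds_at_free[OF X])
  qed
  then have *: "(\<forall>k. \<forall>J\<in>type_juds (free_gat X) k \<union> term_juds (free_gat X) k. P J) \<longleftrightarrow> (\<forall>J. wf_jud X J \<and> exps J \<noteq> [] \<longrightarrow> P J)" for P
    by blast
  have "(\<phi> J, \<psi> J) \<in> jeq (free_gat Y) \<longleftrightarrow> canon (\<phi> J) = canon (\<psi> J)"
    if "is_interp (free_gat X) (free_gat Y) \<phi>" "is_interp (free_gat X) (free_gat Y) \<psi>" "wf_jud X J" "exps J \<noteq> []" for J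
    using jeq_free_iff[OF Y interp_wf(1)[OF that(1,3,4)] interp_wf(1)[OF that(2,3,4)]
       interp_wf(2)[OF that(1,3,4)] interp_wf(2)[OF that(2,3,4)]] .
  then show ?thesis unfolding interp_eq_def by (auto simp: *)
qed

definition extension :: "'u psh_arrow" where
  "extension = mk_arr (W X) (W Y) (\<lambda>h w. cls (free_gat Y) (tr_jud s l (rep (free_gat X) h w)))"

lemma tr_rep:
  assumes w: "w \<in> elts (W X) h"
  shows "wf_jud Y (tr_jud s l (rep (free_gat X) h w))" "exps (tr_jud s l (rep (free_gat X) h w)) \<noteq> []" "kind (tr_jud s l (rep (free_gat X) h w)) = h"
  using rep_W[OF X w] wf_jud_tr[OF X Y d] exps_tr[OF X Y d] by auto

lemma extension_hom: "extension \<in> phom (W X) (W Y)"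
  unfolding extension_def
proof (rule mk_arr_hom[OF is_psh_W[OF X] is_psh_W[OF Y]])
  fix h w assume "w \<in> elts (W X) h"
  then show "cls (free_gat Y) (tr_jud s l (rep (free_gat X) h w)) \<in> elts (W Y) h"
    using cls_in_W[OF Y] tr_rep by metis
next
  fix e w assume w: "w \<in> elts (W X) (tgt e)"
  let ?J = "rep (free_gat X) (tgt e) w" and ?K = "rep (free_gat X) (src e) (bd (W X) e w)"
  note J = rep_W[OF X w] and b = boundary_bd_jud[OF X rep_W(1-3)[OF X w]]
  have bw: "bd (W X) e w = cls (free_gat X) (bd_jud ?J)" using bd_W[OF X J(1-3)] J(4) by simp
  have cK: "canon ?K = canon (bd_jud ?J)" using canon_rep[OF X b(2,3)] b(4) bw by simp
  note K = rep_W[OF X bd_in[OF is_psh_W[OF X] w]]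
  have "bd_jud (tr_jud s l ?J) = tr_jud s l (bd_jud ?J)"
    using boundary_tr[OF X Y d, of ?J] b(1) boundary_bd_jud(1)[OF Y tr_rep[OF w]] by simp
  moreover have "cls (free_gat Y) (tr_jud s l (bd_jud ?J)) = cls (free_gat Y) (tr_jud s l ?K)"
    using cls_eq_iff[OF Y wf_jud_tr[OF X Y d b(2)] _ wf_jud_tr[OF X Y d K(1)]] b K cK canon_tr[OF X Y d]
      exps_tr[OF X Y d] by simp
  ultimately show "cls (free_gat Y) (tr_jud s l ?K) = bd (W Y) e (cls (free_gat Y) (tr_jud s l ?J))"
    using bd_W[OF Y tr_rep[OF w]] by simp
qed

text \<open>
  The positions selected by the value of a constant are positions in its list of arguments, so they are
  composed with the positions of these arguments.
\<close>

lemma extension_top: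
  assumes w: "w \<in> elts (W X) h"
  defines "js \<equiv> sel X h w" and "x \<equiv> lab X h w"
  shows "sel Y h (ap extension h w) = map ((!) js) (s (lab_ob h js) x)"
    "lab Y h (ap extension h w) = l (lab_ob h js) x"
proof -
  let ?J = "rep (free_gat X) h w"
  note J = rep_W[OF X w]
  have last: "last (canon (tr_jud s l ?J)) = tr_expr s l (last (canon ?J))"
    using canon_tr[OF X Y d J(1)] canon_ne[OF J(2)] by (simp add: last_map)
  have c: "last (canon ?J) = type_app x js \<and> h = TyO (lev h) \<or> last (canon ?J) = term_app x js \<and> h = TmO (lev h)"
    using J last_canon_type[of X] last_canon_term[of X]
    by (cases ?J rule: exps.cases) (fastforce simp: js_def x_def sel_def lab_def simp del: wf_jud.simps last_canon_Typ last_canon_Trm)+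
  note t = sel_cls[OF Y tr_rep(1,2)[OF w], unfolded tr_rep(3)[OF w] last]
  have x: "x \<in> elts X (lab_ob h js)" using top_W(1)[OF X w] by (simp add: x_def js_def)
  from c show "sel Y h (ap extension h w) = map ((!) js) (s (lab_ob h js) x)" "lab Y h (ap extension h w) = l (lab_ob h js) x"
  proof (auto simp: extension_def ap_mk_arr[OF w] t)
  qed (use x tr_expr_type_app[OF X d, of x js] tr_expr_term_app[OF X d, of x js] in \<open>metis lab_ob.simps esel_app elab_app\<close>)+
qed

lemma interp_eq_tr: "(tr_jud s l, tr_jud s l) \<in> interp_eq (free_gat X) (free_gat Y)"
  using is_interp_tr[OF X Y d] by (simp add: interp_eq_iff)

lemma V_ar: "on_ar V (T, a, U) = (on_ob V T, \<lambda>h. \<lambda>x\<in>elts (on_ob V T) h. cls U ((SOME \<phi>. \<phi> \<in> a) (rep T h x)), on_ob V U)"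
  by (simp add: V_def Let_def)

lemma V_tr: "on_ar V (free_gat X, interp_eq (free_gat X) (free_gat Y) `` {tr_jud s l}, free_gat Y) = extension"
proof -
  define \<phi> where "\<phi> = (SOME \<phi>. \<phi> \<in> interp_eq (free_gat X) (free_gat Y) `` {tr_jud s l})"
  have "\<phi> \<in> interp_eq (free_gat X) (free_gat Y) `` {tr_jud s l}"
    unfolding \<phi>_def by (rule someI[of _ "tr_jud s l"]) (simp add: interp_eq_tr)
  then have i: "is_interp (free_gat X) (free_gat Y) \<phi>" and c: "\<And>J. wf_jud X J \<Longrightarrow> exps J \<noteq> [] \<Longrightarrow> canon (\<phi> J) = canon (tr_jud s l J)"
    by (simp_all add: interp_eq_iff)
  have "cls (free_gat Y) (\<phi> (rep (free_gat X) h w)) = cls (free_gat Y) (tr_jud s l (rep (free_gat X) h w))" if "w \<in> elts (W X) h" for h w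
    using cls_eq_iff[OF Y interp_wf[OF i rep_W(1,2)[OF X that]] tr_rep(1,2)[OF that]] c rep_W(1,2)[OF X that]
    by simp
  then show ?thesis unfolding V_ar extension_def mk_arr_def \<phi>_def[symmetric] by (simp cong: restrict_cong)
qed

lemma extension_unit:
  assumes F: "F \<in> phom X (W Y)" and s: "\<And>h x. s h x = sel Y h (ap F h x)"
    and l: "\<And>h x. l h x = lab Y h (ap F h x)"
  shows "pcomp extension (gat_unit X) = F"
proof (rule arrow_eqI[OF Y comp_hom_psh[OF unit_top(1)[OF X] extension_hom] F])
  fix h x assume x: "x \<in> elts X h"
  have "lab_ob h [0..<lev h] = h" by (cases h) auto
  moreover have "map ((!) [0..<lev h]) (s h x) = s h x"
    using sel_less[OF X d x] by (intro map_idI) auto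
  ultimately show "sel Y h (ap (pcomp extension (gat_unit X)) h x) = sel Y h (ap F h x)"
    "lab Y h (ap (pcomp extension (gat_unit X)) h x) = lab Y h (ap F h x)"
    using extension_top[OF ap_in[OF unit_top(1)[OF X] x]] unit_top(2,3)[OF X x]
    by (simp_all add: ap_comp[OF unit_top(1)[OF X] extension_hom x] s l)
qed

text \<open>
  Existence holds by \<open>extension_unit\<close>. For uniqueness, the value of \<open>on_ar V m\<close> on the
  class of a basic judgement is read off an arbitrarily chosen representative. As interpretations commute
  with permutations, it determines the value on the basic judgement itself up to renaming.
\<close>

lemma transpose_eq:
  assumes F: "F \<in> phom X (W Y)" and s: "\<And>h x. s h x = sel Y h (ap F h x)"
    and l: "\<And>h x. l h x = lab Y h (ap F h x)"
  shows "transpose X (free_gat Y) F = (free_gat X, interp_eq (free_gat X) (free_gat Y) `` {tr_jud s l}, free_gat Y)"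
  unfolding transpose_def
proof (rule the_equality)
  show "(free_gat X, interp_eq (free_gat X) (free_gat Y) `` {tr_jud s l}, free_gat Y) \<in> hom gat_cat (free_gat X) (free_gat Y) \<and>
    pcomp (on_ar V (free_gat X, interp_eq (free_gat X) (free_gat Y) `` {tr_jud s l}, free_gat Y)) (gat_unit X) = F"
    unfolding V_tr using extension_unit[OF F s l] is_gat_free_gat[OF X] is_gat_free_gat[OF Y] is_interp_tr[OF X Y d]
    by (auto simp: hom_def gat_cat_def intro: quotientI)
next
  fix m assume m: "m \<in> hom gat_cat (free_gat X) (free_gat Y) \<and> pcomp (on_ar V m) (gat_unit X) = F"
  then obtain a where ma: "m = (free_gat X, a, free_gat Y)" and "a \<in> {\<phi>. is_interp (free_gat X) (free_gat Y) \<phi>} // interp_eq (free_gat X) (free_gat Y)"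
    by (cases m) (auto simp: hom_def gat_cat_def)
  then obtain \<psi> where a: "a = interp_eq (free_gat X) (free_gat Y) `` {\<psi>}" and \<psi>: "is_interp (free_gat X) (free_gat Y) \<psi>"
    by (auto elim: quotientE)
  define \<phi> where "\<phi> = (SOME \<phi>. \<phi> \<in> a)"
  have "\<phi> \<in> a" unfolding \<phi>_def by (rule someI[of _ \<psi>]) (simp add: a interp_eq_iff \<psi>)
  then have \<phi>: "is_interp (free_gat X) (free_gat Y) \<phi>" and \<psi>\<phi>: "\<And>J. wf_jud X J \<Longrightarrow> exps J \<noteq> [] \<Longrightarrow> canon (\<psi> J) = canon (\<phi> J)"
    by (auto simp: a interp_eq_iff)
  have gen: "canon (\<phi> (gen_jud X h x)) = canon (tr_jud s l (gen_jud X h x))" if x: "x \<in> elts X h" for h x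
  proof -
    let ?J = "gen_jud X h x" and ?w = "ap (gat_unit X) h x"
    let ?R = "rep (free_gat X) h ?w"
    note J = gen_jud_facts[OF x] and w = ap_in[OF unit_top(1)[OF X] x]
    have "?w = cls (free_gat X) ?J" by (simp add: gat_unit_eq ap_mk_arr[OF x])
    then have cR: "canon ?J = canon ?R" using canon_rep[OF X J(1,2)] J(3) by simp
    note R = rep_W(1,2)[OF X w]
    obtain \<sigma> where \<sigma>: "bij \<sigma>" "?R = map_jud \<sigma> id ?J" using renaming_if_canon_eq[OF J(1,2) R cR] .
    have "\<phi> ?R = map_jud \<sigma> id (\<phi> ?J)" using interp_perm[OF \<phi> gen_jud_derived[OF X x] \<sigma>(1)] \<sigma>(2) by simp
    then have "canon (\<phi> ?R) = canon (\<phi> ?J)"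
      using canon_map[OF bij_is_inj[OF \<sigma>(1)] interp_wf(1)[OF \<phi> J(1,2)]] by simp
    moreover have "cls (free_gat Y) (\<phi> ?R) = cls (free_gat Y) (tr_jud s l ?R)"
    proof -
      have "ap F h x = cls (free_gat Y) (\<phi> ?R)"
        using m w x by (auto simp: ma V_ar psh_cat_def ap_def gat_unit_eq mk_arr_def compose_def \<phi>_def)
      moreover have "ap F h x = ap extension h ?w"
        using ap_comp[OF unit_top(1)[OF X] extension_hom x] by (simp add: extension_unit[OF F s l])
      ultimately show ?thesis by (simp add: extension_def ap_mk_arr[OF w])
    qed
    then have "canon (\<phi> ?R) = canon (tr_jud s l ?R)"
      using cls_eq_iff[OF Y interp_wf[OF \<phi> R] tr_rep(1,2)[OF w]] by simp
    moreover have "canon (tr_jud s l ?R) = canon (tr_jud s l ?J)"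
      using canon_tr[OF X Y d] R(1) J(1) cR by simp
    ultimately show ?thesis by simp
  qed
  have "\<phi> J = tr_jud s l J" if "wf_jud X J" for J
    using interp_unique[OF X Y d \<phi> interp_on_generators[OF \<phi> gen]] that derived_free_gat[OF X] by blast
  then have "(\<psi>, \<chi>) \<in> interp_eq (free_gat X) (free_gat Y) \<longleftrightarrow> (tr_jud s l, \<chi>) \<in> interp_eq (free_gat X) (free_gat Y)" for \<chi>
    using \<psi>\<phi> \<psi> is_interp_tr[OF X Y d] by (auto simp: interp_eq_iff)
  then show "m = (free_gat X, interp_eq (free_gat X) (free_gat Y) `` {tr_jud s l}, free_gat Y)" unfolding ma a by auto
qed

end

text \<open>
  The Kleisli extension of \<open>F\<close>. Both \<open>W f\<close> and the multiplication are instances of it.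
\<close>

definition bind :: "'u::infinite psh \<Rightarrow> 'u psh \<Rightarrow> 'u psh_arrow \<Rightarrow> 'u psh_arrow" where
  "bind X Y F = on_ar V (transpose X (free_gat Y) F)"

lemma
  fixes Y :: "'u::infinite psh"
  assumes F: "F \<in> phom X (W Y)" and Y: "is_psh Y"
  shows bind_hom: "bind X Y F \<in> phom (W X) (W Y)"
    and sel_bind: "w \<in> elts (W X) h \<Longrightarrow> sel Y h (ap (bind X Y F) h w) =
      map ((!) (sel X h w)) (sel Y (lab_ob h (sel X h w)) (ap F (lab_ob h (sel X h w)) (lab X h w)))"
    and lab_bind: "w \<in> elts (W X) h \<Longrightarrow> lab Y h (ap (bind X Y F) h w) =
      lab Y (lab_ob h (sel X h w)) (ap F (lab_ob h (sel X h w)) (lab X h w))"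
proof -
  note X = hom_psh(1)[OF F]
  note d = top_data_arrow[OF F Y]
  have "bind X Y F = extension X Y (\<lambda>h y. sel Y h (ap F h y)) (\<lambda>h y. lab Y h (ap F h y))"
    unfolding bind_def transpose_eq[OF X Y d F refl refl] by (rule V_tr[OF X Y d])
  then show "bind X Y F \<in> phom (W X) (W Y)"
    "w \<in> elts (W X) h \<Longrightarrow> sel Y h (ap (bind X Y F) h w) =
      map ((!) (sel X h w)) (sel Y (lab_ob h (sel X h w)) (ap F (lab_ob h (sel X h w)) (lab X h w)))"
    "w \<in> elts (W X) h \<Longrightarrow> lab Y h (ap (bind X Y F) h w) =
      lab Y (lab_ob h (sel X h w)) (ap F (lab_ob h (sel X h w)) (lab X h w))"
    using extension_hom[OF X Y d] extension_top[OF X Y d] by simp_all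
qed

section \<open>The weakening monad on positions and labels\<close>

type_synonym 'u psh_funct = "('u psh, 'u psh_arrow, 'u psh, 'u psh_arrow) funct"

abbreviation W_endo :: "'u::infinite psh_funct" where
  "W_endo \<equiv> endo weakening_monad"

abbreviation W_map :: "'u::infinite psh_arrow \<Rightarrow> 'u psh_arrow" where
  "W_map \<equiv> on_ar W_endo"

abbreviation \<mu> :: "'u::infinite psh \<Rightarrow> 'u psh_arrow" where
  "\<mu> \<equiv> mult weakening_monad"

lemma lev_lab_ob [simp]: "lev (lab_ob h js) = length js"
  by (cases h) auto

lemma lab_ob_lab_ob [simp]: "lab_ob (lab_ob h js) js' = lab_ob h js'" "lab_ob h (map f js) = lab_ob h js"
  by (cases h; simp)+

lemma lab_ob_upt [simp]: "lab_ob h [0..<lev h] = h"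
  by (cases h) auto

lemma W_endo_ob [simp]: "on_ob W_endo X = W X"
  by (simp add: weakening_monad_def induced_monad_def comp_funct_def G_def)

lemma W_endo_ar:
  assumes "f \<in> phom X Y"
  shows "W_map f = bind X Y (pcomp (gat_unit Y) f)"
  using homD[OF assms]
  by (simp add: weakening_monad_def induced_monad_def comp_funct_def G_def bind_def Let_def)

lemma mult_eq: "\<mu> X = bind (W X) X (Idn psh_cat (W X))"
  by (simp add: weakening_monad_def induced_monad_def gat_counit_def bind_def G_def)

lemma unit_eq: "unit weakening_monad = gat_unit"
  by (simp add: weakening_monad_def induced_monad_def)

lemma sel_W_less:
  fixes X :: "'u::infinite psh"
  assumes X: "is_psh X" and w: "w \<in> elts (W X) h" and j: "j \<in> set (sel X h w)"
  shows "j < lev h"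
  using sel_less[OF is_psh_W[OF X] top_data_arrow[OF idn_hom_psh[OF is_psh_W[OF X]] X] w, of j] j
  by (simp add: ap_idn[OF w])

lemma lab_in:
  fixes X :: "'u::infinite psh"
  shows "is_psh X \<Longrightarrow> w \<in> elts (W X) h \<Longrightarrow> lab X h w \<in> elts X (lab_ob h (sel X h w))"
  by (rule top_W(1))

lemma
  fixes Y :: "'u::infinite psh"
  assumes f: "f \<in> phom X Y"
  shows W_endo_hom: "W_map f \<in> phom (W X) (W Y)"
    and sel_W_endo: "w \<in> elts (W X) h \<Longrightarrow> sel Y h (ap (W_map f) h w) = sel X h w"
    and lab_W_endo: "w \<in> elts (W X) h \<Longrightarrow> lab Y h (ap (W_map f) h w) = ap f (lab_ob h (sel X h w)) (lab X h w)"
proof -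
  note X = hom_psh(1)[OF f] and Y = hom_psh(2)[OF f]
  note uf = comp_hom_psh[OF f unit_top(1)[OF Y]]
  show "W_map f \<in> phom (W X) (W Y)" unfolding W_endo_ar[OF f] by (rule bind_hom[OF uf Y])
  assume w: "w \<in> elts (W X) h"
  note l = lab_in[OF X w]
  show "sel Y h (ap (W_map f) h w) = sel X h w"
    "lab Y h (ap (W_map f) h w) = ap f (lab_ob h (sel X h w)) (lab X h w)"
    using unit_top(2,3)[OF Y ap_in[OF f l]]
    by (simp_all add: W_endo_ar[OF f] sel_bind[OF uf Y w] lab_bind[OF uf Y w] ap_comp[OF f unit_top(1)[OF Y] l] map_nth)
qed

lemma
  fixes X :: "'u::infinite psh"
  assumes X: "is_psh X"
  shows mult_hom: "\<mu> X \<in> phom (W (W X)) (W X)"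
    and sel_mult: "w \<in> elts (W (W X)) h \<Longrightarrow> sel X h (ap (\<mu> X) h w) =
      map ((!) (sel (W X) h w)) (sel X (lab_ob h (sel (W X) h w)) (lab (W X) h w))"
    and lab_mult: "w \<in> elts (W (W X)) h \<Longrightarrow> lab X h (ap (\<mu> X) h w) =
      lab X (lab_ob h (sel (W X) h w)) (lab (W X) h w)"
proof -
  note i = idn_hom_psh[OF is_psh_W[OF X]]
  show "\<mu> X \<in> phom (W (W X)) (W X)" unfolding mult_eq by (rule bind_hom[OF i X])
  assume w: "w \<in> elts (W (W X)) h"
  show "sel X h (ap (\<mu> X) h w) =
      map ((!) (sel (W X) h w)) (sel X (lab_ob h (sel (W X) h w)) (lab (W X) h w))"
    "lab X h (ap (\<mu> X) h w) = lab X (lab_ob h (sel (W X) h w)) (lab (W X) h w)"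
    using ap_idn[OF lab_in[OF is_psh_W[OF X] w]]
    by (simp_all add: mult_eq sel_bind[OF i X w] lab_bind[OF i X w])
qed

lemma W_endo_idn:
  fixes X :: "'u::infinite psh"
  assumes X: "is_psh X" shows "W_map (Idn psh_cat X) = Idn psh_cat (W X)"
proof (rule arrow_eqI[OF X W_endo_hom[OF idn_hom_psh[OF X]] idn_hom_psh[OF is_psh_W[OF X]]])
  fix h w assume w: "w \<in> elts (W X) h"
  show "sel X h (ap (W_map (Idn psh_cat X)) h w) = sel X h (ap (Idn psh_cat (W X)) h w)"
    "lab X h (ap (W_map (Idn psh_cat X)) h w) = lab X h (ap (Idn psh_cat (W X)) h w)"
    using lab_in[OF X w]
    by (simp_all add: sel_W_endo[OF idn_hom_psh[OF X] w] lab_W_endo[OF idn_hom_psh[OF X] w] ap_idn w)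
qed

lemma W_endo_comp:
  fixes Z :: "'u::infinite psh"
  assumes f: "f \<in> phom X Y" and g: "g \<in> phom Y Z"
  shows "W_map (pcomp g f) = pcomp (W_map g) (W_map f)"
proof (rule arrow_eqI[OF hom_psh(2)[OF g] W_endo_hom[OF comp_hom_psh[OF f g]] comp_hom_psh[OF W_endo_hom[OF f] W_endo_hom[OF g]]])
  note gf = comp_hom_psh[OF f g]
  fix h w assume w: "w \<in> elts (W X) h"
  note Wf = ap_in[OF W_endo_hom[OF f] w]
  show "sel Z h (ap (W_map (pcomp g f)) h w) = sel Z h (ap (pcomp (W_map g) (W_map f)) h w)"
    "lab Z h (ap (W_map (pcomp g f)) h w) = lab Z h (ap (pcomp (W_map g) (W_map f)) h w)"
    by (simp_all add: ap_comp[OF W_endo_hom[OF f] W_endo_hom[OF g] w] sel_W_endo[OF gf w] lab_W_endo[OF gf w] sel_W_endo[OF g Wf]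
      lab_W_endo[OF g Wf] sel_W_endo[OF f w] lab_W_endo[OF f w] ap_comp[OF f g lab_in[OF hom_psh(1)[OF f] w]])
qed

lemma is_functor_W: "is_functor psh_cat psh_cat (W_endo :: 'u::infinite psh_funct)"
  unfolding is_functor_def
proof (intro conjI ballI impI category_psh)
  fix f g :: "'u psh_arrow"
  assume "f \<in> Ar psh_cat" "g \<in> Ar psh_cat" "Cod psh_cat f = Dom psh_cat g"
  then have "f \<in> phom (Dom psh_cat f) (Dom psh_cat g)" "g \<in> phom (Dom psh_cat g) (Cod psh_cat g)"
    by (simp_all add: hom_def)
  then show "W_map (pcomp g f) = pcomp (W_map g) (W_map f)" by (rule W_endo_comp)
next
  fix f :: "'u psh_arrow" assume "f \<in> Ar psh_cat"
  then show "W_map f \<in> phom (on_ob W_endo (Dom psh_cat f)) (on_ob W_endo (Cod psh_cat f))"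
    using W_endo_hom[OF hom_arrow] by simp
qed (simp_all add: Ob_psh W_endo_idn is_psh_W)

lemma unit_natural:
  fixes Y :: "'u::infinite psh"
  assumes f: "f \<in> phom X Y"
  shows "pcomp (W_map f) (gat_unit X) = pcomp (gat_unit Y) f"
proof -
  note X = hom_psh(1)[OF f] and Y = hom_psh(2)[OF f]
  note uX = unit_top[OF X] and uY = unit_top[OF Y] and Wf = W_endo_hom[OF f]
  let ?l = "pcomp (W_map f) (gat_unit X)" and ?r = "pcomp (gat_unit Y) f"
  show ?thesis
  proof (rule arrow_eqI[OF Y comp_hom_psh[OF uX(1) Wf] comp_hom_psh[OF f uY(1)]])
    fix h x assume x: "x \<in> elts X h"
    note ux = ap_in[OF uX(1) x] and fx = ap_in[OF f x]
    show "sel Y h (ap ?l h x) = sel Y h (ap ?r h x)"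
      "lab Y h (ap ?l h x) = lab Y h (ap ?r h x)"
      by (simp_all add: ap_comp[OF uX(1) Wf x] ap_comp[OF f uY(1) x] sel_W_endo[OF f ux] lab_W_endo[OF f ux] uX(2,3)[OF x]
        uY(2,3)[OF fx])
  qed
qed

lemma mult_natural:
  fixes Y :: "'u::infinite psh"
  assumes f: "f \<in> phom X Y"
  shows "pcomp (W_map f) (\<mu> X) = pcomp (\<mu> Y) (W_map (W_map f))"
proof -
  note X = hom_psh(1)[OF f] and Y = hom_psh(2)[OF f]
  note mX = mult_hom[OF X] and mY = mult_hom[OF Y] and Wf = W_endo_hom[OF f] and WWf = W_endo_hom[OF W_endo_hom[OF f]]
  let ?l = "pcomp (W_map f) (\<mu> X)" and ?r = "pcomp (\<mu> Y) (W_map (W_map f))"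
  show ?thesis
  proof (rule arrow_eqI[OF Y comp_hom_psh[OF mX Wf] comp_hom_psh[OF WWf mY]])
    fix h w assume w: "w \<in> elts (W (W X)) h"
    note mw = ap_in[OF mX w] and Wfw = ap_in[OF WWf w] and lw = lab_in[OF is_psh_W[OF X] w]
    show "sel Y h (ap ?l h w) =
        sel Y h (ap ?r h w)"
      "lab Y h (ap ?l h w) =
        lab Y h (ap ?r h w)"
      by (simp_all add: ap_comp[OF mX Wf w] ap_comp[OF WWf mY w] sel_W_endo[OF f mw] lab_W_endo[OF f mw]
        sel_mult[OF X w] lab_mult[OF X w] sel_mult[OF Y Wfw] lab_mult[OF Y Wfw] sel_W_endo[OF Wf w] lab_W_endo[OF Wf w]
        sel_W_endo[OF f lw] lab_W_endo[OF f lw])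
  qed
qed

lemma mult_unit:
  fixes X :: "'u::infinite psh"
  assumes X: "is_psh X"
  shows "pcomp (\<mu> X) (gat_unit (W X)) = Idn psh_cat (W X)"
    "pcomp (\<mu> X) (W_map (gat_unit X)) = Idn psh_cat (W X)"
proof -
  note WX = is_psh_W[OF X] note m = mult_hom[OF X] and u = unit_top[OF WX] and u' = unit_top[OF X]
  note Wu = W_endo_hom[OF u'(1)]
  show "pcomp (\<mu> X) (gat_unit (W X)) = Idn psh_cat (W X)"
  proof (rule arrow_eqI[OF X comp_hom_psh[OF u(1) m] idn_hom_psh[OF WX]])
    fix h w assume w: "w \<in> elts (W X) h"
    note uw = ap_in[OF u(1) w]
    have "map ((!) [0..<lev h]) (sel X h w) = sel X h w"
      using sel_W_less[OF X w] by (intro map_idI) auto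
    then show "sel X h (ap (pcomp (\<mu> X) (gat_unit (W X))) h w) = sel X h (ap (Idn psh_cat (W X)) h w)"
      "lab X h (ap (pcomp (\<mu> X) (gat_unit (W X))) h w) = lab X h (ap (Idn psh_cat (W X)) h w)"
      by (simp_all add: ap_comp[OF u(1) m w] ap_idn[OF w] sel_mult[OF X uw] lab_mult[OF X uw] u(2,3)[OF w])
  qed
  show "pcomp (\<mu> X) (W_map (gat_unit X)) = Idn psh_cat (W X)"
  proof (rule arrow_eqI[OF X comp_hom_psh[OF Wu m] idn_hom_psh[OF WX]])
    fix h w assume w: "w \<in> elts (W X) h"
    note uw = ap_in[OF Wu w] and lw = lab_in[OF X w]
    show "sel X h (ap (pcomp (\<mu> X) (W_map (gat_unit X))) h w) = sel X h (ap (Idn psh_cat (W X)) h w)"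
      "lab X h (ap (pcomp (\<mu> X) (W_map (gat_unit X))) h w) = lab X h (ap (Idn psh_cat (W X)) h w)"
      by (simp_all add: ap_comp[OF Wu m w] ap_idn[OF w] sel_mult[OF X uw] lab_mult[OF X uw]
        sel_W_endo[OF u'(1) w] lab_W_endo[OF u'(1) w] u'(2,3)[OF lw] map_nth)
  qed
qed

text \<open>
  This is the associativity of composing lists of positions. It relies on \<open>sel_W_less\<close>: a label
  selects positions within the list selected by the element it belongs to.
\<close>

lemma mult_assoc:
  fixes X :: "'u::infinite psh"
  assumes X: "is_psh X"
  shows "pcomp (\<mu> X) (\<mu> (W X)) =
    pcomp (\<mu> X) (W_map (\<mu> X))"
proof -
  note WX = is_psh_W[OF X] note WWX = is_psh_W[OF WX]
  note m = mult_hom[OF X] and m' = mult_hom[OF WX] note Wm = W_endo_hom[OF m]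
  let ?l = "pcomp (\<mu> X) (\<mu> (W X))" and ?r = "pcomp (\<mu> X) (W_map (\<mu> X))"
  show ?thesis
  proof (rule arrow_eqI[OF X comp_hom_psh[OF m' m] comp_hom_psh[OF Wm m]])
    fix h w assume w: "w \<in> elts (W (W (W X))) h"
    note mw = ap_in[OF m' w] and Wfw = ap_in[OF Wm w] and lw = lab_in[OF WWX w]
    note llw = lab_in[OF WX lw]
    show "lab X h (ap ?l h w) =
        lab X h (ap ?r h w)"
      by (simp add: ap_comp[OF m' m w] ap_comp[OF Wm m w] lab_mult[OF X mw] lab_mult[OF X Wfw]
        sel_mult[OF WX w] lab_mult[OF WX w] sel_W_endo[OF m w] lab_W_endo[OF m w] lab_mult[OF X lw])
    have "map ((!) (map ((!) (sel (W (W X)) h w)) js)) js' = map ((!) (sel (W (W X)) h w)) (map ((!) js) js')"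
      if "\<And>j. j \<in> set js' \<Longrightarrow> j < length js" for js js'
      using that by simp
    note this[OF sel_W_less[OF X llw, unfolded lev_lab_ob]]
    then show "sel X h (ap ?l h w) =
        sel X h (ap ?r h w)"
      by (simp add: ap_comp[OF m' m w] ap_comp[OF Wm m w] sel_mult[OF X mw] sel_mult[OF X Wfw]
        sel_mult[OF WX w] lab_mult[OF WX w] sel_W_endo[OF m w] lab_W_endo[OF m w] sel_mult[OF X lw])
  qed
qed

lemma unit_nat_trans:
  "is_nat_trans psh_cat psh_cat id_funct (W_endo :: 'u::infinite psh_funct) (unit weakening_monad)"
  unfolding is_nat_trans_def
proof (intro conjI ballI is_functor_id category_psh is_functor_W)
  fix X :: "'u psh" assume "X \<in> Ob psh_cat"
  then show "unit weakening_monad X \<in> phom (on_ob id_funct X) (on_ob W_endo X)"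
    by (simp add: id_funct_def unit_eq unit_top Ob_psh)
next
  fix f :: "'u psh_arrow" assume "f \<in> Ar psh_cat"
  then show "pcomp (W_map f) (unit weakening_monad (Dom psh_cat f)) =
    pcomp (unit weakening_monad (Cod psh_cat f)) (on_ar id_funct f)"
    using unit_natural[OF hom_arrow] by (simp add: id_funct_def unit_eq)
qed

lemma mult_nat_trans:
  "is_nat_trans psh_cat psh_cat (W_endo \<cdot> W_endo) (W_endo :: 'u::infinite psh_funct) (\<mu>)"
  unfolding is_nat_trans_def
proof (intro conjI ballI is_functor_comp[OF is_functor_W is_functor_W] is_functor_W)
  fix X :: "'u psh" assume "X \<in> Ob psh_cat"
  then show "\<mu> X \<in> phom (on_ob (W_endo \<cdot> W_endo) X) (on_ob W_endo X)"
    using mult_hom by (simp add: comp_funct_def Ob_psh)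
next
  fix f :: "'u psh_arrow" assume "f \<in> Ar psh_cat"
  then show "pcomp (W_map f) (\<mu> (Dom psh_cat f)) =
    pcomp (\<mu> (Cod psh_cat f)) (on_ar (W_endo \<cdot> W_endo) f)"
    using mult_natural[OF hom_arrow] by (simp add: comp_funct_def)
qed

lemma is_monad: "is_monad (psh_cat :: ('u::infinite psh, 'u psh_arrow) cat) weakening_monad"
  unfolding is_monad_def Let_def
proof (intro conjI ballI is_functor_W unit_nat_trans mult_nat_trans)
  fix X :: "'u psh" assume "X \<in> Ob psh_cat"
  then have X: "is_psh X" by (simp add: Ob_psh)
  show "pcomp (\<mu> X) (unit weakening_monad (on_ob W_endo X)) = Idn psh_cat (on_ob W_endo X)"
    "pcomp (\<mu> X) (W_map (unit weakening_monad X)) = Idn psh_cat (on_ob W_endo X)"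
    "pcomp (\<mu> X) (\<mu> (on_ob W_endo X)) =
      pcomp (\<mu> X) (W_map (\<mu> X))"
    unfolding W_endo_ob unit_eq by (fact mult_unit[OF X] mult_assoc[OF X])+
qed

section \<open>The left adjoint on slices\<close>

lemma ex_inj_hob: "\<exists>f :: hob \<times> 'u::infinite \<Rightarrow> 'u. inj f"
proof -
  obtain i :: "nat \<Rightarrow> 'u" where i: "inj i"
    using infinite_countable_subset[OF infinite_UNIV[where 'a = 'u]] by auto
  obtain p :: "'u \<times> 'u \<Rightarrow> 'u" where p: "inj p"
    using card_of_Times_same_infinite[OF infinite_UNIV[where 'a = 'u]]
    unfolding card_of_ordIso[symmetric] by (auto simp: bij_betw_def)
  define c where "c h = (case h of TyO n \<Rightarrow> 2 * n | TmO n \<Rightarrow> Suc (2 * n))" for h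
  have "inj c"
  proof (rule injI)
    fix h h' assume "c h = c h'"
    then show "h = h'" by (cases h; cases h') (auto simp: c_def, presburger+)
  qed
  then have [simp]: "c h = c h' \<longleftrightarrow> h = h'" for h h' by (rule inj_eq)
  have [simp]: "i m = i n \<longleftrightarrow> m = n" "p x = p y \<longleftrightarrow> x = y" for m n x y
    using i p by (simp_all add: inj_eq)
  have "inj (\<lambda>(h, x). p (i (c h), x))" by (auto intro: injI)
  then show ?thesis by blast
qed

text \<open>
  The sets at different objects may overlap, so the object is made part of the code.
\<close>

definition node :: "hob \<Rightarrow> 'u::infinite \<Rightarrow> 'u" where
  "node h x = (SOME f :: hob \<times> 'u \<Rightarrow> 'u. inj f) (h, x)"

lemma node_eq [simp]: "node h x = node h' x' \<longleftrightarrow> h = h' \<and> x = x'"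
  unfolding node_def using inj_eq[OF someI_ex[OF ex_inj_hob], of "(h, x)" "(h', x')"] by simp

definition unnode :: "'u::infinite \<Rightarrow> hob \<times> 'u" where
  "unnode c = (THE (h, x). c = node h x)"

lemma unnode_node [simp]: "unnode (node h x) = (h, x)"
  unfolding unnode_def by (rule the_equality) auto

text \<open>
  An arrow \<open>Y \<rightarrow> W Z\<close> with positions \<open>s\<close> labels each element of \<open>Y\<close> by an
  element of \<open>Z\<close>. In this structure every element of \<open>Y\<close> is moved to the object where
  its label lives, and its boundary is the element whose label is the boundary of its label.
\<close>

definition nodes :: "'u::infinite psh \<Rightarrow> (hob \<Rightarrow> 'u \<Rightarrow> nat list) \<Rightarrow> 'u psh" where
  "nodes Y s = \<lparr>elts = \<lambda>d. {node h y | h y. y \<in> elts Y h \<and> lab_ob h (s h y) = d},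
     bd = \<lambda>e c. case unnode c of (h, y) \<Rightarrow> node (par_ob h (s h y)) (restr Y h (par_ob h (s h y)) y)\<rparr>"

lemma elts_nodes: "elts (nodes Y s) d = {node h y | h y. y \<in> elts Y h \<and> lab_ob h (s h y) = d}"
  by (simp add: nodes_def)

lemma bd_nodes: "bd (nodes Y s) e (node h y) = node (par_ob h (s h y)) (restr Y h (par_ob h (s h y)) y)"
  by (simp add: nodes_def)

lemma node_in_nodes: "y \<in> elts Y h \<Longrightarrow> node h y \<in> elts (nodes Y s) (lab_ob h (s h y))"
  by (auto simp: elts_nodes)

lemma lab_ob_par: "tgt e = lab_ob h js \<Longrightarrow> lab_ob (par_ob h js) (par_sel h js) = src e"
  by (cases h; cases e) auto

lemma is_psh_nodes:
  assumes Y: "is_psh Y" and d: "top_data Y Z s l" shows "is_psh (nodes Y s)"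
  unfolding is_psh_def
proof (intro allI funcsetI)
  fix e c assume "c \<in> elts (nodes Y s) (tgt e)"
  then obtain h y where c: "c = node h y" "y \<in> elts Y h" "tgt e = lab_ob h (s h y)" by (auto simp: elts_nodes)
  note t = top_dataD(2,3)[OF d c(2,3)]
  show "bd (nodes Y s) e c \<in> elts (nodes Y s) (src e)"
    using node_in_nodes[OF restr_in[OF Y t(1) c(2)], of s] lab_ob_par[OF c(3)] by (simp add: c(1) bd_nodes t(2))
qed

lemma top_data_nodes:
  assumes d: "top_data Y Z s l" shows "top_data Y (nodes Y s) s node"
  using top_dataD(2,3)[OF d] node_in_nodes unfolding top_data_def bd_nodes by blast

lemma bd_to_bd_to: "j \<le> i \<Longrightarrow> i \<le> n \<Longrightarrow> bd_to X i j (bd_to X n i x) = bd_to X n j x"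
  by (induction n arbitrary: x) (auto simp: le_Suc_eq)

text \<open>
  The boundary of the node selects the remaining positions, which are followed one after the other.
\<close>

lemma bd_to_nodes:
  assumes Y: "is_psh Y" and d: "top_data Y Z s l"
  shows "y \<in> elts Y (TyO n) \<Longrightarrow> length (s (TyO n) y) = k \<Longrightarrow> j < k \<Longrightarrow>
    bd_to (nodes Y s) k j (node (TyO n) y) = node (TyO (s (TyO n) y ! j)) (bd_to Y n (s (TyO n) y ! j) y)"
proof (induction k arbitrary: n y)
  case (Suc k)
  define js i where "js = butlast (s (TyO n) y)" and "i = last (s (TyO n) y)"
  have "s (TyO n) y \<noteq> []" using Suc.prems(2) by auto
  then have s: "s (TyO n) y = js @ [i]" "length js = k" using Suc.prems(2) by (simp_all add: js_def i_def)
  have t: "i < n" "s (TyO i) (bd_to Y n i y) = js"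
    using top_dataD(2,3)[OF d Suc.prems(1), of "Ext k"] s by auto
  note y' = bd_to_in[OF Y less_imp_le[OF t(1)] Suc.prems(1)]
  have b: "bd (nodes Y s) (Ext k) (node (TyO n) y) = node (TyO i) (bd_to Y n i y)" by (simp add: bd_nodes s)
  show ?case
  proof (cases "j = k")
    case True
    then show ?thesis using b s by (simp add: nth_append)
  next
    case False
    then have j: "j < k" using Suc.prems by simp
    have "js ! j < i" using sel_less[OF Y d y', of "js ! j"] t(2) s(2) j by simp
    then show ?thesis
      using Suc.IH[OF y' _ j] b s t j bd_to_bd_to[of "js ! j" i n Y y] by (simp add: nth_append)
  qed
qed simp

text \<open>
  Here \<open>js'\<close> stands for the positions selected by the label of \<open>y\<close>, when labels are
  themselves judgements. The restriction of the node to the parent of the label corresponds to the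
  restriction of \<open>y\<close> along the composed list of positions.
\<close>

lemma restr_nodes:
  assumes Y: "is_psh Y" and d: "top_data Y Z s l" and y: "y \<in> elts Y h"
    and e: "tgt e = lab_ob h js'" and b: "below (par_ob (lab_ob h (s h y)) js') (lab_ob h (s h y))"
  defines "h' \<equiv> par_ob h (map ((!) (s h y)) js')"
  shows "restr (nodes Y s) (lab_ob h (s h y)) (par_ob (lab_ob h (s h y)) js') (node h y) = node h' (restr Y h h' y)"
proof (cases h)
  case (TyO n)
  then have "js' \<noteq> []" using e by (cases e) auto
  then show ?thesis using bd_to_nodes[OF Y d y[unfolded TyO] refl, of "last js'"] b by (simp add: h'_def TyO last_map)
next
  case (TmO n)
  then show ?thesis by (simp add: h'_def bd_nodes)
qed

text \<open>
  The positions \<open>s\<close> are required to be those of some arrow \<open>F\<^sub>0\<close>, which ensures that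
  they fit together along restrictions.
\<close>

context
  fixes Y Q :: "'u::infinite psh" and s F\<^sub>0
  assumes F0: "F\<^sub>0 \<in> phom Y (W Q)" and Q: "is_psh Q"
    and s: "s = (\<lambda>h y. sel Q h (ap F\<^sub>0 h y))"
begin

lemma shape: "top_data Y Q s (\<lambda>h y. lab Q h (ap F\<^sub>0 h y))"
  unfolding s by (rule top_data_arrow[OF F0 Q])

lemma is_psh_shape: "is_psh (nodes Y s)"
  by (rule is_psh_nodes[OF hom_psh(1)[OF F0] shape])

text \<open>
  The arrow with positions \<open>s\<close> that labels each element by its own node. It is universal among
  arrows with these positions (\<open>ex_mate\<close>, \<open>mate_inj\<close>).
\<close>

definition generic :: "'u psh_arrow" where
  "generic = mk_arr Y (W (nodes Y s)) (\<lambda>h y. cls (free_gat (nodes Y s)) (top_jud Y s node h y))"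

lemma generic: "generic \<in> phom Y (W (nodes Y s))" "y \<in> elts Y h \<Longrightarrow> sel (nodes Y s) h (ap generic h y) = s h y"
  "y \<in> elts Y h \<Longrightarrow> lab (nodes Y s) h (ap generic h y) = node h y"
  using ex_arrow[OF hom_psh(1)[OF F0] is_psh_shape top_data_nodes[OF shape]] by (simp_all add: generic_def)

lemma mate_hom: "m \<in> phom (nodes Y s) Z \<Longrightarrow> pcomp (W_map m) generic \<in> phom Y (W Z)"
  by (rule comp_hom_psh[OF generic(1) W_endo_hom])

lemma mate_top:
  assumes m: "m \<in> phom (nodes Y s) Z" and y: "y \<in> elts Y h"
  shows "sel Z h (ap (pcomp (W_map m) generic) h y) = s h y"
    "lab Z h (ap (pcomp (W_map m) generic) h y) = ap m (lab_ob h (s h y)) (node h y)"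
  using generic(2,3)[OF y] ap_in[OF generic(1) y]
  by (simp_all add: ap_comp[OF generic(1) W_endo_hom[OF m] y] sel_W_endo[OF m] lab_W_endo[OF m])

lemma nodes_eqI:
  assumes "m \<in> phom (nodes Y s) Z" "m' \<in> phom (nodes Y s) Z"
    and "\<And>h y. y \<in> elts Y h \<Longrightarrow> ap m (lab_ob h (s h y)) (node h y) = ap m' (lab_ob h (s h y)) (node h y)"
  shows "m = m'"
  by (rule hom_psh_eqI[OF assms(1,2)]) (use assms(3) in \<open>auto simp: elts_nodes\<close>)

lemma mate_inj:
  assumes "m \<in> phom (nodes Y s) Z" "m' \<in> phom (nodes Y s) Z"
    and "pcomp (W_map m) generic = pcomp (W_map m') generic"
  shows "m = m'"
  by (rule nodes_eqI[OF assms(1,2)]) (use mate_top(2)[OF assms(1)] mate_top(2)[OF assms(2)] assms(3) in metis)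

text \<open>
  By \<open>top_data_arrow\<close> the labels of an arrow with positions \<open>s\<close> respect the boundaries of
  nodes.
\<close>

lemma ex_mate:
  assumes F: "F \<in> phom Y (W Z)" and Z: "is_psh Z"
    and sF: "\<And>h y. y \<in> elts Y h \<Longrightarrow> sel Z h (ap F h y) = s h y"
  obtains m where "m \<in> phom (nodes Y s) Z" "pcomp (W_map m) generic = F"
    "\<And>h y. y \<in> elts Y h \<Longrightarrow> ap m (lab_ob h (s h y)) (node h y) = lab Z h (ap F h y)"
proof -
  note t = top_data_arrow[OF F Z]
  define m where "m = mk_arr (nodes Y s) Z (\<lambda>d c. case unnode c of (h, y) \<Rightarrow> lab Z h (ap F h y))"
  have m: "m \<in> phom (nodes Y s) Z"
    unfolding m_def
  proof (rule mk_arr_hom[OF is_psh_shape Z])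
    fix d c assume "c \<in> elts (nodes Y s) d"
    then show "(case unnode c of (h, y) \<Rightarrow> lab Z h (ap F h y)) \<in> elts Z d"
      using top_dataD(1)[OF t] sF by (auto simp: elts_nodes)
  next
    fix e c assume "c \<in> elts (nodes Y s) (tgt e)"
    then obtain h y where c: "c = node h y" "y \<in> elts Y h" "tgt e = lab_ob h (s h y)" by (auto simp: elts_nodes)
    show "(case unnode (bd (nodes Y s) e c) of (h, y) \<Rightarrow> lab Z h (ap F h y)) =
           bd Z e (case unnode c of (h, y) \<Rightarrow> lab Z h (ap F h y))"
      using top_dataD(4)[OF t c(2), of e] c(3) sF[OF c(2)] by (simp add: c(1) bd_nodes)
  qed
  have am: "ap m (lab_ob h (s h y)) (node h y) = lab Z h (ap F h y)" if "y \<in> elts Y h" for h y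
    using node_in_nodes[OF that, of s] by (simp add: m_def ap_mk_arr)
  have "pcomp (W_map m) generic = F"
    by (rule arrow_eqI[OF Z mate_hom[OF m] F]) (simp_all add: mate_top[OF m] sF am)
  then show ?thesis using that m am by blast
qed

end

section \<open>The weakening monad is strongly cartesian\<close>

lemma is_pullbackI:
  assumes "p \<in> hom C P A" "q \<in> hom C P B" "f \<in> hom C A Z" "g \<in> hom C B Z" "Cmp C f p = Cmp C g q"
    and "\<And>Y a b. a \<in> hom C Y A \<Longrightarrow> b \<in> hom C Y B \<Longrightarrow> Cmp C f a = Cmp C g b \<Longrightarrow>
      \<exists>!u. u \<in> hom C Y P \<and> Cmp C p u = a \<and> Cmp C q u = b"
  shows "is_pullback C p q f g"
  unfolding is_pullback_def
proof (intro conjI ballI impI)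
  fix h k assume *: "h \<in> Ar C" "k \<in> Ar C"
    "Dom C h = Dom C k \<and> Cod C h = Dom C f \<and> Cod C k = Dom C g \<and> Cmp C f h = Cmp C g k"
  then have "h \<in> hom C (Dom C h) A" "k \<in> hom C (Dom C h) B" "Cmp C f h = Cmp C g k"
    using assms by (simp_all add: hom_def)
  from assms(6)[OF this] show "\<exists>!u. u \<in> hom C (Dom C h) (Dom C p) \<and> Cmp C p u = h \<and> Cmp C q u = k"
    using assms(1) by (simp add: hom_def)
qed (use assms in \<open>simp_all add: hom_def\<close>)

lemma is_pullbackD:
  assumes pb: "is_pullback C p q f g" and a: "a \<in> hom C Y (Dom C f)" and b: "b \<in> hom C Y (Dom C g)"
    and eq: "Cmp C f a = Cmp C g b"
  shows "\<exists>!u. u \<in> hom C Y (Dom C p) \<and> Cmp C p u = a \<and> Cmp C q u = b"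
proof -
  have "\<forall>h\<in>Ar C. \<forall>k\<in>Ar C.
        Dom C h = Dom C k \<and> Cod C h = Dom C f \<and> Cod C k = Dom C g \<and> Cmp C f h = Cmp C g k \<longrightarrow>
        (\<exists>!u. u \<in> hom C (Dom C h) (Dom C p) \<and> Cmp C p u = h \<and> Cmp C q u = k)"
    using pb unfolding is_pullback_def by blast
  with homD[OF a] homD[OF b] eq show ?thesis by metis
qed

text \<open>
  Two arrows into \<open>W A\<close> and \<open>W B\<close> that agree over \<open>W C\<close> have the same positions.
  So they correspond to arrows out of the same structure of nodes, into \<open>A\<close> and \<open>B\<close>, where
  the given pullback applies.
\<close>

lemma preserves_pullbacks_W: "preserves_pullbacks psh_cat psh_cat (W_endo :: 'u::infinite psh_funct)"
  unfolding preserves_pullbacks_def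
proof (intro allI impI)
  fix p q f g :: "'u psh_arrow"
  assume pb: "is_pullback psh_cat p q f g"
  define P A B C where "P = Dom psh_cat p" and "A = Dom psh_cat f" and "B = Dom psh_cat g" and "C = Cod psh_cat f"
  have p: "p \<in> phom P A" and q: "q \<in> phom P B" and f: "f \<in> phom A C" and g: "g \<in> phom B C"
    and sq: "pcomp f p = pcomp g q"
    using pb by (auto simp: is_pullback_def hom_def P_def A_def B_def C_def)
  have univ: "\<exists>!u. u \<in> phom Y P \<and> pcomp p u = a \<and> pcomp q u = b"
    if "a \<in> phom Y A" "b \<in> phom Y B" "pcomp f a = pcomp g b" for Y a b
    using is_pullbackD[OF pb] that unfolding P_def A_def B_def by blast
  note A = hom_psh(1)[OF f] and B = hom_psh(1)[OF g] and C = hom_psh(2)[OF f] and P = hom_psh(1)[OF p]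
  note Wp = W_endo_hom[OF p] and Wq = W_endo_hom[OF q] and Wf = W_endo_hom[OF f] and Wg = W_endo_hom[OF g]
  have main: "\<exists>!u. u \<in> phom Y (W P) \<and> pcomp (W_map p) u = a \<and> pcomp (W_map q) u = b"
    if a: "a \<in> phom Y (W A)" and b: "b \<in> phom Y (W B)"
      and eq: "pcomp (W_map f) a = pcomp (W_map g) b" for Y a b
  proof -
    define s where "s = (\<lambda>h y. sel A h (ap a h y))"
    note cx = a A s_def
    have e: "ap (W_map f) h (ap a h y) = ap (W_map g) h (ap b h y)" if "y \<in> elts Y h" for h y
      using ap_comp[OF a Wf that] ap_comp[OF b Wg that] eq by simp
    have sb: "sel B h (ap b h y) = s h y" if "y \<in> elts Y h" for h y
      using e[OF that] sel_W_endo[OF f ap_in[OF a that]] sel_W_endo[OF g ap_in[OF b that]] by (simp add: s_def)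
    obtain ma where ma: "ma \<in> phom (nodes Y s) A" "pcomp (W_map ma) (generic Y s) = a"
      "\<And>h y. y \<in> elts Y h \<Longrightarrow> ap ma (lab_ob h (s h y)) (node h y) = lab A h (ap a h y)"
      using ex_mate[OF cx a A] by (auto simp: s_def)
    obtain mb where mb: "mb \<in> phom (nodes Y s) B" "pcomp (W_map mb) (generic Y s) = b"
      "\<And>h y. y \<in> elts Y h \<Longrightarrow> ap mb (lab_ob h (s h y)) (node h y) = lab B h (ap b h y)"
      using ex_mate[OF cx b B] sb by auto
    note mh = mate_hom[OF cx] and gen = generic(1)[OF cx]
    have mate_comp: "pcomp (W_map n) (pcomp (W_map m) (generic Y s)) = pcomp (W_map (pcomp n m)) (generic Y s)"
      if "m \<in> phom (nodes Y s) D" "n \<in> phom D E" for m n D E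
      using comp_assoc[OF category_psh gen W_endo_hom[OF that(1)] W_endo_hom[OF that(2)]] W_endo_comp[OF that] by simp
    have "pcomp f ma = pcomp g mb"
      by (rule mate_inj[OF cx comp_hom_psh[OF ma(1) f] comp_hom_psh[OF mb(1) g]])
         (use mate_comp[OF ma(1) f] mate_comp[OF mb(1) g] ma(2) mb(2) eq in simp)
    from univ[OF ma(1) mb(1) this] obtain k where k: "k \<in> phom (nodes Y s) P" "pcomp p k = ma" "pcomp q k = mb"
      and ku: "\<And>k'. k' \<in> phom (nodes Y s) P \<Longrightarrow> pcomp p k' = ma \<Longrightarrow> pcomp q k' = mb \<Longrightarrow> k' = k"
      by metis
    show ?thesis
    proof (rule ex1I[of _ "pcomp (W_map k) (generic Y s)"])
      show "pcomp (W_map k) (generic Y s) \<in> phom Y (W P) \<and>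
        pcomp (W_map p) (pcomp (W_map k) (generic Y s)) = a \<and>
        pcomp (W_map q) (pcomp (W_map k) (generic Y s)) = b"
        using mh[OF k(1)] mate_comp[OF k(1) p] mate_comp[OF k(1) q] k(2,3) ma(2) mb(2) by simp
    next
      fix u assume u: "u \<in> phom Y (W P) \<and> pcomp (W_map p) u = a \<and> pcomp (W_map q) u = b"
      then have uh: "u \<in> phom Y (W P)" by simp
      have "sel P h (ap u h y) = s h y" if "y \<in> elts Y h" for h y
        using u ap_comp[OF uh Wp that] sel_W_endo[OF p ap_in[OF uh that]] by (simp add: s_def)
      then obtain k' where k': "k' \<in> phom (nodes Y s) P" "pcomp (W_map k') (generic Y s) = u"
        using ex_mate[OF cx uh P] by blast
      have "pcomp p k' = ma"
        by (rule mate_inj[OF cx comp_hom_psh[OF k'(1) p] ma(1)]) (use mate_comp[OF k'(1) p] k'(2) u ma(2) in simp)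
      moreover have "pcomp q k' = mb"
        by (rule mate_inj[OF cx comp_hom_psh[OF k'(1) q] mb(1)]) (use mate_comp[OF k'(1) q] k'(2) u mb(2) in simp)
      ultimately show "u = pcomp (W_map k) (generic Y s)" using ku[OF k'(1)] k'(2) by simp
    qed
  qed
  have sqT: "pcomp (W_map f) (W_map p) = pcomp (W_map g) (W_map q)"
    using W_endo_comp[OF p f] W_endo_comp[OF q g] sq by simp
  show "is_pullback psh_cat (W_map p) (W_map q) (W_map f) (W_map g)"
    by (rule is_pullbackI[OF Wp Wq Wf Wg sqT main])
qed

text \<open>
  An element of \<open>W X\<close> whose image is in the image of the unit selects all positions, so it is the
  unit applied to its label.
\<close>

lemma unit_cartesian:
  fixes Y :: "'u::infinite psh"
  assumes f: "f \<in> phom X Y"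
  shows "is_pullback psh_cat (gat_unit X) f (W_map f) (gat_unit Y)"
proof (rule is_pullbackI)
  note X = hom_psh(1)[OF f] and Y = hom_psh(2)[OF f]
  note uX = unit_top[OF X] and uY = unit_top[OF Y] and Wf = W_endo_hom[OF f]
  show "gat_unit X \<in> phom X (W X)" "f \<in> phom X Y" "W_map f \<in> phom (W X) (W Y)"
    "gat_unit Y \<in> phom Y (W Y)" by (fact uX(1) f Wf uY(1))+
  show "pcomp (W_map f) (gat_unit X) = pcomp (gat_unit Y) f" by (rule unit_natural[OF f])
  fix Z a b assume a: "a \<in> phom Z (W X)" and b: "b \<in> phom Z Y"
    and eq: "pcomp (W_map f) a = pcomp (gat_unit Y) b"
  have e: "ap (W_map f) h (ap a h z) = ap (gat_unit Y) h (ap b h z)" if "z \<in> elts Z h" for h z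
    using ap_comp[OF a Wf that] ap_comp[OF b uY(1) that] eq by simp
  have sa: "sel X h (ap a h z) = [0..<lev h]" if "z \<in> elts Z h" for h z
    using e[OF that] sel_W_endo[OF f ap_in[OF a that]] uY(2)[OF ap_in[OF b that]] by simp
  have la: "ap f h (lab X h (ap a h z)) = ap b h z" if "z \<in> elts Z h" for h z
    using e[OF that] lab_W_endo[OF f ap_in[OF a that]] uY(3)[OF ap_in[OF b that]] sa[OF that] by simp
  note t = top_data_arrow[OF a X]
  have li: "lab X h (ap a h z) \<in> elts X h" if "z \<in> elts Z h" for h z
    using top_dataD(1)[OF t that] sa[OF that] by simp
  define u where "u = mk_arr Z X (\<lambda>h z. lab X h (ap a h z))"
  have u: "u \<in> phom Z X"
    unfolding u_def
  proof (rule mk_arr_hom[OF hom_psh(1)[OF a] X])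
    fix h z assume z: "z \<in> elts Z h"
    show "lab X h (ap a h z) \<in> elts X h" by (rule li[OF z])
  next
    fix e z assume z: "z \<in> elts Z (tgt e)"
    have "par_ob (tgt e) [0..<lev (tgt e)] = src e" by (cases e) auto
    then show "lab X (src e) (ap a (src e) (bd Z e z)) = bd X e (lab X (tgt e) (ap a (tgt e) z))"
      using top_dataD(4)[OF t z, of e] sa[OF z] by (simp add: bd_eq_restr)
  qed
  have au: "ap u h z = lab X h (ap a h z)" if "z \<in> elts Z h" for h z using that by (simp add: u_def ap_mk_arr)
  show "\<exists>!u. u \<in> phom Z X \<and> pcomp (gat_unit X) u = a \<and> pcomp f u = b"
  proof (rule ex1I[of _ u], intro conjI u)
    show "pcomp (gat_unit X) u = a"
      by (rule arrow_eqI[OF X comp_hom_psh[OF u uX(1)] a])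
         (simp_all add: ap_comp[OF u uX(1)] au uX(2,3)[OF li] sa)
    show "pcomp f u = b"
      by (rule hom_psh_eqI[OF comp_hom_psh[OF u f] b]) (simp add: ap_comp[OF u f] au la)
  next
    fix u' assume u': "u' \<in> phom Z X \<and> pcomp (gat_unit X) u' = a \<and> pcomp f u' = b"
    then have u'h: "u' \<in> phom Z X" by simp
    show "u' = u"
    proof (rule hom_psh_eqI[OF u'h u])
      fix h z assume z: "z \<in> elts Z h"
      show "ap u' h z = ap u h z"
        using u' ap_comp[OF u'h uX(1) z] uX(3)[OF ap_in[OF u'h z]] au[OF z] by simp
    qed
  qed
qed

text \<open>
  The arrow \<open>u\<close> into \<open>W (W X)\<close> has to have the positions \<open>s\<close> of \<open>b\<close>. So
  it corresponds to an arrow from the nodes into \<open>W X\<close>, which is in turn given by tops: the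
  positions have to be the positions \<open>s'\<close> of the labels of \<open>b\<close>, because they are
  unaffected by \<open>f\<close>, and the labels have to be those of \<open>a\<close>.
\<close>

lemma mult_cartesian:
  fixes Y :: "'u::infinite psh"
  assumes f: "f \<in> phom X Y"
  shows "is_pullback psh_cat (\<mu> X) (W_map (W_map f)) (W_map f) (\<mu> Y)"
proof (rule is_pullbackI)
  note X = hom_psh(1)[OF f] and Y = hom_psh(2)[OF f]
  note WX = is_psh_W[OF X] and WY = is_psh_W[OF Y]
  note mX = mult_hom[OF X] and mY = mult_hom[OF Y] and Wf = W_endo_hom[OF f]
  note WWf = W_endo_hom[OF Wf]
  show "\<mu> X \<in> phom (W (W X)) (W X)"
    "W_map (W_map f) \<in> phom (W (W X)) (W (W Y))" "W_map f \<in> phom (W X) (W Y)"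
    "\<mu> Y \<in> phom (W (W Y)) (W Y)" by (fact mX WWf Wf mY)+
  show "pcomp (W_map f) (\<mu> X) = pcomp (\<mu> Y) (W_map (W_map f))"
    by (rule mult_natural[OF f])
  fix Z a b assume a: "a \<in> phom Z (W X)" and b: "b \<in> phom Z (W (W Y))"
    and eq: "pcomp (W_map f) a = pcomp (\<mu> Y) b"
  note Z = hom_psh(1)[OF a]
  define s where "s = (\<lambda>h z. sel (W Y) h (ap b h z))"
  define s' where "s' = (\<lambda>h z. sel Y (lab_ob h (s h z)) (lab (W Y) h (ap b h z)))"
  note cx = b WY s_def
  have e: "ap (W_map f) h (ap a h z) = ap (\<mu> Y) h (ap b h z)" if "z \<in> elts Z h" for h z
    using ap_comp[OF a Wf that] ap_comp[OF b mY that] eq by simp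
  have sa: "sel X h (ap a h z) = map ((!) (s h z)) (s' h z)" if "z \<in> elts Z h" for h z
    using e[OF that] sel_W_endo[OF f ap_in[OF a that]] sel_mult[OF Y ap_in[OF b that]] by (simp add: s_def s'_def)
  have la: "ap f (lab_ob h (s' h z)) (lab X h (ap a h z)) = lab Y (lab_ob h (s h z)) (lab (W Y) h (ap b h z))"
    if "z \<in> elts Z h" for h z
    using e[OF that] lab_W_endo[OF f ap_in[OF a that]] lab_mult[OF Y ap_in[OF b that]] sa[OF that] by (simp add: s_def)
  obtain mb where mb: "mb \<in> phom (nodes Z s) (W Y)" "pcomp (W_map mb) (generic Z s) = b"
    "\<And>h z. z \<in> elts Z h \<Longrightarrow> ap mb (lab_ob h (s h z)) (node h z) = lab (W Y) h (ap b h z)"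
    using ex_mate[OF cx b WY] by (auto simp: s_def)
  note td = top_data_arrow[OF b WY, folded s_def]
  note ta = top_data_arrow[OF a X]
  define sl where "sl = (\<lambda>(d :: hob) c. case unnode c of (h, z) \<Rightarrow> s' h z)"
  define ll where "ll = (\<lambda>(d :: hob) c. case unnode c of (h, z) \<Rightarrow> lab X h (ap a h z))"
  have tl: "top_data (nodes Z s) X sl ll"
    unfolding top_data_def
  proof (intro allI ballI)
    fix d c assume c: "c \<in> elts (nodes Z s) d"
    then obtain h z where hz: "c = node h z" "z \<in> elts Z h" "d = lab_ob h (s h z)" by (auto simp: elts_nodes)
    let ?\<Lambda> = "lab (W Y) h (ap b h z)"
    have \<Lambda>: "?\<Lambda> \<in> elts (W Y) d" using top_dataD(1)[OF td hz(2)] by (simp add: hz(3))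
    have js': "sl d c = sel Y d ?\<Lambda>" by (simp add: sl_def hz s'_def)
    have 1: "ll d c \<in> elts X (lab_ob d (sl d c))"
      using top_dataD(1)[OF ta hz(2)] sa[OF hz(2)] by (simp add: ll_def sl_def hz)
    have 2: "below (par_ob d (sl d c)) d \<and>
       sl (par_ob d (sl d c)) (restr (nodes Z s) d (par_ob d (sl d c)) c) = par_sel d (sl d c) \<and>
       ll (par_ob d (sl d c)) (restr (nodes Z s) d (par_ob d (sl d c)) c) = bd X e (ll d c)"
      if e: "tgt e = lab_ob d (sl d c)" for e
    proof -
      \<comment> \<open>The condition on the parent of the node: its positions come from the labels of \<open>b\<close>, its label from \<open>a\<close>.\<close>
      let ?j = "par_ob d (sl d c)" and ?h = "par_ob h (sel X h (ap a h z))"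
      note top = top_W(2-4)[OF Y \<Lambda>, folded js', OF e]
      have eh: "tgt e = lab_ob h (sel X h (ap a h z))" using e sa[OF hz(2)] by (simp add: hz(3) sl_def hz(1))
      have slc: "sl d c = s' h z" by (simp add: sl_def hz)
      have r: "restr (nodes Z s) d ?j c = node ?h (restr Z h ?h z)"
        using restr_nodes[OF Z td hz(2), of e "s' h z"] e top(1) sa[OF hz(2)]
        unfolding slc unfolding hz(1,3) by simp
      note zt = top_dataD(2-4)[OF ta hz(2) eh]
      have z': "restr Z h ?h z \<in> elts Z ?h" by (rule restr_in[OF Z zt(1) hz(2)])
      have "node ?h (restr Z h ?h z) \<in> elts (nodes Z s) ?j"
        using restr_in[OF is_psh_shape[OF cx] top(1) c] by (simp add: r)
      then have dj: "lab_ob ?h (s ?h (restr Z h ?h z)) = ?j" by (auto simp: elts_nodes)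
      have "lab (W Y) ?h (ap b ?h (restr Z h ?h z)) = ap mb ?j (restr (nodes Z s) d ?j c)"
        using mb(3)[OF z'] by (simp add: r dj)
      also have "\<dots> = restr (W Y) d ?j ?\<Lambda>"
        using ap_restr[OF mb(1) top(1) c] mb(3)[OF hz(2)] by (simp add: hz(1,3))
      finally have lb: "lab (W Y) ?h (ap b ?h (restr Z h ?h z)) = restr (W Y) d ?j ?\<Lambda>" .
      have "sl ?j (restr (nodes Z s) d ?j c) = s' ?h (restr Z h ?h z)" unfolding r by (simp add: sl_def)
      also have "\<dots> = par_sel d (sl d c)" unfolding s'_def dj lb by (rule top(2))
      finally have "sl ?j (restr (nodes Z s) d ?j c) = par_sel d (sl d c)" .
      moreover have "ll ?j (restr (nodes Z s) d ?j c) = bd X e (ll d c)"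
        unfolding r using zt(3) by (simp add: ll_def hz(1))
      ultimately show ?thesis using top(1) by simp
    qed
    show "ll d c \<in> elts X (lab_ob d (sl d c)) \<and> (\<forall>e. tgt e = lab_ob d (sl d c) \<longrightarrow> below (par_ob d (sl d c)) d \<and>
       sl (par_ob d (sl d c)) (restr (nodes Z s) d (par_ob d (sl d c)) c) = par_sel d (sl d c) \<and>
       ll (par_ob d (sl d c)) (restr (nodes Z s) d (par_ob d (sl d c)) c) = bd X e (ll d c))" using 1 2 by blast
  qed
  obtain l where l: "l \<in> phom (nodes Z s) (W X)"
    "\<And>h z. z \<in> elts Z h \<Longrightarrow> sel X (lab_ob h (s h z)) (ap l (lab_ob h (s h z)) (node h z)) = s' h z"
    "\<And>h z. z \<in> elts Z h \<Longrightarrow> lab X (lab_ob h (s h z)) (ap l (lab_ob h (s h z)) (node h z)) = lab X h (ap a h z)"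
  proof -
    note ea = ex_arrow[OF is_psh_shape[OF cx] X tl]
    show ?thesis by (rule that[OF ea(1)]) (use ea(2,3)[OF node_in_nodes] in \<open>simp_all add: sl_def ll_def\<close>)
  qed
  note gen = generic(1)[OF cx] and ml = mate_hom[OF cx l(1)]
  have Wfl: "pcomp (W_map f) l = mb"
  proof (rule arrow_eqI[OF Y comp_hom_psh[OF l(1) Wf] mb(1)])
    fix d c assume c: "c \<in> elts (nodes Z s) d"
    then obtain h z where hz: "c = node h z" "z \<in> elts Z h" "d = lab_ob h (s h z)" by (auto simp: elts_nodes)
    note lc = ap_in[OF l(1) c]
    show "sel Y d (ap (pcomp (W_map f) l) d c) = sel Y d (ap mb d c)"
      using l(2)[OF hz(2)] mb(3)[OF hz(2)]
      by (simp add: ap_comp[OF l(1) Wf c] sel_W_endo[OF f lc], simp add: hz(1,3) s'_def)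
    show "lab Y d (ap (pcomp (W_map f) l) d c) = lab Y d (ap mb d c)"
      using l(2,3)[OF hz(2)] mb(3)[OF hz(2)] la[OF hz(2)]
      by (simp add: ap_comp[OF l(1) Wf c] lab_W_endo[OF f lc], simp add: hz(1,3))
  qed
  show "\<exists>!u. u \<in> phom Z (W (W X)) \<and> pcomp (\<mu> X) u = a \<and> pcomp (W_map (W_map f)) u = b"
  proof (rule ex1I[of _ "pcomp (W_map l) (generic Z s)"], intro conjI ml)
    show "pcomp (\<mu> X) (pcomp (W_map l) (generic Z s)) = a"
    proof (rule arrow_eqI[OF X comp_hom_psh[OF ml mX] a])
      fix h z assume z: "z \<in> elts Z h"
      note w = ap_in[OF ml z]
      show "sel X h (ap (pcomp (\<mu> X) (pcomp (W_map l) (generic Z s))) h z) = sel X h (ap a h z)"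
        "lab X h (ap (pcomp (\<mu> X) (pcomp (W_map l) (generic Z s))) h z) = lab X h (ap a h z)"
        by (simp_all add: ap_comp[OF ml mX z] sel_mult[OF X w] lab_mult[OF X w] mate_top[OF cx l(1) z] l(2,3)[OF z] sa[OF z])
    qed
    show "pcomp (W_map (W_map f)) (pcomp (W_map l) (generic Z s)) = b"
      using comp_assoc[OF category_psh gen W_endo_hom[OF l(1)] WWf] W_endo_comp[OF l(1) Wf] Wfl mb(2) by simp
  next
    fix u assume u: "u \<in> phom Z (W (W X)) \<and> pcomp (\<mu> X) u = a \<and>
      pcomp (W_map (W_map f)) u = b"
    then have uh: "u \<in> phom Z (W (W X))" by simp
    have ub: "ap b h z = ap (W_map (W_map f)) h (ap u h z)"
      and ua: "ap a h z = ap (\<mu> X) h (ap u h z)" if "z \<in> elts Z h" for h z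
      using u ap_comp[OF uh WWf that] ap_comp[OF uh mX that] by auto
    have su: "sel (W X) h (ap u h z) = s h z" if "z \<in> elts Z h" for h z
      using sel_W_endo[OF Wf ap_in[OF uh that]] by (simp add: s_def ub[OF that])
    obtain m where m: "m \<in> phom (nodes Z s) (W X)" "pcomp (W_map m) (generic Z s) = u"
      "\<And>h z. z \<in> elts Z h \<Longrightarrow> ap m (lab_ob h (s h z)) (node h z) = lab (W X) h (ap u h z)"
      using ex_mate[OF cx uh WX] su by auto
    have "m = l"
    proof (rule arrow_eqI[OF X m(1) l(1)])
      fix d c assume c: "c \<in> elts (nodes Z s) d"
      then obtain h z where hz: "c = node h z" "z \<in> elts Z h" "d = lab_ob h (s h z)" by (auto simp: elts_nodes)
      note uz = ap_in[OF uh hz(2)]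
      note lu = lab_in[OF WX uz, unfolded su[OF hz(2)]]
      have "s' h z = sel X (lab_ob h (s h z)) (lab (W X) h (ap u h z))"
        using lab_W_endo[OF Wf uz] sel_W_endo[OF f lu] by (simp add: s'_def ub[OF hz(2)] su[OF hz(2)])
      then show "sel X d (ap m d c) = sel X d (ap l d c)"
        using m(3)[OF hz(2)] l(2)[OF hz(2)] by (simp add: hz(1,3))
      show "lab X d (ap m d c) = lab X d (ap l d c)"
        using m(3)[OF hz(2)] l(3)[OF hz(2)] lab_mult[OF X uz] by (simp add: hz(1,3) ua[OF hz(2)] su[OF hz(2)])
    qed
    then show "u = pcomp (W_map l) (generic Z s)" using m(2) by simp
  qed
qed

text \<open>
  The left adjoint sends \<open>F : Y \<rightarrow> W X\<close> to the labelling of its nodes by elements of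
  \<open>X\<close>; the generic arrow is the unit.
\<close>

lemma local_right_adjoint_W: "local_right_adjoint psh_cat psh_cat (W_endo :: 'u::infinite psh_funct)"
  unfolding local_right_adjoint_def
proof (intro conjI ballI is_functor_W)
  fix X :: "'u psh" assume "X \<in> Ob psh_cat"
  then have X: "is_psh X" by (simp add: Ob_psh)
  let ?S = "slice psh_cat X" and ?R = "slice psh_cat (on_ob W_endo X)"
  show "is_right_adjoint ?S ?R (slice_funct W_endo)"
  proof (rule right_adjoint_if_universal_arrows[OF is_functor_slice[OF is_functor_W]])
    fix F assume "F \<in> Ob ?R"
    then obtain Y where F: "F \<in> phom Y (W X)" by (auto simp: slice_def hom_def)
    define s where "s = (\<lambda>h y. sel X h (ap F h y))"
    note cx = F X s_def
    obtain m where m: "m \<in> phom (nodes Y s) X" "pcomp (W_map m) (generic Y s) = F"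
      "\<And>h y. y \<in> elts Y h \<Longrightarrow> ap m (lab_ob h (s h y)) (node h y) = lab X h (ap F h y)"
      using ex_mate[OF cx F X] by (auto simp: s_def)
    note gen = generic(1)[OF cx]
    show "\<exists>b u. b \<in> Ob ?S \<and> u \<in> hom ?R F (on_ob (slice_funct W_endo) b) \<and>
      (\<forall>b'\<in>Ob ?S. \<forall>k\<in>hom ?R F (on_ob (slice_funct W_endo) b').
         \<exists>!n. n \<in> hom ?S b b' \<and> Cmp ?R (on_ar (slice_funct W_endo) n) u = k)"
    proof (intro exI[of _ m] exI[of _ "(F, generic Y s, W_map m)"] conjI ballI)
      show "m \<in> Ob ?S" using homD[OF m(1)] by (simp add: slice_def)
      show "(F, generic Y s, W_map m) \<in> hom ?R F (on_ob (slice_funct W_endo) m)"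
        unfolding hom_slice using homD[OF F] homD[OF W_endo_hom[OF m(1)]] gen m(2) by (simp add: slice_funct_def)
      fix g k assume "g \<in> Ob ?S" and k: "k \<in> hom ?R F (on_ob (slice_funct W_endo) g)"
      then obtain Z where g: "g \<in> phom Z X" by (auto simp: slice_def hom_def)
      note Wg = W_endo_hom[OF g]
      obtain \<kappa> where \<kappa>: "k = (F, \<kappa>, W_map g)" "\<kappa> \<in> phom Y (W Z)" "pcomp (W_map g) \<kappa> = F"
        using k homD[OF F] homD[OF Wg] unfolding hom_slice by (auto simp: slice_funct_def)
      have "sel Z h (ap \<kappa> h y) = s h y" if "y \<in> elts Y h" for h y
        using ap_comp[OF \<kappa>(2) Wg that] sel_W_endo[OF g ap_in[OF \<kappa>(2) that]] by (simp add: s_def \<kappa>(3))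
      then obtain n where n: "n \<in> phom (nodes Y s) Z" "pcomp (W_map n) (generic Y s) = \<kappa>"
        using ex_mate[OF cx \<kappa>(2) hom_psh(1)[OF g]] by blast
      have gn: "pcomp g n = m"
        by (rule mate_inj[OF cx comp_hom_psh[OF n(1) g] m(1)])
           (use comp_assoc[OF category_psh gen W_endo_hom[OF n(1)] Wg] W_endo_comp[OF n(1) g] n(2) m(2) \<kappa>(3) in simp)
      show "\<exists>!n. n \<in> hom ?S m g \<and> Cmp ?R (on_ar (slice_funct W_endo) n) (F, generic Y s, W_map m) = k"
      proof (rule ex1I[of _ "(m, n, g)"])
        show "(m, n, g) \<in> hom ?S m g \<and> Cmp ?R (on_ar (slice_funct W_endo) (m, n, g)) (F, generic Y s, W_map m) = k"
          unfolding hom_slice using homD[OF m(1)] homD[OF g] n gn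
          by (simp add: \<kappa>(1), simp add: slice_def slice_funct_def)
      next
        fix n' assume n': "n' \<in> hom ?S m g \<and> Cmp ?R (on_ar (slice_funct W_endo) n') (F, generic Y s, W_map m) = k"
        then obtain n2 where n2: "n' = (m, n2, g)" "n2 \<in> phom (nodes Y s) Z"
          using homD[OF m(1)] homD[OF g] unfolding hom_slice by auto
        have "pcomp (W_map n2) (generic Y s) = \<kappa>"
          using n' by (simp add: n2(1) \<kappa>(1) slice_def slice_funct_def)
        then show "n' = (m, n, g)" using mate_inj[OF cx n2(2) n(1)] n(2) n2(1) by simp
      qed
    qed
  qed
qed

theorem proposition46:
  shows "strongly_cartesian_monad (psh_cat :: ('u::infinite psh, 'u psh_arrow) cat) weakening_monad"
  unfolding strongly_cartesian_monad_def cartesian_monad_def cartesian_nat_trans_def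
proof (intro conjI ballI is_monad preserves_pullbacks_W unit_nat_trans mult_nat_trans local_right_adjoint_W)
  fix f :: "'u psh_arrow" assume "f \<in> Ar psh_cat"
  note f = hom_arrow[OF this]
  show "is_pullback psh_cat (unit weakening_monad (Dom psh_cat f)) (on_ar id_funct f) (W_map f)
      (unit weakening_monad (Cod psh_cat f))"
    using unit_cartesian[OF f] by (simp add: unit_eq id_funct_def)
  show "is_pullback psh_cat (\<mu> (Dom psh_cat f)) (on_ar (W_endo \<cdot> W_endo) f) (W_map f)
      (\<mu> (Cod psh_cat f))"
    using mult_cartesian[OF f] by (simp add: comp_funct_def)
qed

end
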